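(* Let $G(T) := \sum_{0<\gamma\le T} 1/\gamma$, where $\gamma$ runs over the ordinates of the nontrivial zeros $\rho=\beta+i\gamma$ of the Riemann zeta-function with $0<\gamma\le T$, counted with multiplicity. Then the limit \[ H := \lim_{T\to\infty}\left(G(T) - \frac{\log^2(T/2\pi)}{4\pi}\right) \] exists, and \[ H = \int_{2\pi}^\infty \frac{Q(t)}{t^2}\,dt - \frac{1}{16\pi}, \] where $Q(t) := N(t) - L(t)$.
   Context: $N(T)$ denotes the number of nontrivial zeros $\beta+i\gamma$ of $\zeta(s)$ with $0<\gamma\le T$, counted with multiplicity. $L(T) := \frac{T}{2\pi}\left(\log\frac{T}{2\pi} - 1\right) + \frac78$, and $Q(T) := N(T)-L(T)$ for $T>0$. *)

theory Defs
  imports "HOL-Complex_Analysis.Complex_Analysis"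
begin

(* The Riemann zeta function is the analytic continuation to the plane minus {1} of its Dirichlet
   series; the identity theorem makes it unique there. The value 0 at the pole only makes the
   total function unique; the pole itself is never counted as a zero below. *)
definition zeta :: "complex \<Rightarrow> complex" where
  "zeta = (THE f. f holomorphic_on - {1} \<and>
                  (\<forall>s. Re s > 1 \<longrightarrow> (\<lambda>n. of_nat (Suc n) powr (- s)) sums f s) \<and>
                  f 1 = 0)"

definition trivial_zeros :: "complex set" where
  "trivial_zeros = {- of_nat (2 * n) | n. n \<ge> 1}"

definition nontrivial_zeros :: "complex set" where
  "nontrivial_zeros = {s. s \<noteq> 1 \<and> zeta s = 0} - trivial_zeros"

definition zeros_upto :: "real \<Rightarrow> complex set" where
  "zeros_upto T = {\<rho> \<in> nontrivial_zeros. 0 < Im \<rho> \<and> Im \<rho> \<le> T}"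

(* At a zero rho of zeta, zorder zeta rho is its multiplicity, a positive integer. *)
definition N :: "real \<Rightarrow> int" where
  "N T = (\<Sum>\<rho>\<in>zeros_upto T. zorder zeta \<rho>)"

definition G :: "real \<Rightarrow> real" where
  "G T = (\<Sum>\<rho>\<in>zeros_upto T. of_int (zorder zeta \<rho>) * (1 / Im \<rho>))"

definition L :: "real \<Rightarrow> real" where
  "L T = T / (2 * pi) * (ln (T / (2 * pi)) - 1) + 7 / 8"

definition Q :: "real \<Rightarrow> real" where
  "Q T = of_int (N T) - L T"

end

(* The trapezoid rule on the intervals [n, n+1] continues (s-1) zeta(s) to Re s > -1. Writing the
   trapezoid errors of u^-s as Mellin transforms of those of exp(-x u), summing over n and expanding
   the resulting kernel 1/(e^x - 1) - 1/x + 1/2 into partial fractions gives the functional equation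
   for -1 < s < 0, hence an entire xi with xi(1 - s) = xi(s); put Xi(z) = xi(1/2 + z), an even function.

   Jensen's formula on |z| = R, with Stirling's formula for |Xi| away from the imaginary axis and a
   minimum modulus theorem near it, determines the sum of ln(R/|w|) over the zeros w of Xi up to
   O(ln^2 R). The number of zeros is monotone in R, so difference quotients of this sum recover it
   with a power saving: Q(T) = O(T^(4/5)), and the integral of Q(t)/t^2 converges.

   The integral starts at 2 pi, so one also needs that no zero has 0 < gamma <= 2 pi. The sum of
   Re 1/(1 - rho) over all zeros is xi'(1)/xi(1) = 1 + (Euler's constant)/2 - ln(4 pi)/2 = 0.0230...,
   and all its terms are nonnegative, whereas rho and 1 - rho with such an ordinate would contribute
   at least 1/(1 + 4 pi^2) = 0.0247... . Partial summation then gives the formula. *)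

theory Submission
  imports Defs "HOL-Real_Asymp.Real_Asymp"
begin

section \<open>Zeros of analytic functions: Jensen, Borel-Caratheodory, minimum modulus\<close>

text \<open>Jensen's formula uses only the modulus of \<open>Xi\<close> on circles, so no argument
  of zeta along horizontal lines has to be bounded. The price is an error that is a power of T
  instead of ln T; an exponent below 1 makes both Q(t)/t^2 integrable and Q(T)/T vanish in the
  limit. The trapezoid rule suits the functional equation: the half-planes Re s > -1 and Re (1 - s)
  > -1 cover the plane and overlap in a strip. For -1 < s < 0 the Dirichlet series at 1 - s
  converges and all Mellin integrands are nonnegative, so Tonelli's theorem settles every exchange
  of sum and integral. At the lowest zero the numerical margin is below 0.002, hence the explicit
  bounds for ln 2, ln pi and Euler's constant. There the infinite sum over zeros is never formed: a
  sum over a large disc replaces it, and its remainder is small because the logarithmic derivative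
  of an even function vanishes at the centre. The constant -1/(16 pi) comes from L alone: 7/(16 pi)
  from the lower end of the integral of L(t)/t^2, and -1/(2 pi) from the boundary term
  L(T)/T.\<close>

lemma finite_zeros_ball:
  fixes f :: "complex \<Rightarrow> complex"
  assumes "f holomorphic_on UNIV" "f z0 \<noteq> 0" "bounded B"
  shows "finite {z \<in> B. f z = 0}"
proof -
  obtain a where "\<forall>x\<in>B. norm x \<le> a"
    using assms(3) unfolding bounded_iff by blast
  then have B: "B \<subseteq> cball 0 a" by auto
  have "finite {z \<in> cball 0 a. f z = 0}"
  proof (rule ccontr)
    assume "infinite {z \<in> cball 0 a. f z = 0}"
    then obtain x where x: "x islimpt {z \<in> cball 0 a. f z = 0}"
      using compact_eq_Bolzano_Weierstrass[of "cball (0::complex) a"] by auto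
    have "f z0 = 0"
      by (rule analytic_continuation[OF assms(1) open_UNIV connected_UNIV _ UNIV_I x _ UNIV_I]) auto
    with assms(2) show False by simp
  qed
  then show ?thesis by (rule rev_finite_subset) (use B in auto)
qed

text \<open>Multiplicity as a natural number, so that it can serve as an exponent. For an entire
  function that is not identically zero \<open>zorder\<close> is nonnegative, so \<open>nat\<close>
  loses nothing.\<close>

definition zmult :: "(complex \<Rightarrow> complex) \<Rightarrow> complex \<Rightarrow> nat" where
  "zmult f z = nat (zorder f z)"

lemma zorder_entire:
  fixes f :: "complex \<Rightarrow> complex"
  assumes f: "f holomorphic_on UNIV" and f0: "f z0 \<noteq> 0"
  shows "zorder f z > 0 \<longleftrightarrow> f z = 0" "zorder f z \<ge> 0"
proof -
  have "eventually (\<lambda>z. f z \<noteq> 0) (at z)"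
    using non_zero_neighbour_alt[OF f open_UNIV connected_UNIV UNIV_I UNIV_I f0, of z] by simp
  then have freq: "frequently (\<lambda>z. f z \<noteq> 0) (at z)"
    by (intro eventually_frequently) auto
  show "zorder f z > 0 \<longleftrightarrow> f z = 0"
    by (rule zorder_pos_iff[OF f open_UNIV UNIV_I freq])
  show "zorder f z \<ge> 0"
    by (rule zorder_ge_0[OF _ freq]) (use f in \<open>simp add: analytic_on_holomorphic\<close>, blast)
qed

lemma zmult_ge_1:
  assumes "f holomorphic_on UNIV" "f z0 \<noteq> 0" "f w = 0"
  shows "1 \<le> real (zmult f w)"
  using zorder_entire(1)[OF assms(1,2), of w] assms(3) by (simp add: zmult_def)

section \<open>Blaschke factorization on a disc\<close>

lemma ball_neighbourhood_of_cball:
  fixes U :: "complex set"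
  assumes "open U" "cball 0 r \<subseteq> U" "0 < r"
  obtains r' where "r' > r" "ball 0 r' \<subseteq> U"
proof -
  obtain e where e: "e > 0" "(\<Union>x\<in>cball 0 r. ball x e) \<subseteq> U"
    using compact_subset_open_imp_ball_epsilon_subset[OF compact_cball assms(1,2)] .
  have "z \<in> U" if "z \<in> ball 0 (r + e)" for z
  proof (cases "cmod z \<le> r")
    case True
    then show ?thesis using assms(2) by auto
  next
    case False
    \<comment> \<open>The radial projection of z to the circle of radius r; its distance from z is
      cmod z - r < e.\<close>
    define x where "x = of_real (r / cmod z) * z"
    have zpos: "cmod z > 0" using False assms(3) by linarith
    have x: "cmod x = r" using zpos assms(3) by (simp add: x_def norm_mult norm_divide)
    have "z - x = of_real (1 - r / cmod z) * z" by (simp add: x_def algebra_simps)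
    then have "cmod (z - x) = \<bar>1 - r / cmod z\<bar> * cmod z" by (simp only: norm_mult norm_of_real)
    also have "\<dots> = cmod z - r" using False zpos assms(3) by (simp add: field_simps abs_if)
    finally have "z \<in> ball x e" using that by (simp add: dist_norm norm_minus_commute)
    then show ?thesis using e(2) x by force
  qed
  then show ?thesis
    by (intro that[of "r + e"]) (use e(1) in auto)
qed

text \<open>On the circle \<open>r\<^sup>2\<close> equals z * cnj z, which makes the left side z
  times a conjugate of z - w. Hence r (z - w) / (r^2 - cnj w z) has modulus 1 there.\<close>

lemma norm_blaschke_factor:
  fixes z w :: complex
  assumes "cmod z = r" "0 < r"
  shows "cmod ((of_real r)\<^sup>2 - cnj w * z) = r * cmod (z - w)"
proof -
  have "(of_real r)\<^sup>2 = z * cnj z" using complex_norm_square[of z] assms(1) by simp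
  then have "(of_real r)\<^sup>2 - cnj w * z = z * cnj (z - w)" by (simp add: algebra_simps)
  then show ?thesis using assms by (simp add: norm_mult flip: complex_cnj_diff)
qed

lemma blaschke_denominator_nonzero:
  fixes z w :: complex
  assumes "cmod z \<le> r" "cmod w < r"
  shows "(of_real r)\<^sup>2 - cnj w * z \<noteq> 0"
proof
  assume "(of_real r)\<^sup>2 - cnj w * z = 0"
  then have "(of_real r)\<^sup>2 = cnj w * z" by simp
  then have "cmod ((of_real r)\<^sup>2) = cmod (cnj w * z)" by (rule arg_cong)
  then have "r * r = cmod w * cmod z"
    by (simp add: norm_mult norm_power power2_eq_square)
  moreover have "cmod w * cmod z \<le> cmod w * r" by (intro mult_left_mono assms) auto
  moreover have "cmod w * r < r * r" using assms by (intro mult_strict_right_mono) (auto intro: le_less_trans[OF norm_ge_zero])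
  ultimately show False by simp
qed

text \<open>Dividing f by Blaschke factors removes its zeros in the disc without changing its
  modulus on the circle, and the value of the quotient at 0 records the logarithmic sum over the
  zeros. The same F serves Jensen's formula, the zero count, the minimum modulus theorem and the
  logarithmic derivative. It is zero-free on a larger open disc, so that its logarithm exists across
  the circle.\<close>

lemma blaschke_factorization:
  fixes f :: "complex \<Rightarrow> complex"
  assumes f: "f holomorphic_on UNIV" and f0: "f 0 \<noteq> 0" and r: "0 < r"
    and sph: "\<And>z. cmod z = r \<Longrightarrow> f z \<noteq> 0"
  defines "S \<equiv> {z \<in> ball 0 r. f z = 0}"
  obtains F r' where "r' > r" "F holomorphic_on ball 0 r'" "\<And>z. z \<in> ball 0 r' \<Longrightarrow> F z \<noteq> 0"
    "\<And>z. z \<in> cball 0 r \<Longrightarrow>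
       f z = F z * (\<Prod>w\<in>S. (of_real r * (z - w) / ((of_real r)\<^sup>2 - cnj w * z)) ^ zmult f w)"
    "\<And>z. cmod z = r \<Longrightarrow> cmod (F z) = cmod (f z)"
    "ln (cmod (F 0)) = ln (cmod (f 0)) + (\<Sum>w\<in>S. real (zmult f w) * ln (r / cmod w))"
proof -
  have fin: "finite S" unfolding S_def by (rule finite_zeros_ball[OF f f0 bounded_ball])
  have opn: "open (ball 0 r \<union> f -` (- {0}))"
    by (intro open_Un open_ball open_vimage[OF _ holomorphic_on_imp_continuous_on[OF f]]) auto
  have sub: "cball 0 r \<subseteq> ball 0 r \<union> f -` (- {0})" using sph by fastforce
  \<comment> \<open>On this larger disc f still has no zeros besides those in S. So f and the
    polynomial P have the same zeros with the same orders there, and f / P extends to the zero-free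
    h below.\<close>
  obtain r' where r': "r' > r" "ball 0 r' \<subseteq> ball 0 r \<union> f -` (- {0})"
    using ball_neighbourhood_of_cball[OF opn sub r] .
  define A where "A = ball (0::complex) r'"
  have zeros_A: "z \<in> S" if "z \<in> A" "f z = 0" for z
    using r'(2) that by (force simp: A_def S_def)
  have S_A: "S \<subseteq> A" using r' by (auto simp: S_def A_def)
  define P where "P = (\<lambda>z. \<Prod>w\<in>S. (z - w) ^ zmult f w)"
  note zpos = zorder_entire(1)[OF f f0] and zge = zorder_entire(2)[OF f f0]
  have Pholo: "P holomorphic_on UNIV" unfolding P_def by (intro holomorphic_intros)
  have P0: "P z = 0 \<longleftrightarrow> z \<in> S" for z
    unfolding P_def using fin zpos by (auto simp: zmult_def S_def)
  have zo: "zorder P z = zorder f z" if "z \<in> A" for z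
  proof (cases "z \<in> S")
    case False
    then have "zorder P z = 0"
      by (intro zorder_eq_0I) (use Pholo P0 in \<open>auto simp: analytic_on_holomorphic\<close>)
    moreover have "zorder f z = 0" using False zeros_A[OF that] zpos[of z] zge[of z] by fastforce
    ultimately show ?thesis by simp
  next
    case True
    show ?thesis
    proof (rule zorder_eqI)
      show "open (- (S - {z}))" using fin by (intro open_Compl finite_imp_closed) auto
      show "z \<in> - (S - {z})" by auto
      show "(\<lambda>u. \<Prod>w\<in>S-{z}. (u - w) ^ zmult f w) holomorphic_on - (S - {z})" by (intro holomorphic_intros)
      show "(\<Prod>w\<in>S-{z}. (z - w) ^ zmult f w) \<noteq> 0" using fin by auto
      show "P u = (\<Prod>w\<in>S-{z}. (u - w) ^ zmult f w) * (u - z) powi zorder f z"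
        if "u \<in> - (S - {z})" "u \<noteq> z" for u
        using True fin zge[of z] by (simp add: P_def prod.remove[of S z] zmult_def power_int_def)
    qed
  qed
  obtain h where h: "h holomorphic_on A" "\<And>z. z \<in> A \<Longrightarrow> h z \<noteq> 0" "\<And>z. z \<in> A \<Longrightarrow> f z = h z * P z"
  proof (rule holomorphic_zorder_factorization[of f A P])
    show "f holomorphic_on A" "P holomorphic_on A"
      using f Pholo holomorphic_on_subset by blast+
    show "open A" "connected A" by (auto simp: A_def)
    show "P z = 0 \<longleftrightarrow> f z = 0" if "z \<in> A" for z
      using P0 zeros_A[OF that] by (auto simp: S_def)
    show "zorder P z = zorder f z" if "z \<in> A" for z using zo that .
  qed (rule that)
  define F where "F = (\<lambda>z. h z * (\<Prod>w\<in>S. (((of_real r)\<^sup>2 - cnj w * z) / of_real r) ^ zmult f w))"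
  have cb: "cball 0 r \<subseteq> A" using r' by (auto simp: A_def)
  have ne: "(of_real r)\<^sup>2 - cnj w * z \<noteq> 0" if "z \<in> cball 0 r" "w \<in> S" for z w
    using blaschke_denominator_nonzero[of z r w] that by (auto simp: S_def)
  have Fholo: "F holomorphic_on ball 0 r'"
    unfolding F_def using h(1) r by (intro holomorphic_intros) (auto simp: A_def)
  have Fne: "F z \<noteq> 0" if "z \<in> cball 0 r" for z
    using that h(2) cb fin ne r by (auto simp: F_def prod_zero_iff)
  have "open {z \<in> ball 0 r'. F z \<in> - {0}}"
    by (rule continuous_open_preimage[OF holomorphic_on_imp_continuous_on[OF Fholo], unfolded vimage_def Int_def mem_Collect_eq]) auto
  moreover have "cball 0 r \<subseteq> {z \<in> ball 0 r'. F z \<in> - {0}}" using Fne r' by auto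
  \<comment> \<open>A second enlargement: the factors r^2 - cnj w z contained in F vanish at r^2 /
    cnj w, which lies outside the closed disc but may lie inside \<open>ball 0 r'\<close>.\<close>
  ultimately obtain r'' where r'': "r'' > r" "ball 0 r'' \<subseteq> {z \<in> ball 0 r'. F z \<in> - {0}}"
    by (rule ball_neighbourhood_of_cball[OF _ _ r])
  have Fholo': "F holomorphic_on ball 0 r''"
    by (rule holomorphic_on_subset[OF Fholo]) (use r'' in auto)
  have Fne': "F z \<noteq> 0" if "z \<in> ball 0 r''" for z using r''(2) that by auto
  have fF: "f z = F z * (\<Prod>w\<in>S. (of_real r * (z - w) / ((of_real r)\<^sup>2 - cnj w * z)) ^ zmult f w)"
    if "z \<in> cball 0 r" for z
  proof -
    have "P z = (\<Prod>w\<in>S. (((of_real r)\<^sup>2 - cnj w * z) / of_real r) ^ zmult f w) *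
        (\<Prod>w\<in>S. (of_real r * (z - w) / ((of_real r)\<^sup>2 - cnj w * z)) ^ zmult f w)"
      unfolding P_def prod.distrib[symmetric] power_mult_distrib[symmetric]
      using ne[OF that] r by (intro prod.cong refl) simp
    then show ?thesis using h(3)[of z] that cb by (auto simp: F_def)
  qed
  have norm_eq: "cmod (F z) = cmod (f z)" if "cmod z = r" for z
  proof -
    have "cmod (of_real r * (z - w) / ((of_real r)\<^sup>2 - cnj w * z)) = 1" if "w \<in> S" for w
      using norm_blaschke_factor[OF \<open>cmod z = r\<close> r, of w] ne[OF _ that, of z] \<open>cmod z = r\<close> r
      by (auto simp: norm_divide norm_mult)
    then have "cmod (\<Prod>w\<in>S. (of_real r * (z - w) / ((of_real r)\<^sup>2 - cnj w * z)) ^ zmult f w) = 1"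
      by (simp add: prod_norm[symmetric] norm_power)
    then show ?thesis using fF[of z] that by (simp add: norm_mult)
  qed
  have F0: "ln (cmod (F 0)) = ln (cmod (f 0)) + (\<Sum>w\<in>S. real (zmult f w) * ln (r / cmod w))"
  proof -
    have w0: "w \<noteq> 0" if "w \<in> S" for w using that f0 by (auto simp: S_def)
    have "cmod (f 0) = cmod (F 0) * (\<Prod>w\<in>S. (cmod w / r) ^ zmult f w)"
      using fF[of 0] r by (simp add: norm_mult prod_norm[symmetric] norm_power norm_divide power2_eq_square)
    then have "ln (cmod (f 0)) = ln (cmod (F 0)) + ln (\<Prod>w\<in>S. (cmod w / r) ^ zmult f w)"
      using Fne[of 0] w0 r by (subst ln_mult_pos[symmetric]) (auto intro!: prod_pos)
    also have "ln (\<Prod>w\<in>S. (cmod w / r) ^ zmult f w) = (\<Sum>w\<in>S. real (zmult f w) * ln (cmod w / r))"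
      using w0 r by (subst ln_prod) (auto simp: ln_realpow fin)
    also have "\<dots> = - (\<Sum>w\<in>S. real (zmult f w) * ln (r / cmod w))"
      using w0 r unfolding sum_negf[symmetric] by (intro sum.cong refl) (auto simp: ln_div algebra_simps)
    finally show ?thesis by simp
  qed
  show ?thesis by (rule that[OF r''(1) Fholo' Fne' fF norm_eq F0])
qed

text \<open>The half-plane Re < B is mapped to the unit disc by k / (2 B - k), fixing 0; Schwarz's
  lemma applied to the image of h - h 0 and solved for k gives the bound.\<close>

lemma borel_caratheodory:
  fixes h :: "complex \<Rightarrow> complex"
  assumes h: "h holomorphic_on ball 0 R" and A: "\<And>z. z \<in> ball 0 R \<Longrightarrow> Re (h z) \<le> A"
    and z: "cmod z < R"
  shows "cmod (h z - h 0) \<le> 2 * (A - Re (h 0)) * cmod z / (R - cmod z)"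
proof -
  have R: "R > 0" using z by (meson le_less_trans norm_ge_zero)
  \<comment> \<open>A constant B strictly above A - Re (h 0) keeps B positive and the Moebius map
    strictly inside the disc, even for constant h; afterwards B tends to A - Re (h 0).\<close>
  have "cmod (h z - h 0) \<le> 2 * B * cmod z / (R - cmod z)" if B: "B > A - Re (h 0)" for B
  proof -
    have "A \<ge> Re (h 0)" using A[of 0] R by auto
    then have Bpos: "B > 0" using B by linarith
    define k where "k = (\<lambda>u. h (of_real R * u) - h 0)"
    have mem: "of_real R * u \<in> ball 0 R" if "cmod u < 1" for u :: complex
      using that R by (simp add: norm_mult)
    have kB: "Re (k u) < B" if "cmod u < 1" for u
      using A[OF mem[OF that]] B by (simp add: k_def)
    have kne: "2 * of_real B - k u \<noteq> 0" if "cmod u < 1" for u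
      using kB[OF that] Bpos by (auto simp: complex_eq_iff)
    have "(h \<circ> (\<lambda>u. of_real R * u)) holomorphic_on ball 0 1"
      by (rule holomorphic_on_compose_gen[OF _ h]) (use mem in \<open>auto intro!: holomorphic_intros\<close>)
    then have kholo: "k holomorphic_on ball 0 1" unfolding k_def o_def by (intro holomorphic_intros)
    define p where "p = (\<lambda>u. k u / (2 * of_real B - k u))"
    have pholo: "p holomorphic_on ball 0 1"
      unfolding p_def using kne by (intro holomorphic_intros kholo) auto
    have p0: "p 0 = 0" by (simp add: p_def k_def)
    have plt: "cmod (p u) < 1" if "cmod u < 1" for u
    proof -
      have "(Re (k u))\<^sup>2 < (2 * B - Re (k u))\<^sup>2"
      proof -
        have "(2 * B - Re (k u))\<^sup>2 - (Re (k u))\<^sup>2 = 4 * B * (B - Re (k u))"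
          by (simp add: power2_eq_square algebra_simps)
        also have "\<dots> > 0" using Bpos kB[OF that] by simp
        finally show ?thesis by simp
      qed
      then have "cmod (k u) < cmod (2 * of_real B - k u)"
        by (simp add: cmod_def)
      then show ?thesis using kne[OF that] by (simp add: p_def norm_divide)
    qed
    define u where "u = z / of_real R"
    have u1: "cmod u < 1" using z R by (simp add: u_def norm_divide)
    have pu: "cmod (p u) \<le> cmod u" using Schwarz_Lemma(1)[OF pholo p0 plt u1] .
    have "k u * (1 + p u) = 2 * of_real B * p u"
      using kne[OF u1] by (simp add: p_def field_simps)
    then have "cmod (k u) * cmod (1 + p u) = 2 * B * cmod (p u)"
    proof -
      assume eq: "k u * (1 + p u) = 2 * of_real B * p u"
      have "cmod (k u * (1 + p u)) = cmod (2 * of_real B * p u)" by (simp only: eq)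
      then show ?thesis using Bpos by (simp only: norm_mult norm_numeral norm_of_real abs_of_pos)
    qed
    moreover have "1 - cmod u \<le> cmod (1 + p u)"
      using pu norm_diff_ineq[of 1 "p u"] by simp
    ultimately have "cmod (k u) * (1 - cmod u) \<le> 2 * B * cmod u"
      using pu Bpos by (smt (verit) mult_left_mono norm_ge_zero)
    then have "cmod (k u) \<le> 2 * B * cmod u / (1 - cmod u)" using u1 by (simp add: field_simps)
    also have "\<dots> = 2 * B * cmod z / (R - cmod z)" using R z by (simp add: u_def norm_divide field_simps)
    finally show ?thesis using R by (simp add: k_def u_def)
  qed
  then have "\<forall>B>A - Re (h 0). cmod (h z - h 0) \<le> B * (2 * cmod z / (R - cmod z))"
    by (simp add: mult_ac)
  then have ev: "eventually (\<lambda>B. cmod (h z - h 0) \<le> B * (2 * cmod z / (R - cmod z))) (at_right (A - Re (h 0)))"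
    by (auto simp: eventually_at_filter)
  have lim: "((\<lambda>B. B * (2 * cmod z / (R - cmod z))) \<longlongrightarrow> (A - Re (h 0)) * (2 * cmod z / (R - cmod z))) (at_right (A - Re (h 0)))"
    by (intro tendsto_mult tendsto_ident_at tendsto_const)
  have "cmod (h z - h 0) \<le> (A - Re (h 0)) * (2 * cmod z / (R - cmod z))"
    by (rule tendsto_lowerbound[OF lim ev trivial_limit_at_right_real])
  then show ?thesis by (simp add: mult_ac)
qed


text \<open>The mean value property of Re (ln F), where F is the zero-free quotient of the Blaschke
  factorization. The unimodular c fixes the starting point of the circle: with c =
  \<open>- \<i>\<close> the first half of the parameter interval runs through the right half
  circle.\<close>

lemma jensen_circle:
  fixes f :: "complex \<Rightarrow> complex"
  assumes f: "f holomorphic_on UNIV" and f0: "f 0 \<noteq> 0" and r: "0 < r"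
    and sph: "\<And>z. cmod z = r \<Longrightarrow> f z \<noteq> 0" and c: "cmod c = 1"
  shows "((\<lambda>t. ln (cmod (f (c * of_real r * cis (2 * pi * t))))) has_integral
      (ln (cmod (f 0)) + (\<Sum>w\<in>{z \<in> ball 0 r. f z = 0}. real (zmult f w) * ln (r / cmod w)))) {0..1}"
proof -
  obtain r' F where F: "r' > r" "F holomorphic_on ball 0 r'" "\<And>z. z \<in> ball 0 r' \<Longrightarrow> F z \<noteq> 0"
    "\<And>z. z \<in> cball 0 r \<Longrightarrow> f z = F z * (\<Prod>w\<in>{z \<in> ball 0 r. f z = 0}.
       (of_real r * (z - w) / ((of_real r)\<^sup>2 - cnj w * z)) ^ zmult f w)"
    "\<And>z. cmod z = r \<Longrightarrow> cmod (F z) = cmod (f z)"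
    "ln (cmod (F 0)) = ln (cmod (f 0)) + (\<Sum>w\<in>{z \<in> ball 0 r. f z = 0}. real (zmult f w) * ln (r / cmod w))"
    by (rule blaschke_factorization[OF f f0 r]) (erule sph, rule that)
  obtain h where h: "h holomorphic_on ball 0 r'" "\<And>z. z \<in> ball 0 r' \<Longrightarrow> exp (h z) = F z"
    using holomorphic_logarithm_exists[OF convex_ball open_ball F(2,3), of 0] F(1) r by auto
  define H where "H = (\<lambda>z. h (c * z))"
  have "(h \<circ> (\<lambda>z. c * z)) holomorphic_on cball 0 r"
    by (rule holomorphic_on_compose_gen[OF _ h(1)]) (use F(1) c in \<open>auto intro!: holomorphic_intros simp: norm_mult\<close>)
  then have "H holomorphic_on cball 0 r" by (simp add: H_def o_def)
  from Cauchy_integral_circlepath_simple[OF this, of 0] r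
  have "((\<lambda>u. H u / u) has_contour_integral (2 * of_real pi * \<i> * H 0)) (circlepath 0 r)" by simp
  then have "((\<lambda>t. H (of_real r * cis (2 * pi * t)) * (2 * of_real pi * \<i>)) has_integral (2 * of_real pi * \<i> * H 0)) {0..1}"
    unfolding has_contour_integral_def
  proof (rule has_integral_eq[rotated])
    fix t :: real assume t: "t \<in> {0..1}"
    have cp: "circlepath 0 r t = of_real r * cis (2 * pi * t)"
      by (simp add: circlepath cis_conv_exp mult_ac)
    have vd: "vector_derivative (circlepath 0 r) (at t within {0..1}) = 2 * of_real pi * \<i> * (of_real r * cis (2 * pi * t))"
      using vector_derivative_circlepath01[of t 0 r] t by (simp add: cis_conv_exp mult_ac)
    show "H (circlepath 0 r t) / circlepath 0 r t * vector_derivative (circlepath 0 r) (at t within {0..1})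
        = H (of_real r * cis (2 * pi * t)) * (2 * of_real pi * \<i>)"
      unfolding cp vd using r by (simp add: field_simps)
  qed
  from has_integral_mult_left[OF this, of "1 / (2 * of_real pi * \<i>)"]
  have "((\<lambda>t. H (of_real r * cis (2 * pi * t))) has_integral H 0) {0..1}"
    by simp
  from has_integral_linear[OF this bounded_linear_Re]
  have *: "((\<lambda>t. Re (h (c * of_real r * cis (2 * pi * t)))) has_integral Re (h 0)) {0..1}"
    by (simp add: o_def H_def mult.assoc)
  have Re_h: "Re (h z) = ln (cmod (F z))" if "z \<in> ball 0 r'" for z
    using h(2)[OF that, symmetric] by simp
  have "Re (h 0) = ln (cmod (F 0))" using Re_h[of 0] F(1) r by simp
  moreover have "Re (h (c * of_real r * cis (2 * pi * t))) = ln (cmod (f (c * of_real r * cis (2 * pi * t))))" for t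
    using Re_h[of "c * of_real r * cis (2 * pi * t)"] F(5)[of "c * of_real r * cis (2 * pi * t)"] F(1) c r
    by (simp add: norm_mult)
  ultimately show ?thesis using * F(6) by simp
qed

lemma exists_zero_free_radius:
  fixes f :: "complex \<Rightarrow> complex"
  assumes f: "f holomorphic_on UNIV" "f 0 \<noteq> 0" and ab: "a < b"
  obtains r where "a < r" "r < b" "\<And>z. cmod z = r \<Longrightarrow> f z \<noteq> 0"
proof -
  have "finite (cmod ` {z \<in> cball 0 b. f z = 0})"
    using finite_zeros_ball[OF f bounded_cball] by blast
  then have "\<not> {a<..<b} \<subseteq> cmod ` {z \<in> cball 0 b. f z = 0}"
    using ab finite_subset infinite_Ioo by blast
  then obtain r where "r \<in> {a<..<b}" "r \<notin> cmod ` {z \<in> cball 0 b. f z = 0}" by blast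
  then show ?thesis by (intro that[of r]) force+
qed

section \<open>Zero counts and lower bounds from growth\<close>

lemma log_bound_imp_zero_count:
  fixes f :: "complex \<Rightarrow> complex"
  assumes f: "f holomorphic_on UNIV" and f0: "f 0 \<noteq> 0" and a: "0 < a"
    and A: "\<And>z. cmod z \<le> 3 * a \<Longrightarrow> cmod (f z) \<le> exp A"
  shows "(\<Sum>w\<in>{z \<in> ball 0 a. f z = 0}. real (zmult f w)) * ln 2 \<le> A - ln (cmod (f 0))"
proof -
  \<comment> \<open>Beyond radius 2 a every zero in \<open>ball 0 a\<close> contributes at least ln
    2 to ln |F 0|. The range up to 3 a leaves room for a circle free of zeros, and the maximum
    principle bounds ln |F 0| by A.\<close>
  obtain r where r: "2 * a < r" "r < 3 * a" and sph: "\<And>z. cmod z = r \<Longrightarrow> f z \<noteq> 0"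
    using exists_zero_free_radius[OF f f0, of "2 * a" "3 * a"] a by auto
  have rpos: "r > 0" using r a by linarith
  obtain r' F where F: "r' > r" "F holomorphic_on ball 0 r'" "\<And>z. z \<in> ball 0 r' \<Longrightarrow> F z \<noteq> 0"
    "\<And>z. z \<in> cball 0 r \<Longrightarrow> f z = F z * (\<Prod>w\<in>{z \<in> ball 0 r. f z = 0}.
       (of_real r * (z - w) / ((of_real r)\<^sup>2 - cnj w * z)) ^ zmult f w)"
    "\<And>z. cmod z = r \<Longrightarrow> cmod (F z) = cmod (f z)"
    "ln (cmod (F 0)) = ln (cmod (f 0)) + (\<Sum>w\<in>{z \<in> ball 0 r. f z = 0}. real (zmult f w) * ln (r / cmod w))"
    by (rule blaschke_factorization[OF f f0 rpos]) (erule sph, rule that)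
  have "cmod (F 0) \<le> exp A"
  proof (rule maximum_modulus_frontier[of F "ball 0 r"])
    show "F holomorphic_on interior (ball 0 r)" using F(1) by (auto intro: holomorphic_on_subset[OF F(2)])
    show "continuous_on (closure (ball 0 r)) F" using F(1) rpos
      by (intro holomorphic_on_imp_continuous_on holomorphic_on_subset[OF F(2)]) auto
    show "cmod (F z) \<le> exp A" if "z \<in> frontier (ball 0 r)" for z
      using that rpos F(5)[of z] A[of z] r by (simp add: frontier_ball)
  qed (use rpos in auto)
  then have F0A: "ln (cmod (F 0)) \<le> A"
    using F(3)[of 0] F(1) rpos ln_le_cancel_iff[of "cmod (F 0)" "exp A"] by simp
  have "(\<Sum>w\<in>{z \<in> ball 0 a. f z = 0}. real (zmult f w) * ln 2)
      \<le> (\<Sum>w\<in>{z \<in> ball 0 a. f z = 0}. real (zmult f w) * ln (r / cmod w))"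
  proof (rule sum_mono)
    fix w assume w: "w \<in> {z \<in> ball 0 a. f z = 0}"
    then have "w \<noteq> 0" "cmod w < a" using f0 by auto
    then have "2 \<le> r / cmod w" using r by (simp add: field_simps)
    then have "ln 2 \<le> ln (r / cmod w)" by (subst ln_le_cancel_iff) auto
    then show "real (zmult f w) * ln 2 \<le> real (zmult f w) * ln (r / cmod w)"
      by (rule mult_left_mono) simp
  qed
  also have "\<dots> \<le> (\<Sum>w\<in>{z \<in> ball 0 r. f z = 0}. real (zmult f w) * ln (r / cmod w))"
  proof (rule sum_mono2)
    show "finite {z \<in> ball 0 r. f z = 0}" by (rule finite_zeros_ball[OF f f0 bounded_ball])
    show "{z \<in> ball 0 a. f z = 0} \<subseteq> {z \<in> ball 0 r. f z = 0}" using r a by auto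
    fix w assume "w \<in> {z \<in> ball 0 r. f z = 0} - {z \<in> ball 0 a. f z = 0}"
    then have "w \<noteq> 0" "cmod w < r" using f0 by auto
    then show "0 \<le> real (zmult f w) * ln (r / cmod w)" by simp
  qed
  finally have "(\<Sum>w\<in>{z \<in> ball 0 a. f z = 0}. real (zmult f w) * ln 2)
      \<le> (\<Sum>w\<in>{z \<in> ball 0 r. f z = 0}. real (zmult f w) * ln (r / cmod w))" .
  with F0A show ?thesis using F(6) by (simp add: sum_distrib_right)
qed

text \<open>Pigeonhole: of n + 1 candidates with spacing 1/(n + 1), each excluded one has a point of
  X within half the spacing, and no point of X can exclude two of them.\<close>

lemma exists_separated_radius:
  fixes X :: "real set"
  assumes "finite X"
  obtains r where "R \<le> r" "r \<le> R + 1" "\<And>x. x \<in> X \<Longrightarrow> 1 / (2 * (real (card X) + 1)) \<le> \<bar>x - r\<bar>"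
proof (rule ccontr)
  define n where "n = card X"
  define p where "p = (\<lambda>i::nat. R + real i / (real n + 1))"
  note that' = that
  assume contra: "\<not> thesis"
  have "\<exists>x\<in>X. \<bar>x - p i\<bar> < 1 / (2 * (real n + 1))" if "i \<in> {..n}" for i
  proof -
    have "R \<le> p i" "p i \<le> R + 1" using that by (auto simp: p_def field_simps)
    then show ?thesis using contra that' n_def linorder_not_less by blast
  qed
  then obtain g where g: "\<And>i. i \<in> {..n} \<Longrightarrow> g i \<in> X \<and> \<bar>g i - p i\<bar> < 1 / (2 * (real n + 1))"
    by metis
  have "inj_on g {..n}"
  proof (rule inj_onI)
    fix i j assume ij: "i \<in> {..n}" "j \<in> {..n}" "g i = g j"
    have "\<bar>p i - p j\<bar> < 1 / (real n + 1)"
    proof -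
      have *: "\<bar>x - y\<bar> < E" if "\<bar>a - x\<bar> < e" "\<bar>a - y\<bar> < e" "2 * e = E" for a x y e E :: real
        using that by linarith
      show ?thesis by (rule *[of "g i" _ "1 / (2 * (real n + 1))"]) (use g[OF ij(1)] g[OF ij(2)] ij(3) in \<open>auto simp: divide_simps\<close>)
    qed
    moreover have "p i - p j = (real i - real j) / (real n + 1)" by (simp add: p_def diff_divide_distrib)
    ultimately have "\<bar>real i - real j\<bar> / (real n + 1) < 1 / (real n + 1)" by (simp add: abs_divide)
    then have "\<bar>real i - real j\<bar> < 1" unfolding divide_less_cancel by auto
    then show "i = j" by linarith
  qed
  then have "card {..n} \<le> card X"
    using g assms by (intro card_inj_on_le[of g]) auto
  then show False by (simp add: n_def)
qed

text \<open>On a suitable circle f is the product of the zero-free F, bounded below by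
  Borel-Caratheodory, and of at most B / ln 2 Blaschke factors, each bounded below because the
  radius keeps away from the moduli of the zeros. The radius 15 R is three times 5 R, as the zero
  count in \<open>ball 0 (5 * R)\<close> requires.\<close>

lemma minimum_modulus:
  fixes f :: "complex \<Rightarrow> complex" and A R :: real
  assumes f: "f holomorphic_on UNIV" and f0: "f 0 \<noteq> 0" and R: "1 \<le> R"
    and A: "\<And>z. cmod z \<le> 15 * R \<Longrightarrow> cmod (f z) \<le> exp A"
  defines "B \<equiv> A - ln (cmod (f 0))"
  obtains r where "R \<le> r" "r \<le> R + 1" "\<And>z. cmod z = r \<Longrightarrow> f z \<noteq> 0"
    "\<And>z. cmod z = r \<Longrightarrow> ln (cmod (f 0)) - 2 * B - B / ln 2 * ln (20 * R * (B / ln 2 + 1)) \<le> ln (cmod (f z))"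
proof -
  define M where "M = B / ln 2"
  \<comment> \<open>With r1 > 4 R the circle of radius r <= R + 1 <= 2 R satisfies r / (r1 - r) <=
    1, so the Borel-Caratheodory bound costs only 2 (A - Re (h 0)).\<close>
  obtain r1 where r1: "4 * R < r1" "r1 < 5 * R" and sph: "\<And>z. cmod z = r1 \<Longrightarrow> f z \<noteq> 0"
    using exists_zero_free_radius[OF f f0, of "4 * R" "5 * R"] R by auto
  have r1pos: "r1 > 0" using r1 R by linarith
  define S where "S = {z \<in> ball 0 r1. f z = 0}"
  have fin: "finite {z \<in> ball 0 a. f z = 0}" for a
    by (rule finite_zeros_ball[OF f f0 bounded_ball])
  have finS: "finite S" unfolding S_def by (rule fin)
  have "(\<Sum>w\<in>S. real (zmult f w)) \<le> (\<Sum>w\<in>{z \<in> ball 0 (5 * R). f z = 0}. real (zmult f w))"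
    by (rule sum_mono2[OF fin]) (use r1 in \<open>auto simp: S_def\<close>)
  also have "\<dots> \<le> M"
    using log_bound_imp_zero_count[OF f f0, of "5 * R" A] A R
    by (simp add: M_def B_def field_simps)
  finally have SM: "(\<Sum>w\<in>S. real (zmult f w)) \<le> M" .
  have "card (cmod ` S) \<le> card S" by (rule card_image_le[OF finS])
  moreover have "(\<Sum>w\<in>S. 1) \<le> (\<Sum>w\<in>S. real (zmult f w))"
    using zmult_ge_1[OF f f0] by (intro sum_mono) (auto simp: S_def)
  ultimately have cardM: "real (card (cmod ` S)) \<le> M" using SM by simp
  have M0: "M \<ge> 0" using cardM by linarith
  obtain r where r: "R \<le> r" "r \<le> R + 1"
    and sep: "\<And>x. x \<in> cmod ` S \<Longrightarrow> 1 / (2 * (real (card (cmod ` S)) + 1)) \<le> \<bar>x - r\<bar>"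
    using exists_separated_radius[OF finite_imageI[OF finS, of cmod]] by blast
  have sepM: "1 / (2 * (M + 1)) \<le> cmod (z - w)" if "w \<in> S" "cmod z = r" for z w
  proof -
    have "1 / (2 * (M + 1)) \<le> 1 / (2 * (real (card (cmod ` S)) + 1))"
      using cardM by (intro divide_left_mono) auto
    also have "\<dots> \<le> \<bar>cmod w - r\<bar>" using sep that by blast
    also have "\<dots> \<le> cmod (z - w)" using that(2) norm_triangle_ineq3[of w z] by (simp add: norm_minus_commute)
    finally show ?thesis .
  qed
  have rr1: "r < r1" using r r1 R by linarith
  have fne: "f z \<noteq> 0" if "cmod z = r" for z
  proof
    assume "f z = 0"
    then have "z \<in> S" using that rr1 by (simp add: S_def)
    from sepM[OF this that] M0 show False by (simp add: field_simps)
  qed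
  obtain r' F where F: "r' > r1" "F holomorphic_on ball 0 r'" "\<And>z. z \<in> ball 0 r' \<Longrightarrow> F z \<noteq> 0"
    "\<And>z. z \<in> cball 0 r1 \<Longrightarrow> f z = F z * (\<Prod>w\<in>{z \<in> ball 0 r1. f z = 0}.
       (of_real r1 * (z - w) / ((of_real r1)\<^sup>2 - cnj w * z)) ^ zmult f w)"
    "\<And>z. cmod z = r1 \<Longrightarrow> cmod (F z) = cmod (f z)"
    "ln (cmod (F 0)) = ln (cmod (f 0)) + (\<Sum>w\<in>{z \<in> ball 0 r1. f z = 0}. real (zmult f w) * ln (r1 / cmod w))"
    by (rule blaschke_factorization[OF f f0 r1pos]) (erule sph, rule that)
  have FA: "cmod (F z) \<le> exp A" if "z \<in> ball 0 r1" for z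
  proof (rule maximum_modulus_frontier[of F "ball 0 r1"])
    show "F holomorphic_on interior (ball 0 r1)" using F(1) by (auto intro: holomorphic_on_subset[OF F(2)])
    show "continuous_on (closure (ball 0 r1)) F" using F(1) r1pos
      by (intro holomorphic_on_imp_continuous_on holomorphic_on_subset[OF F(2)]) auto
    show "cmod (F z) \<le> exp A" if "z \<in> frontier (ball 0 r1)" for z
      using that r1pos F(5)[of z] A[of z] r1 by (simp add: frontier_ball)
  qed (use that in auto)
  obtain h where h: "h holomorphic_on ball 0 r'" "\<And>z. z \<in> ball 0 r' \<Longrightarrow> exp (h z) = F z"
    using holomorphic_logarithm_exists[OF convex_ball open_ball F(2,3), of 0] F(1) r1pos by auto
  have Re_h: "Re (h z) = ln (cmod (F z))" if "z \<in> ball 0 r'" for z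
    using h(2)[OF that, symmetric] by simp
  have h1: "h holomorphic_on ball 0 r1" using F(1) by (auto intro: holomorphic_on_subset[OF h(1)])
  have hA: "Re (h z) \<le> A" if "z \<in> ball 0 r1" for z
    using FA[OF that] Re_h[of z] F(3)[of z] that F(1) ln_le_cancel_iff[of "cmod (F z)" "exp A"] by simp
  have "0 \<le> (\<Sum>w\<in>{z \<in> ball 0 r1. f z = 0}. real (zmult f w) * ln (r1 / cmod w))"
  proof (rule sum_nonneg)
    fix w assume "w \<in> {z \<in> ball 0 r1. f z = 0}"
    then have "w \<noteq> 0" "cmod w < r1" using f0 by auto
    then show "0 \<le> real (zmult f w) * ln (r1 / cmod w)" by simp
  qed
  then have h0: "Re (h 0) \<ge> ln (cmod (f 0))" using Re_h[of 0] F(1,6) r1pos by simp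
  have "ln (cmod (f 0)) - 2 * B - M * ln (20 * R * (M + 1)) \<le> ln (cmod (f z))" if z: "cmod z = r" for z
  proof -
    have "cmod (h z - h 0) \<le> 2 * (A - Re (h 0)) * cmod z / (r1 - cmod z)"
      by (rule borel_caratheodory[OF h1 hA]) (use z rr1 in auto)
    also have "\<dots> = 2 * (A - Re (h 0)) * (r / (r1 - r))" using z by simp
    also have "\<dots> \<le> 2 * (A - Re (h 0)) * 1"
      using hA[of 0] r1pos rr1 r r1 R by (intro mult_left_mono) (auto simp: field_simps)
    finally have "Re (h z) \<ge> Re (h 0) - 2 * (A - Re (h 0))"
      using abs_Re_le_cmod[of "h z - h 0"] by simp
    then have Fz: "ln (cmod (F z)) \<ge> ln (cmod (f 0)) - 2 * B"
      using Re_h[of z] z rr1 F(1) h0 by (simp add: B_def)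
    have big: "20 * R * (M + 1) \<ge> 1" using mult_mono[of 1 "20 * R" 1 "M + 1"] R M0 by simp
    have fac: "- ln (20 * R * (M + 1)) \<le> ln (cmod (of_real r1 * (z - w) / ((of_real r1)\<^sup>2 - cnj w * z)))"
      and facpos: "cmod (of_real r1 * (z - w) / ((of_real r1)\<^sup>2 - cnj w * z)) > 0" if w: "w \<in> S" for w
    proof -
      have ne: "(of_real r1)\<^sup>2 - cnj w * z \<noteq> 0"
        using blaschke_denominator_nonzero[of z r1 w] z rr1 w by (auto simp: S_def)
      have zw: "cmod (z - w) > 0" using sepM[OF w z] M0 by (smt (verit) divide_pos_pos)
      have "cmod ((of_real r1)\<^sup>2 - cnj w * z) \<le> r1\<^sup>2 + cmod w * cmod z"
        using norm_triangle_ineq4[of "(of_real r1)\<^sup>2" "cnj w * z"] by (simp add: norm_mult norm_power)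
      also have "cmod w * cmod z \<le> r1 * r1" using w z rr1 r1pos by (intro mult_mono) (auto simp: S_def)
      finally have den: "cmod ((of_real r1)\<^sup>2 - cnj w * z) \<le> 2 * r1\<^sup>2" by (simp add: power2_eq_square)
      \<comment> \<open>Numerator at least r1 / (2 (M + 1)) by separation, denominator at most 2
        r1^2; then r1 < 5 R.\<close>
      have "1 / (20 * R * (M + 1)) \<le> 1 / (4 * r1 * (M + 1))"
        using r1 r1pos R M0 by (intro divide_left_mono mult_right_mono mult_pos_pos) auto
      also have "\<dots> = (r1 * (1 / (2 * (M + 1)))) / (2 * r1\<^sup>2)"
        using r1pos M0 by (simp add: power2_eq_square divide_simps)
      also have "\<dots> \<le> (r1 * cmod (z - w)) / cmod ((of_real r1)\<^sup>2 - cnj w * z)"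
        using sepM[OF w z] den ne r1pos by (intro frac_le mult_left_mono) auto
      also have "\<dots> = cmod (of_real r1 * (z - w) / ((of_real r1)\<^sup>2 - cnj w * z))"
        using r1pos by (simp add: norm_divide norm_mult)
      finally have le: "1 / (20 * R * (M + 1)) \<le> cmod (of_real r1 * (z - w) / ((of_real r1)\<^sup>2 - cnj w * z))" .
      moreover have "0 < 1 / (20 * R * (M + 1))" using R M0 by simp
      ultimately show pos: "cmod (of_real r1 * (z - w) / ((of_real r1)\<^sup>2 - cnj w * z)) > 0" by linarith
      have li: "ln (1 / X) = - ln X" if "X > 0" for X :: real using that by (simp add: ln_div)
      have "ln (1 / (20 * R * (M + 1))) \<le> ln (cmod (of_real r1 * (z - w) / ((of_real r1)\<^sup>2 - cnj w * z)))"
        using le pos \<open>0 < 1 / (20 * R * (M + 1))\<close> by (subst ln_le_cancel_iff) auto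
      then show "- ln (20 * R * (M + 1)) \<le> ln (cmod (of_real r1 * (z - w) / ((of_real r1)\<^sup>2 - cnj w * z)))"
        using li[of "20 * R * (M + 1)"] big by linarith
    qed
    have "- M * ln (20 * R * (M + 1)) \<le> - (\<Sum>w\<in>S. real (zmult f w)) * ln (20 * R * (M + 1))"
      using SM big by (intro mult_right_mono) auto
    also have "\<dots> = (\<Sum>w\<in>S. real (zmult f w) * - ln (20 * R * (M + 1)))"
      by (simp add: sum_distrib_right sum_negf)
    also have "\<dots> \<le> (\<Sum>w\<in>S. real (zmult f w) * ln (cmod (of_real r1 * (z - w) / ((of_real r1)\<^sup>2 - cnj w * z))))"
      using fac by (intro sum_mono mult_left_mono) auto
    also have "\<dots> = ln (\<Prod>w\<in>S. cmod (of_real r1 * (z - w) / ((of_real r1)\<^sup>2 - cnj w * z)) ^ zmult f w)"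
      using facpos finS by (subst ln_prod) (auto simp: ln_realpow)
    finally have prod: "- M * ln (20 * R * (M + 1)) \<le> \<dots>" .
    have "cmod (f z) = cmod (F z) * (\<Prod>w\<in>S. cmod (of_real r1 * (z - w) / ((of_real r1)\<^sup>2 - cnj w * z)) ^ zmult f w)"
      using F(4)[of z] z rr1 unfolding S_def[symmetric]
      by (simp add: norm_mult norm_power norm_divide flip: prod_norm)
    then have "ln (cmod (f z)) = ln (cmod (F z)) + ln (\<Prod>w\<in>S. cmod (of_real r1 * (z - w) / ((of_real r1)\<^sup>2 - cnj w * z)) ^ zmult f w)"
      using facpos F(3)[of z] F(1) z rr1 by (subst ln_mult_pos[symmetric]) (auto intro!: prod_pos)
    then show ?thesis using Fz prod by simp
  qed
  then show ?thesis using that[OF r fne] by (simp add: M_def)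
qed

section \<open>Trapezoid errors and Stirling's formula\<close>

text \<open>Integration by parts twice against the Peano kernel u (1 - u) / 2, which vanishes at
  both ends. The kernel is nonnegative, which later gives the signs needed for Tonelli. Values in a
  Banach space cover real exponentials and complex powers alike, and F stands for an antiderivative
  because all applications have one in closed form.\<close>

lemma trapezoid_peano:
  fixes F f f' f'' :: "real \<Rightarrow> 'a::banach"
  assumes F: "\<And>x. x \<in> {a..a+1} \<Longrightarrow> (F has_vector_derivative f x) (at x)"
    and f: "\<And>x. x \<in> {a..a+1} \<Longrightarrow> (f has_vector_derivative f' x) (at x)"
    and f': "\<And>x. x \<in> {a..a+1} \<Longrightarrow> (f' has_vector_derivative f'' x) (at x)"
  shows "((\<lambda>u. (u * (1 - u) / 2) *\<^sub>R f'' (a + u)) has_integral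
      ((1/2) *\<^sub>R (f a + f (a + 1)) - (F (a + 1) - F a))) {0..1}"
proof -
  \<comment> \<open>The antiderivative left by the two integrations by parts: the kernel and its
    derivatives, with alternating signs, against f', f and F.\<close>
  define W where "W = (\<lambda>u. (u * (1 - u) / 2) *\<^sub>R f' (a + u) - ((1 - 2 * u) / 2) *\<^sub>R f (a + u) - F (a + u))"
  have shift: "((\<lambda>u. g (a + u)) has_vector_derivative d) (at u)" if "(g has_vector_derivative d) (at (a + u))" for g :: "real \<Rightarrow> 'a" and d u
  proof -
    have "((\<lambda>u. a + u) has_vector_derivative 1) (at u)"
      unfolding has_real_derivative_iff_has_vector_derivative[symmetric] by (auto intro!: derivative_eq_intros)
    from vector_diff_chain_at[OF this that] show ?thesis by (simp add: o_def)
  qed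
  have "(W has_vector_derivative (u * (1 - u) / 2) *\<^sub>R f'' (a + u)) (at u within {0..1})"
    if u: "u \<in> {0..1}" for u
  proof -
    have au: "a + u \<in> {a..a+1}" using u by auto
    have d1: "((\<lambda>u. (u * (1 - u) / 2)) has_vector_derivative ((1 - 2 * u) / 2)) (at u)"
      by (auto intro!: derivative_eq_intros simp flip: has_real_derivative_iff_has_vector_derivative)
    have d2: "((\<lambda>u. ((1 - 2 * u) / 2)) has_vector_derivative (- 1)) (at u)"
      by (auto intro!: derivative_eq_intros simp flip: has_real_derivative_iff_has_vector_derivative)
    note d1' = d1[THEN has_real_derivative_iff_has_vector_derivative[THEN iffD2]]
      and d2' = d2[THEN has_real_derivative_iff_has_vector_derivative[THEN iffD2]]
    have "(W has_vector_derivative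
        ((u * (1 - u) / 2) *\<^sub>R f'' (a + u) + ((1 - 2 * u) / 2) *\<^sub>R f' (a + u))
        - (((1 - 2 * u) / 2) *\<^sub>R f' (a + u) + (- 1) *\<^sub>R f (a + u)) - f (a + u)) (at u)"
      unfolding W_def
      by (intro has_vector_derivative_diff has_vector_derivative_scaleR d1' d2' shift F f f' au)
    then show ?thesis by (simp add: has_vector_derivative_at_within)
  qed
  then have "((\<lambda>u. (u * (1 - u) / 2) *\<^sub>R f'' (a + u)) has_integral (W 1 - W 0)) {0..1}"
    by (intro fundamental_theorem_of_calculus) auto
  moreover have "W 1 - W 0 = (1/2) *\<^sub>R (f a + f (a + 1)) - (F (a + 1) - F a)"
    by (simp add: W_def scaleR_add_right)
  ultimately show ?thesis by simp
qed

text \<open>The constant 1/8 is the maximum of the Peano kernel on the unit interval.\<close>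

lemma trapezoid_error:
  fixes F f f' f'' :: "real \<Rightarrow> 'a::banach"
  assumes F: "\<And>x. x \<in> {a..a+1} \<Longrightarrow> (F has_vector_derivative f x) (at x)"
    and f: "\<And>x. x \<in> {a..a+1} \<Longrightarrow> (f has_vector_derivative f' x) (at x)"
    and f': "\<And>x. x \<in> {a..a+1} \<Longrightarrow> (f' has_vector_derivative f'' x) (at x)"
    and B: "\<And>x. x \<in> {a..a+1} \<Longrightarrow> norm (f'' x) \<le> B"
  shows "norm ((1/2) *\<^sub>R (f a + f (a + 1)) - (F (a + 1) - F a)) \<le> B / 8"
proof -
  have "norm ((1/2) *\<^sub>R (f a + f (a + 1)) - (F (a + 1) - F a)) \<le> B / 8 * Henstock_Kurzweil_Integration.content {0..1::real}"
  proof (rule has_integral_bound_real[where f = "\<lambda>u. (u * (1 - u) / 2) *\<^sub>R f'' (a + u)"])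
    show "0 \<le> B / 8" using order_trans[OF norm_ge_zero B[of a]] by simp
    show "((\<lambda>u. (u * (1 - u) / 2) *\<^sub>R f'' (a + u)) has_integral
      ((1/2) *\<^sub>R (f a + f (a + 1)) - (F (a + 1) - F a))) {0..1}"
      by (rule trapezoid_peano[OF F f f'])
    show "finite {}" by simp
    fix u :: real assume "u \<in> {0..1} - {}"
    then have u: "0 \<le> u" "u \<le> 1" by auto
    have "u * (1 - u) \<le> 1/4" using zero_le_power2[of "u - 1/2"] by (simp add: power2_eq_square algebra_simps)
    moreover have "0 \<le> u * (1 - u)" using u by simp
    ultimately have "(u * (1 - u) / 2) * norm (f'' (a + u)) \<le> (1/8) * B"
      using B[of "a + u"] u by (intro mult_mono) auto
    then show "norm ((u * (1 - u) / 2) *\<^sub>R f'' (a + u)) \<le> B / 8"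
      using \<open>0 \<le> u * (1 - u)\<close> by simp
  qed
  then show ?thesis by simp
qed

text \<open>The main term of ln Gamma without the constant ln (2 pi) / 2, which the error bounds
  absorb.\<close>

definition stirling :: "complex \<Rightarrow> complex" where
  "stirling z = (z - 1/2) * Ln z - z"

text \<open>The trapezoid rule for Ln (z + x) on [0, n], with antiderivative (z + x) Ln (z + x) - (z
  + x). The error on [k, k + 1] is at most 1 / (8 (k + 1)^2), because |z + x| >= Re (z + x) >= k + 1
  there.\<close>

lemma sum_Ln_stirling:
  assumes z: "Re z \<ge> 1"
  shows "cmod ((\<Sum>k\<le>n. Ln (z + of_nat k)) - ((z + of_nat n + 1/2) * Ln (z + of_nat n) - (z + of_nat n) - stirling z)) \<le> 1 / 2"
proof -
  define t where "t = (\<lambda>k::nat. (1/2) *\<^sub>R (Ln (z + of_nat k) + Ln (z + of_nat k + 1)) -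
      (((z + of_nat k + 1) * Ln (z + of_nat k + 1) - (z + of_nat k + 1)) - ((z + of_nat k) * Ln (z + of_nat k) - (z + of_nat k))))"
  have pos: "z + of_real x \<notin> \<real>\<^sub>\<le>\<^sub>0" "z + of_real x \<noteq> 0" if "x \<ge> 0" for x
    using z that by (auto simp: complex_nonpos_Reals_iff complex_eq_iff)
  have tb: "cmod (t k) \<le> (1 / (1 + real k) ^ 2) / 8" for k
  proof -
    have eq: "t k = (1/2) *\<^sub>R (Ln (z + of_real (real k)) + Ln (z + of_real (real k + 1))) -
      (((z + of_real (real k + 1)) * Ln (z + of_real (real k + 1)) - (z + of_real (real k + 1)))
       - ((z + of_real (real k)) * Ln (z + of_real (real k)) - (z + of_real (real k))))"
      by (simp add: t_def add.assoc)
    show ?thesis unfolding eq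
    proof (rule trapezoid_error[where f' = "\<lambda>x. 1 / (z + of_real x)" and f'' = "\<lambda>x. - 1 / (z + of_real x) ^ 2"])
      fix x assume x: "x \<in> {real k..real k + 1}"
      then have x0: "x \<ge> 0" by auto
      show "((\<lambda>x. (z + of_real x) * Ln (z + of_real x) - (z + of_real x)) has_vector_derivative Ln (z + of_real x)) (at x)"
        by (rule has_vector_derivative_real_field)
           (use pos[OF x0] in \<open>auto intro!: derivative_eq_intros\<close>)
      show "((\<lambda>x. Ln (z + of_real x)) has_vector_derivative 1 / (z + of_real x)) (at x)"
        by (rule has_vector_derivative_real_field)
           (use pos[OF x0] in \<open>auto intro!: derivative_eq_intros simp: field_simps\<close>)
      show "((\<lambda>x. 1 / (z + of_real x)) has_vector_derivative - 1 / (z + of_real x) ^ 2) (at x)"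
        by (rule has_vector_derivative_real_field)
           (use pos[OF x0] in \<open>auto intro!: derivative_eq_intros simp: power2_eq_square\<close>)
      have "1 + real k \<le> Re (z + of_real x)" using x z by simp
      also have "\<dots> \<le> cmod (z + of_real x)" by (rule complex_Re_le_cmod)
      finally have "(1 + real k) ^ 2 \<le> cmod (z + of_real x) ^ 2" by (intro power_mono) auto
      then show "cmod (- 1 / (z + of_real x) ^ 2) \<le> 1 / (1 + real k) ^ 2"
        by (simp add: norm_divide norm_power frac_le)
    qed
  qed
  have "(\<Sum>k\<le>n. Ln (z + of_nat k)) - ((z + of_nat n + 1/2) * Ln (z + of_nat n) - (z + of_nat n) - stirling z) = (\<Sum>k<n. t k)"
  proof (induction n)
    case 0
    show ?case by (simp add: stirling_def algebra_simps)
  next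
    case (Suc n)
    have "(\<Sum>k\<le>Suc n. Ln (z + of_nat k)) = (\<Sum>k\<le>n. Ln (z + of_nat k)) + Ln (z + of_nat n + 1)"
      by (simp add: algebra_simps)
    with Suc show ?case by (simp add: t_def algebra_simps scaleR_conv_of_real)
  qed
  also have "cmod \<dots> \<le> (\<Sum>k<n. (1 / (1 + real k) ^ 2) / 8)"
    by (rule sum_norm_le) (use tb in auto)
  also have "\<dots> = (\<Sum>k<n. 1 / (real k + 1) ^ 2) / 8" by (simp add: sum_divide_distrib add.commute)
  also have "(\<Sum>k<n. 1 / (real k + 1) ^ 2) \<le> pi\<^sup>2 / 6"
    using sum_le_suminf[of "\<lambda>n. 1 / (real n + 1)\<^sup>2" "{..<n}"] inverse_squares_sums
    by (simp add: sums_iff add.commute)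
  \<comment> \<open>A crude bound that turns the total error into 4/8 = 1/2.\<close>
  also have "pi\<^sup>2 / 6 \<le> 4"
    using pi_less_4 pi_gt_zero power_mono[of pi 4 2] by simp
  finally show ?thesis by simp
qed

lemma n_times_Ln_limit:
  "(\<lambda>n. of_nat n * Ln (1 + z / of_nat n)) \<longlonglongrightarrow> z"
proof -
  have "((\<lambda>h. Ln (1 + z * h)) has_field_derivative z) (at 0)"
    by (auto intro!: derivative_eq_intros simp: complex_nonpos_Reals_iff)
  then have "((\<lambda>h. Ln (1 + z * h) / h) \<longlongrightarrow> z) (at 0)" by (simp add: DERIV_def)
  moreover have "filterlim (\<lambda>n::nat. 1 / of_nat n :: complex) (at 0) sequentially"
    by (simp add: filterlim_at lim_1_over_n eventually_sequentially) (auto intro!: exI[of _ 1])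
  ultimately have "(\<lambda>n. Ln (1 + z * (1 / of_nat n)) / (1 / of_nat n)) \<longlonglongrightarrow> z"
    by (rule filterlim_compose)
  then show ?thesis by (simp add: mult.commute)
qed

text \<open>Gauss' limit for Gamma: the denominator is estimated by \<open>sum_Ln_stirling\<close>
  at z and the factorial in the numerator by the same lemma at 1. Each costs 1/2; the remaining main
  terms are collected in D, which tends to 1.\<close>

lemma stirling_bound:
  assumes z: "Re z \<ge> 1"
  shows "\<bar>ln (cmod (Gamma z)) - Re (stirling z)\<bar> \<le> 2"
proof -
  define D where "D = (\<lambda>n::nat. (real n + 1/2) * (ln (real n + 1) - ln (real n)) - Re ((z + of_nat n + 1/2) * Ln (1 + z / of_nat n)) + Re z)"
  have zn: "z + of_nat k \<noteq> 0" for k :: nat using z by (auto simp: complex_eq_iff)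
  have zni: "z \<notin> \<int>\<^sub>\<le>\<^sub>0" using z by (auto elim!: nonpos_Ints_cases)
  have bound: "\<bar>ln (cmod (Gamma_series z n)) - Re (stirling z) - D n\<bar> \<le> 1" if n: "n \<ge> 1" for n
  proof -
    have e1: "ln (cmod (Gamma_series z n)) = ln (fact n) + Re z * ln (real n) - (\<Sum>k\<le>n. Re (Ln (z + of_nat k)))"
    proof -
      have "cmod (Gamma_series z n) = fact n * exp (Re z * ln (real n)) / (\<Prod>k\<le>n. cmod (z + of_nat k))"
        using n by (simp add: Gamma_series_def norm_divide norm_mult pochhammer_prod prod_norm[symmetric] lessThan_Suc_atMost[symmetric] atLeast0LessThan norm_exp_eq_Re)
      moreover have "(\<Prod>k\<le>n. cmod (z + of_nat k)) > 0" using zn by (intro prod_pos) auto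
      moreover have "ln (\<Prod>k\<le>n. cmod (z + of_nat k)) = (\<Sum>k\<le>n. Re (Ln (z + of_nat k)))"
        using zn by (subst ln_prod) auto
      ultimately show ?thesis using n zn by (simp add: ln_div ln_mult_pos)
    qed
    \<comment> \<open>The sum from k = 0 to n starting at z = 1 is ln ((n + 1)!), hence the
      additional ln (n + 1).\<close>
    have e2: "ln (fact n) + ln (real n + 1) = Re (\<Sum>k\<le>n. Ln (1 + of_nat k))"
    proof -
      have "Re (Ln (1 + of_nat k)) = ln (real k + 1)" for k
      proof -
        have "1 + of_nat k = (of_nat (Suc k) :: complex)" by simp
        moreover have "Re (Ln (of_nat (Suc k))) = ln (real (Suc k))" by (subst Re_Ln) (auto simp del: of_nat_Suc)
        ultimately show ?thesis by (simp add: add.commute)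
      qed
      then have "Re (\<Sum>k\<le>n. Ln (1 + of_nat k)) = (\<Sum>k\<le>n. ln (real k + 1))" by simp
      also have "\<dots> = ln (fact (Suc n))"
        by (induction n) (auto simp: ln_mult_pos add_ac)
      also have "\<dots> = ln (fact n) + ln (real n + 1)" by (simp add: ln_mult_pos add_ac)
      finally show ?thesis by simp
    qed
    have "\<bar>Re ((\<Sum>k\<le>n. Ln (z + of_nat k)) - ((z + of_nat n + 1/2) * Ln (z + of_nat n) - (z + of_nat n) - stirling z))\<bar> \<le> 1 / 2"
      using sum_Ln_stirling[OF z, of n] abs_Re_le_cmod order_trans by blast
    then have b1: "\<bar>(\<Sum>k\<le>n. Re (Ln (z + of_nat k))) - Re ((z + of_nat n + 1/2) * Ln (z + of_nat n)) + Re z + real n + Re (stirling z)\<bar> \<le> 1/2"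
      by (simp add: algebra_simps)
    have "\<bar>Re ((\<Sum>k\<le>n. Ln (1 + of_nat k)) - ((1 + of_nat n + 1/2) * Ln (1 + of_nat n) - (1 + of_nat n) - stirling 1))\<bar> \<le> 1 / 2"
      using sum_Ln_stirling[of 1 n] abs_Re_le_cmod order_trans by (metis order_refl one_complex.sel(1))
    moreover have "Ln (1 + of_nat n) = of_real (ln (real n + 1))"
      using Ln_of_real[of "real n + 1"] by (simp add: add.commute)
    moreover have "stirling 1 = - 1" by (simp add: stirling_def)
    ultimately have b2: "\<bar>ln (fact n) + ln (real n + 1) - ((real n + 3/2) * ln (real n + 1) - real n)\<bar> \<le> 1/2"
      unfolding e2 by (simp add: algebra_simps)
    have "Ln (z + of_nat n) = of_real (ln (real n)) + Ln (1 + z / of_nat n)"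
    proof -
      have "Ln (of_real (real n) * (1 + z / of_nat n)) = of_real (ln (real n)) + Ln (1 + z / of_nat n)"
        using n zn[of n] by (subst Ln_times_of_real) (auto simp: add_divide_distrib[symmetric] field_simps)
      moreover have "of_real (real n) * (1 + z / of_nat n) = z + of_nat n" using n by (simp add: field_simps)
      ultimately show ?thesis by simp
    qed
    then have e3: "Re ((z + of_nat n + 1/2) * Ln (z + of_nat n)) = (Re z + real n + 1/2) * ln (real n) + Re ((z + of_nat n + 1/2) * Ln (1 + z / of_nat n))"
      by (simp add: algebra_simps)
    have *: "\<bar>x - y\<bar> \<le> 1" if "\<bar>x\<bar> \<le> 1/2" "\<bar>y\<bar> \<le> 1/2" for x y :: real using that by linarith
    show ?thesis
      using *[OF b2 b1] unfolding e1 D_def e3 by (simp add: algebra_simps)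
  qed
  have Dlim: "D \<longlonglongrightarrow> 1"
  proof -
    have "(\<lambda>n. (z + 1/2) * Ln (1 + z / of_nat n)) \<longlonglongrightarrow> (z + 1/2) * Ln (1 + 0)"
      by (intro tendsto_intros) (auto simp: complex_nonpos_Reals_iff intro!: tendsto_divide_0[OF tendsto_const] tendsto_of_nat)
    from tendsto_add[OF this n_times_Ln_limit[of z]]
    have "(\<lambda>n. (z + of_nat n + 1/2) * Ln (1 + z / of_nat n)) \<longlonglongrightarrow> z" by (simp add: algebra_simps)
    from tendsto_Re[OF this] have l1: "(\<lambda>n. Re ((z + of_nat n + 1/2) * Ln (1 + z / of_nat n))) \<longlonglongrightarrow> Re z" .
    have l2: "(\<lambda>n. (real n + 1/2) * (ln (real n + 1) - ln (real n))) \<longlonglongrightarrow> 1" by real_asymp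
    show ?thesis unfolding D_def using tendsto_add[OF tendsto_diff[OF l2 l1] tendsto_const[of "Re z"]] by simp
  qed
  have "(\<lambda>n. ln (cmod (Gamma_series z n)) - Re (stirling z) - D n) \<longlonglongrightarrow> ln (cmod (Gamma z)) - Re (stirling z) - 1"
    using Gamma_nonzero[OF zni] by (intro tendsto_intros Dlim) auto
  then have "\<bar>ln (cmod (Gamma z)) - Re (stirling z) - 1\<bar> \<le> 1"
    by (intro tendsto_upperbound[OF tendsto_rabs]) (auto simp: eventually_sequentially intro!: exI[of _ 1] bound)
  then show ?thesis by linarith
qed

section \<open>Analytic continuation of the zeta function\<close>

definition zeta_term :: "nat \<Rightarrow> complex \<Rightarrow> complex" where
  "zeta_term n s = (s - 1) * (of_real (real n + 1) powr (- s) + of_real (real n + 2) powr (- s)) / 2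
     + (of_real (real n + 2) powr (1 - s) - of_real (real n + 1) powr (1 - s))"

text \<open>The continuation of \<open>(s - 1) \<zeta>(s)\<close>: the \<open>n\<close>-th summand is \<open>s - 1\<close> times the trapezoid error
  of \<open>u\<^sup>-\<^sup>s\<close> on \<open>[n + 1, n + 2]\<close>, which is \<open>O((n + 1) powr (- Re s - 2))\<close>.\<close>

definition zeta_reg :: "complex \<Rightarrow> complex" where
  "zeta_reg s = 1 + (s - 1) / 2 + (\<Sum>n. zeta_term n s)"

text \<open>The error bound for (s - 1) u^(-s), whose second derivative is (s - 1) s (s + 1) u^(-s -
  2). For Re s >= -2 the power has nonincreasing modulus, so its largest value is at the left
  end.\<close>

lemma zeta_term_bound:
  assumes s: "Re s \<ge> -2"
  shows "cmod (zeta_term n s) \<le> cmod (s - 1) * cmod s * cmod (s + 1) / 8 * (real n + 1) powr (- Re s - 2)"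
proof -
  have d: "((\<lambda>x. of_real x powr p) has_vector_derivative p * of_real x powr (p - 1)) (at x)" if "x > 0" for p :: complex and x :: real
    by (rule has_vector_derivative_real_field)
       (use that in \<open>auto intro!: derivative_eq_intros\<close>)
  have "cmod ((1/2) *\<^sub>R ((s - 1) * of_real (real n + 1) powr (- s) + (s - 1) * of_real (real n + 1 + 1) powr (- s))
     - ((- (of_real (real n + 1 + 1) powr (1 - s))) - (- (of_real (real n + 1) powr (1 - s)))))
     \<le> (cmod (s - 1) * cmod s * cmod (s + 1) * (real n + 1) powr (- Re s - 2)) / 8"
  proof (rule trapezoid_error[where f' = "\<lambda>x. (s - 1) * (- s * of_real x powr (- s - 1))"
        and f'' = "\<lambda>x. (s - 1) * (- s * ((- s - 1) * of_real x powr (- s - 1 - 1)))"])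
    fix x assume "x \<in> {real n + 1..real n + 1 + 1}"
    then have x: "x > 0" "x \<ge> real n + 1" by auto
    show "((\<lambda>x. - (of_real x powr (1 - s))) has_vector_derivative (s - 1) * of_real x powr - s) (at x)"
      using has_vector_derivative_minus[OF d[OF x(1), of "1 - s"]] by (simp add: algebra_simps)
    show "((\<lambda>x. (s - 1) * of_real x powr - s) has_vector_derivative (s - 1) * (- s * of_real x powr (- s - 1))) (at x)"
      by (rule has_vector_derivative_mult_right[OF d[OF x(1)]])
    show "((\<lambda>x. (s - 1) * (- s * of_real x powr (- s - 1))) has_vector_derivative
        (s - 1) * (- s * ((- s - 1) * of_real x powr (- s - 1 - 1)))) (at x)"
      by (intro has_vector_derivative_mult_right d[OF x(1)])
    have "cmod (of_real x powr (- s - 1 - 1)) = x powr (- Re s - 2)"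
      using x(1) by (simp add: norm_powr_real_powr) (rule arg_cong[where f = "(powr) x"], simp)
    also have "\<dots> \<le> (real n + 1) powr (- Re s - 2)"
      using s x by (intro powr_mono2') auto
    finally have "cmod (s - 1) * (cmod s * (cmod (s + 1) * cmod (of_real x powr (- s - 1 - 1))))
       \<le> cmod (s - 1) * (cmod s * (cmod (s + 1) * (real n + 1) powr (- Re s - 2)))"
      by (intro mult_left_mono) auto
    moreover have "cmod (- s - 1) = cmod (s + 1)" using norm_minus_cancel[of "s + 1"] by (simp only: minus_add_distrib) simp
    ultimately show "cmod ((s - 1) * (- s * ((- s - 1) * of_real x powr (- s - 1 - 1))))
       \<le> cmod (s - 1) * cmod s * cmod (s + 1) * (real n + 1) powr (- Re s - 2)"
      by (simp add: norm_mult mult_ac)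
  qed
  moreover have "(1/2) *\<^sub>R ((s - 1) * of_real (real n + 1) powr (- s) + (s - 1) * of_real (real n + 1 + 1) powr (- s))
     - ((- (of_real (real n + 1 + 1) powr (1 - s))) - (- (of_real (real n + 1) powr (1 - s)))) = zeta_term n s"
  proof -
    have e: "real n + 1 + 1 = real n + 2" by simp
    show ?thesis unfolding e zeta_term_def scaleR_conv_of_real by (simp add: field_simps)
  qed
  ultimately show ?thesis by simp
qed

lemma summable_Suc_powr:
  fixes p :: real
  assumes "p < -1" shows "summable (\<lambda>n. (real n + 1) powr p)"
proof -
  have "summable (\<lambda>n. real (Suc n) powr p)"
    using assms by (subst summable_Suc_iff) (simp add: summable_real_powr_iff)
  then show ?thesis by (simp add: add.commute)
qed

lemma zeta_series_uniform_limit: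
  assumes s0: "Re s0 > -1"
  obtains d where "d > 0" "cball s0 d \<subseteq> {s. Re s > -1}"
    "uniform_limit (cball s0 d) (\<lambda>N s. \<Sum>n<N. zeta_term n s) (\<lambda>s. \<Sum>n. zeta_term n s) sequentially"
proof -
  \<comment> \<open>Half the distance to the line Re s = -1: on the disc Re s >= d - 1, so the terms
    are dominated by the summable (n + 1)^(-d - 1).\<close>
  define d where "d = (Re s0 + 1) / 2"
  have d: "d > 0" using s0 by (simp add: d_def)
  have Re_ge: "Re s \<ge> d - 1" if "s \<in> cball s0 d" for s
  proof -
    have "Re s0 - Re s \<le> d" using that abs_Re_le_cmod[of "s0 - s"] by (simp add: dist_norm)
    then show ?thesis by (simp add: d_def field_simps)
  qed
  define M where "M = (cmod s0 + d + 1) ^ 3 / 8"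
  have tb: "cmod (zeta_term n s) \<le> M * (real n + 1) powr (- d - 1)" if s: "s \<in> cball s0 d" for n s
  proof -
    have ns: "cmod s \<le> cmod s0 + d" using that norm_triangle_ineq2[of s s0] by (simp add: dist_norm norm_minus_commute)
    have "cmod (s - 1) * cmod s * cmod (s + 1) \<le> (cmod s0 + d + 1) * (cmod s0 + d + 1) * (cmod s0 + d + 1)"
      using ns d norm_triangle_ineq4[of s 1] norm_triangle_ineq[of s 1] by (intro mult_mono) auto
    then have M: "cmod (s - 1) * cmod s * cmod (s + 1) / 8 \<le> M" by (simp add: M_def power3_eq_cube)
    have "cmod (zeta_term n s) \<le> cmod (s - 1) * cmod s * cmod (s + 1) / 8 * (real n + 1) powr (- Re s - 2)"
      using Re_ge[OF s] d by (intro zeta_term_bound) auto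
    also have "\<dots> \<le> M * (real n + 1) powr (- d - 1)"
      using M Re_ge[OF s] d by (intro mult_mono powr_mono) (auto simp: M_def)
    finally show ?thesis .
  qed
  have sM: "summable (\<lambda>n. M * (real n + 1) powr (- d - 1))"
    using d by (intro summable_mult summable_Suc_powr) auto
  have "uniform_limit (cball s0 d) (\<lambda>N s. \<Sum>n<N. zeta_term n s) (\<lambda>s. \<Sum>n. zeta_term n s) sequentially"
    by (rule Weierstrass_m_test[OF tb sM])
  moreover have "cball s0 d \<subseteq> {s. Re s > -1}" using Re_ge d by force
  ultimately show ?thesis using that d by blast
qed

lemma holomorphic_zeta_term: "zeta_term n holomorphic_on A"
  unfolding zeta_term_def by (intro holomorphic_intros) (auto simp: complex_nonpos_Reals_iff)

lemma open_halfplane_Re: "open {s. Re s > a}"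
  by (simp add: open_halfspace_Re_gt)

lemma zeta_series_holomorphic:
  "(\<lambda>s. \<Sum>n. zeta_term n s) holomorphic_on {s. Re s > -1}"
proof (rule holomorphic_uniform_sequence[where f = "\<lambda>N s. \<Sum>n<N. zeta_term n s"])
  show "open {s. Re s > -1}" by (rule open_halfplane_Re)
  show "(\<lambda>s. \<Sum>n<N. zeta_term n s) holomorphic_on {s. Re s > -1}" for N
    by (intro holomorphic_intros holomorphic_zeta_term)
  show "\<exists>d>0. cball x d \<subseteq> {s. - 1 < Re s} \<and>
      uniform_limit (cball x d) (\<lambda>N s. \<Sum>n<N. zeta_term n s) (\<lambda>s. \<Sum>n. zeta_term n s) sequentially"
    if "x \<in> {s. - 1 < Re s}" for x
  proof -
    from that have "Re x > -1" by simp
    then obtain d where "d > 0" "cball x d \<subseteq> {s. - 1 < Re s}"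
      "uniform_limit (cball x d) (\<lambda>N s. \<Sum>n<N. zeta_term n s) (\<lambda>s. \<Sum>n. zeta_term n s) sequentially"
      by (rule zeta_series_uniform_limit)
    then show ?thesis by (intro exI[of _ d] conjI)
  qed
qed

lemma zeta_reg_holomorphic: "zeta_reg holomorphic_on {s. Re s > -1}"
  unfolding zeta_reg_def by (intro holomorphic_intros zeta_series_holomorphic) auto

lemma zeta_reg_1 [simp]: "zeta_reg 1 = 1"
proof -
  have "zeta_term n 1 = 0" for n by (simp add: zeta_term_def complex_eq_iff)
  then show ?thesis by (simp add: zeta_reg_def)
qed

lemma summable_zeta_term:
  assumes "Re s > -1" shows "summable (\<lambda>n. zeta_term n s)"
proof (rule summable_comparison_test)
  show "\<exists>N. \<forall>n\<ge>N. norm (zeta_term n s) \<le> cmod (s - 1) * cmod s * cmod (s + 1) / 8 * (real n + 1) powr (- Re s - 2)"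
    using zeta_term_bound[of s] assms by auto
  show "summable (\<lambda>n. cmod (s - 1) * cmod s * cmod (s + 1) / 8 * (real n + 1) powr (- Re s - 2))"
    using assms by (intro summable_mult summable_Suc_powr) auto
qed

text \<open>Neighbouring trapezoid weights 1/2 add up to 1, which leaves a Dirichlet partial sum
  with corrections by half of the first and last terms; the powers with exponent 1 - s
  telescope.\<close>

lemma sum_zeta_term:
  fixes N :: nat
  shows "(\<Sum>n<N. zeta_term n s) = (s - 1) * ((\<Sum>n<Suc N. of_real (real n + 1) powr (- s)) - 1/2 - of_real (real N + 1) powr (- s) / 2)
     + of_real (real N + 1) powr (1 - s) - 1"
proof (induction N)
  case 0
  show ?case by simp
next
  case (Suc N)
  have e: "real (Suc N) + 1 = real N + 2" by simp
  have X: "(\<Sum>n<Suc (Suc N). of_real (real n + 1) powr (- s)) = (\<Sum>n<Suc N. of_real (real n + 1) powr (- s)) + complex_of_real (real N + 2) powr (- s)"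
    by (subst sum.lessThan_Suc) (simp only: e)
  have Y: "(\<Sum>n<Suc N. zeta_term n s) = (\<Sum>n<N. zeta_term n s) + zeta_term N s" by simp
  have gen: "(s - 1) * (A - 1/2 - p / 2) + q - 1 + ((s - 1) * (p + p') / 2 + (q' - q)) = (s - 1) * (A + p' - 1/2 - p' / 2) + q' - 1"
    for A p q p' q' :: complex by (simp add: field_simps)
  show ?case unfolding Y Suc.IH X e zeta_term_def[of N s] by (rule gen)
qed

lemma tendsto_powr_neg_complex:
  assumes "Re s < 0" shows "(\<lambda>n. of_real (real n + 1) powr s) \<longlonglongrightarrow> 0"
proof -
  have "(\<lambda>n. (real n + 1) powr Re s) \<longlonglongrightarrow> 0" using assms by real_asymp
  then have "(\<lambda>n. norm (complex_of_real (real n + 1) powr s)) \<longlonglongrightarrow> 0"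
    by (simp add: norm_powr_real_powr)
  then show ?thesis by (rule tendsto_norm_zero_cancel)
qed

lemma zeta_series_sums:
  assumes s: "Re s > 1"
  shows "(\<lambda>n. of_nat (Suc n) powr (- s)) sums (zeta_reg s / (s - 1))"
proof -
  have s1: "s \<noteq> 1" using s by auto
  have "(\<lambda>N. \<Sum>n<N. zeta_term n s) \<longlonglongrightarrow> (\<Sum>n. zeta_term n s)"
    using summable_zeta_term[of s] s by (simp add: summable_LIMSEQ)
  moreover have "(\<lambda>N. of_real (real N + 1) powr (- s)) \<longlonglongrightarrow> 0" "(\<lambda>N. of_real (real N + 1) powr (1 - s)) \<longlonglongrightarrow> 0"
    by (intro tendsto_powr_neg_complex; use s in simp)+
  ultimately have "(\<lambda>N. ((\<Sum>n<N. zeta_term n s) - of_real (real N + 1) powr (1 - s) + 1) / (s - 1) + 1/2 + of_real (real N + 1) powr (- s) / 2)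
     \<longlonglongrightarrow> ((\<Sum>n. zeta_term n s) - 0 + 1) / (s - 1) + 1/2 + 0 / 2"
    using s1 by (intro tendsto_intros) auto
  moreover have "((\<Sum>n<N. zeta_term n s) - of_real (real N + 1) powr (1 - s) + 1) / (s - 1) + 1/2 + of_real (real N + 1) powr (- s) / 2
      = (\<Sum>n<Suc N. of_nat (Suc n) powr (- s))" for N
    using s1 unfolding sum_zeta_term by (simp add: field_simps del: sum.lessThan_Suc)
  moreover have "((\<Sum>n. zeta_term n s) - 0 + 1) / (s - 1) + 1/2 + 0 / 2 = zeta_reg s / (s - 1)"
    using s1 by (simp add: zeta_reg_def field_simps)
  ultimately have "(\<lambda>N. (\<Sum>n<Suc N. of_nat (Suc n) powr (- s))) \<longlonglongrightarrow> zeta_reg s / (s - 1)" by simp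
  then show ?thesis unfolding sums_def by (subst (asm) filterlim_sequentially_Suc)
qed

text \<open>Termwise differentiation at 1 turns each summand into the trapezoid error of 1/u, and
  these errors add up to a harmonic number minus a logarithm. In classical terms, (s - 1) zeta(s) =
  1 + gamma (s - 1) + ... with Euler's gamma.\<close>

lemma zeta_reg_deriv_1: "deriv zeta_reg 1 = euler_mascheroni"
proof -
  obtain d where d: "d > 0" "cball 1 d \<subseteq> {s. Re s > -1}"
    and ul: "uniform_limit (cball 1 d) (\<lambda>N s. \<Sum>n<N. zeta_term n s) (\<lambda>s. \<Sum>n. zeta_term n s) sequentially"
    using zeta_series_uniform_limit[of 1] by auto
  have ul': "uniform_limit (ball 1 d) (\<lambda>N s. \<Sum>n<N. zeta_term n s) (\<lambda>s. \<Sum>n. zeta_term n s) sequentially"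
    by (rule uniform_limit_on_subset[OF ul]) auto
  have lim: "(\<lambda>N. deriv (\<lambda>s. \<Sum>n<N. zeta_term n s) 1) \<longlonglongrightarrow> deriv (\<lambda>s. \<Sum>n. zeta_term n s) 1"
    by (rule deriv_complex_uniform_limit[OF ul'])
       (use d in \<open>auto intro!: always_eventually holomorphic_intros holomorphic_zeta_term\<close>)
  define tr where "tr = (\<lambda>n. (1 / (real n + 1) + 1 / (real n + 2)) / 2 - (ln (real n + 2) - ln (real n + 1)))"
  define t where "t = (\<lambda>n. complex_of_real (tr n))"
  have dt: "(zeta_term n has_field_derivative t n) (at 1)" for n
  proof -
    define a b where "a = complex_of_real (ln (real n + 1))" and "b = complex_of_real (ln (real n + 2))"
    have pw: "of_real (real n + 1) powr w = exp (w * a)" "of_real (real n + 2) powr w = exp (w * b)" for w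
      using Ln_of_real[of "real n + 1"] Ln_of_real[of "real n + 2"]
      by (auto simp: powr_def a_def b_def simp del: of_real_add)
    have ea: "exp (- a) = of_real (1 / (real n + 1))" "exp (- b) = of_real (1 / (real n + 2))"
      unfolding a_def b_def of_real_minus[symmetric] exp_of_real exp_minus by (auto simp: inverse_eq_divide)
    have "((\<lambda>s. (s - 1) * (exp (- s * a) + exp (- s * b)) / 2 + (exp ((1 - s) * b) - exp ((1 - s) * a)))
       has_field_derivative (exp (- a) + exp (- b)) / 2 - (b - a)) (at 1)"
      by (auto intro!: derivative_eq_intros)
    then show ?thesis
      unfolding zeta_term_def[abs_def] pw t_def tr_def ea by (simp add: a_def b_def)
  qed
  have ds: "deriv (\<lambda>s. \<Sum>n<N. zeta_term n s) 1 = (\<Sum>n<N. t n)" for N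
    by (intro DERIV_imp_deriv DERIV_sum dt)
  have str: "(\<Sum>n<N. tr n) = harm (Suc N) - ln (real (Suc N)) - 1/2 - 1 / (2 * (real N + 1))" for N
  proof (induction N)
    case 0
    show ?case by (simp add: harm_expand)
  next
    case (Suc N)
    have "harm (Suc (Suc N)) = harm (Suc N) + 1 / (real N + 2)" by (simp add: harm_Suc field_simps)
    moreover have "real (Suc (Suc N)) = real N + 2" "real (Suc N) = real N + 1" by simp_all
    moreover have "(1 / (real N + 1) + 1 / (real N + 2)) / 2 = 1 / (real N + 2) - 1 / (2 * (real N + 1 + 1)) + 1 / (2 * (real N + 1))"
    proof -
      have "1 / (2 * (real N + 1 + 1)) = (1 / (real N + 2)) / 2" "1 / (2 * (real N + 1)) = (1 / (real N + 1)) / 2" by simp_all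
      moreover have "(x + y) / 2 = y - z + w" if "z = y / 2" "w = x / 2" for x y z w :: real
        using that by simp
      ultimately show ?thesis by blast
    qed
    ultimately show ?case using Suc by (simp only: sum.lessThan_Suc tr_def)
  qed
  have st: "(\<Sum>n<N. t n) = of_real (harm (Suc N) - ln (real (Suc N)) - 1/2 - 1 / (2 * (real N + 1)))" for N
    unfolding str[symmetric] t_def by simp
  have "(\<lambda>N. harm (Suc N) - ln (real (Suc N)) - 1/2 - 1 / (2 * (real N + 1))) \<longlonglongrightarrow> euler_mascheroni - 1/2 - 0"
  proof (intro tendsto_diff tendsto_const)
    show "(\<lambda>N. harm (Suc N) - ln (real (Suc N))) \<longlonglongrightarrow> euler_mascheroni"
      using euler_mascheroni_LIMSEQ by (rule filterlim_compose[OF _ filterlim_Suc])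
    show "(\<lambda>N. 1 / (2 * (real N + 1))) \<longlonglongrightarrow> 0" by real_asymp
  qed
  then have "(\<lambda>N. deriv (\<lambda>s. \<Sum>n<N. zeta_term n s) 1) \<longlonglongrightarrow> of_real (euler_mascheroni - 1/2 - 0)"
    unfolding ds st by (rule tendsto_of_real)
  with lim have D: "deriv (\<lambda>s. \<Sum>n. zeta_term n s) 1 = of_real (euler_mascheroni - 1/2 - 0)"
    by (rule LIMSEQ_unique)
  have "((\<lambda>s. \<Sum>n. zeta_term n s) has_field_derivative deriv (\<lambda>s. \<Sum>n. zeta_term n s) 1) (at 1)"
    by (rule holomorphic_derivI[OF zeta_series_holomorphic open_halfplane_Re]) simp
  then have "(zeta_reg has_field_derivative 1/2 + of_real (euler_mascheroni - 1/2 - 0)) (at 1)"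
    unfolding zeta_reg_def[abs_def] D by (auto intro!: derivative_eq_intros)
  then have "deriv zeta_reg 1 = 1/2 + of_real (euler_mascheroni - 1/2 - 0)" by (rule DERIV_imp_deriv)
  also have "\<dots> = euler_mascheroni" by (simp add: of_real_euler_mascheroni)
  finally show ?thesis .
qed

lemma zeta_reg_bound:
  assumes s: "Re s \<ge> 1/2"
  shows "cmod (zeta_reg s) \<le> (cmod s + 2) ^ 3"
proof -
  define x where "x = cmod s + 1"
  have x: "x \<ge> 1" by (simp add: x_def)
  have x1: "cmod (s - 1) \<le> x" "cmod s \<le> x" "cmod (s + 1) \<le> x"
    using norm_triangle_ineq4[of s 1] norm_triangle_ineq[of s 1] by (auto simp: x_def)
  have tb: "cmod (zeta_term n s) \<le> x ^ 3 / 8 * (1 / (real n + 1) ^ 2)" for n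
  proof -
    have "cmod (zeta_term n s) \<le> cmod (s - 1) * cmod s * cmod (s + 1) / 8 * (real n + 1) powr (- Re s - 2)"
      using s by (intro zeta_term_bound) auto
    also have "\<dots> \<le> (x * x * x) / 8 * (real n + 1) powr (- 2)"
      using s x1 x by (intro mult_mono divide_right_mono powr_mono) auto
    also have "(real n + 1) powr (- 2) = 1 / (real n + 1) ^ 2" by (simp add: powr_minus powr_numeral inverse_eq_divide)
    finally show ?thesis by (simp add: power3_eq_cube)
  qed
  have sm: "(\<lambda>n. x ^ 3 / 8 * (1 / (real n + 1) ^ 2)) sums (x ^ 3 / 8 * (pi\<^sup>2 / 6))"
    using sums_mult[OF inverse_squares_sums, of "x ^ 3 / 8"] by (simp add: add.commute)
  have "cmod (\<Sum>n. zeta_term n s) \<le> x ^ 3 / 8 * (pi\<^sup>2 / 6)"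
    using norm_suminf_le[OF tb sums_summable[OF sm]] sums_unique[OF sm] by simp
  also have "\<dots> \<le> x ^ 3 / 8 * 4"
    using pi_less_4 pi_gt_zero power_mono[of pi 4 2] x by (intro mult_left_mono) auto
  finally have b: "cmod (\<Sum>n. zeta_term n s) \<le> x ^ 3 / 2" by simp
  have "cmod (zeta_reg s) \<le> cmod (1 + (s - 1) / 2) + cmod (\<Sum>n. zeta_term n s)"
    unfolding zeta_reg_def by (rule norm_triangle_ineq)
  also have "cmod (1 + (s - 1) / 2) \<le> 1 + cmod (s - 1) / 2"
    using norm_triangle_ineq[of 1 "(s - 1) / 2"] by (simp add: norm_divide)
  finally have "cmod (zeta_reg s) \<le> 1 + x / 2 + x ^ 3 / 2" using b x1 by simp
  also have "\<dots> \<le> (x + 1) ^ 3"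
  proof -
    have "(x + 1) ^ 3 = x ^ 3 + 3 * x ^ 2 + 3 * x + 1" by (simp add: power3_eq_cube power2_eq_square algebra_simps)
    moreover have "x ^ 3 \<ge> 0" "x ^ 2 \<ge> 0" using x by auto
    ultimately show ?thesis using x by linarith
  qed
  finally show ?thesis by (simp add: x_def add_ac)
qed

text \<open>zeta(s) - 1 is at most zeta(2) - 1 = 0.645 in modulus. A bound below 1 keeps |zeta| away
  from 0, so that ln |zeta| is bounded on this half-plane.\<close>

lemma zeta_reg_near_1:
  assumes s: "Re s \<ge> 2"
  shows "cmod (zeta_reg s / (s - 1) - 1) \<le> 7/10"
proof -
  have "(\<lambda>n. of_nat (Suc n) powr (- s)) sums (zeta_reg s / (s - 1))" using s by (intro zeta_series_sums) auto
  then have s1: "(\<lambda>n. of_nat (Suc (Suc n)) powr (- s)) sums (zeta_reg s / (s - 1) - 1)"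
    by (subst sums_Suc_iff) simp
  have s2: "(\<lambda>n. 1 / (real (Suc n) + 1)\<^sup>2) sums (pi\<^sup>2 / 6 - 1)"
    using inverse_squares_sums by (subst sums_Suc_iff[of "\<lambda>n. 1 / (real n + 1)\<^sup>2"]) (simp add: add.commute)
  have le: "cmod (of_nat (Suc (Suc n)) powr (- s)) \<le> 1 / (real (Suc n) + 1)\<^sup>2" for n
  proof -
    have "cmod (of_nat (Suc (Suc n)) powr (- s)) = real (Suc (Suc n)) powr (- Re s)"
      using norm_powr_real_powr[of "of_nat (Suc (Suc n))" "- s"] by simp
    also have "\<dots> \<le> real (Suc (Suc n)) powr (- 2)" using s by (intro powr_mono) auto
    also have "\<dots> = 1 / (real (Suc n) + 1)\<^sup>2" by (simp add: powr_minus powr_numeral inverse_eq_divide add_ac)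
    finally show ?thesis .
  qed
  have "cmod (zeta_reg s / (s - 1) - 1) \<le> pi\<^sup>2 / 6 - 1"
    using norm_suminf_le[OF le sums_summable[OF s2]] sums_unique[OF s1] sums_unique[OF s2] by simp
  also have "\<dots> \<le> 7/10"
  proof -
    have "pi\<^sup>2 \<le> (3.15)\<^sup>2" using pi_approx(2) pi_gt_zero by (intro power_mono) auto
    then show ?thesis by (simp add: power2_eq_square)
  qed
  finally show ?thesis .
qed

section \<open>The functional equation\<close>

lemma nn_integral_Gamma_scaled:
  fixes p c :: real
  assumes "p > 0" "c > 0"
  shows "(\<integral>\<^sup>+x. ennreal (x powr (p - 1) * exp (- c * x)) * indicator {0<..} x \<partial>lborel)
    = ennreal (Gamma p * c powr (- p))"
proof -
  have "(\<integral>\<^sup>+x. ennreal (x powr (p - 1) * exp (- c * x)) * indicator {0<..} x \<partial>lborel)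
     = ennreal \<bar>1 / c\<bar> * (\<integral>\<^sup>+x. ennreal ((0 + 1 / c * x) powr (p - 1) * exp (- c * (0 + 1 / c * x))) * indicator {0<..} (0 + 1 / c * x) \<partial>lborel)"
    by (rule nn_integral_real_affine) (use assms in auto)
  also have "(\<integral>\<^sup>+x. ennreal ((0 + 1 / c * x) powr (p - 1) * exp (- c * (0 + 1 / c * x))) * indicator {0<..} (0 + 1 / c * x) \<partial>lborel)
     = (\<integral>\<^sup>+x. ennreal (c powr (1 - p)) * ennreal (indicator {0..} x * x powr (p - 1) / exp x) \<partial>lborel)"
  proof (rule nn_integral_cong)
    fix x :: real
    have "ennreal ((x / c) powr (p - 1) * exp (- x)) = ennreal (c powr (1 - p)) * ennreal (x powr (p - 1) / exp x)" if "x > 0"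
      using that assms by (subst ennreal_mult[symmetric]) (auto simp: powr_divide exp_minus powr_diff field_simps)
    then show "ennreal ((0 + 1 / c * x) powr (p - 1) * exp (- c * (0 + 1 / c * x))) * indicator {0<..} (0 + 1 / c * x)
       = ennreal (c powr (1 - p)) * ennreal (indicator {0..} x * x powr (p - 1) / exp x)"
      using assms by (cases "x > 0") (auto simp: indicator_def zero_less_divide_iff)
  qed
  also have "\<dots> = ennreal (c powr (1 - p)) * (\<integral>\<^sup>+x. ennreal (indicator {0..} x * x powr (p - 1) / exp x) \<partial>lborel)"
    by (rule nn_integral_cmult) auto
  also have "\<dots> = ennreal (c powr (1 - p)) * ennreal (Gamma p)"
    by (simp only: Gamma_conv_nn_integral_real[OF assms(1)])
  also have "ennreal \<bar>1 / c\<bar> * \<dots> = ennreal (1 / c * (c powr (1 - p) * Gamma p))"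
    using assms by (simp add: ennreal_mult[symmetric] abs_of_pos)
  also have "1 / c * (c powr (1 - p) * Gamma p) = Gamma p * c powr (- p)"
    using assms by (simp add: powr_diff powr_minus field_simps)
  finally show ?thesis .
qed

lemma nn_integral_exhaust:
  fixes F :: "real \<Rightarrow> ennreal"
  assumes [measurable]: "F \<in> borel_measurable borel" and h: "incseq h" "filterlim h at_top sequentially"
  shows "(\<integral>\<^sup>+x. F x * indicator {0..} x \<partial>lborel) = (SUP N. \<integral>\<^sup>+x. F x * indicator {0..h N} x \<partial>lborel)"
proof -
  have "(SUP N. F x * indicator {0..h N} x) = F x * indicator {0..} x" for x
  proof (cases "x \<ge> 0")
    case True
    obtain N where "h N \<ge> x"
      using h(2) unfolding filterlim_at_top eventually_sequentially by blast
    then have "F x * indicator {0..} x \<le> (SUP N. F x * indicator {0..h N} x)"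
      using True by (intro SUP_upper2[of N]) auto
    moreover have "(SUP N. F x * indicator {0..h N} x) \<le> F x * indicator {0..} x"
      by (intro SUP_least mult_left_mono) (auto simp: indicator_def)
    ultimately show ?thesis by (rule antisym[rotated])
  qed auto
  then have "(\<integral>\<^sup>+x. F x * indicator {0..} x \<partial>lborel) = (\<integral>\<^sup>+x. (SUP N. F x * indicator {0..h N} x) \<partial>lborel)" by simp
  also have "\<dots> = (SUP N. \<integral>\<^sup>+x. F x * indicator {0..h N} x \<partial>lborel)"
  proof (rule nn_integral_monotone_convergence_SUP)
    show "incseq (\<lambda>N x. F x * indicator {0..h N} x)"
      using h(1) by (auto simp: incseq_def le_fun_def indicator_def intro: order_trans)
  qed auto
  finally show ?thesis .
qed

lemma nn_integral_square_substitution: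
  fixes f :: "real \<Rightarrow> ennreal"
  assumes [measurable]: "f \<in> borel_measurable borel"
  shows "(\<integral>\<^sup>+w. f w * indicator {0..} w \<partial>lborel) = (\<integral>\<^sup>+y. f (y\<^sup>2) * ennreal (2 * y) * indicator {0..} y \<partial>lborel)"
proof -
  have "(\<integral>\<^sup>+w. f w * indicator {0..} w \<partial>lborel) = (SUP N. \<integral>\<^sup>+x. f x * indicator {0..(real N + 1)\<^sup>2} x \<partial>lborel)"
  proof (rule nn_integral_exhaust)
    show "incseq (\<lambda>N. (real N + 1)\<^sup>2)" by (auto simp: incseq_def intro!: power_mono)
    show "filterlim (\<lambda>N. (real N + 1)\<^sup>2) at_top sequentially" by real_asymp
  qed auto
  also have "\<dots> = (SUP N. \<integral>\<^sup>+y. f (y\<^sup>2) * ennreal (2 * y) * indicator {0..real N + 1} y \<partial>lborel)"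
  proof (rule SUP_cong[OF refl])
    fix N :: nat
    show "(\<integral>\<^sup>+x. f x * indicator {0..(real N + 1)\<^sup>2} x \<partial>lborel) = (\<integral>\<^sup>+y. f (y\<^sup>2) * ennreal (2 * y) * indicator {0..real N + 1} y \<partial>lborel)"
      using nn_integral_substitution_aux[of f 0 "real N + 1" "\<lambda>y. y\<^sup>2" "\<lambda>y. 2 * y"]
      by (force intro!: derivative_eq_intros continuous_intros)
  qed
  also have "\<dots> = (\<integral>\<^sup>+y. f (y\<^sup>2) * ennreal (2 * y) * indicator {0..} y \<partial>lborel)"
  proof (rule nn_integral_exhaust[symmetric])
    show "incseq (\<lambda>N. real N + 1)" by (auto simp: incseq_def)
    show "filterlim (\<lambda>N. real N + 1) at_top sequentially" by real_asymp
  qed auto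
  finally show ?thesis .
qed

lemma nn_integral_gaussian_moment:
  fixes s t :: real
  assumes "-1 < s" "t > 0"
  shows "(\<integral>\<^sup>+y. ennreal (y powr s * exp (- t * y\<^sup>2)) * indicator {0<..} y \<partial>lborel)
     = ennreal (Gamma ((s + 1) / 2) * t powr (- ((s + 1) / 2)) / 2)"
proof -
  define p where "p = (s + 1) / 2"
  have p: "p > 0" using assms by (simp add: p_def)
  define f where "f = (\<lambda>x::real. ennreal (1/2) * (ennreal (x powr (p - 1) * exp (- t * x)) * indicator {0<..} x))"
  have [measurable]: "f \<in> borel_measurable borel" unfolding f_def by measurable
  have "(\<integral>\<^sup>+y. ennreal (y powr s * exp (- t * y\<^sup>2)) * indicator {0<..} y \<partial>lborel)
      = (\<integral>\<^sup>+y. f (y\<^sup>2) * ennreal (2 * y) * indicator {0..} y \<partial>lborel)"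
  proof (rule nn_integral_cong)
    fix y :: real
    have "f (y\<^sup>2) * ennreal (2 * y) = ennreal (y powr s * exp (- t * y\<^sup>2))" if "y > 0"
    proof -
      have "(y\<^sup>2) powr (p - 1) * y = y powr s"
      proof -
        have "(y\<^sup>2) powr (p - 1) * y = y powr (2 * (p - 1)) * y powr 1"
          using that by (simp add: powr_powr flip: powr_numeral)
        also have "\<dots> = y powr s" by (simp only: powr_add[symmetric]) (simp add: p_def field_simps)
        finally show ?thesis .
      qed
      then have eq: "1/2 * ((y\<^sup>2) powr (p - 1) * exp (- t * y\<^sup>2)) * (2 * y) = y powr s * exp (- t * y\<^sup>2)" by simp
      have "f (y\<^sup>2) * ennreal (2 * y) = ennreal (1/2 * ((y\<^sup>2) powr (p - 1) * exp (- t * y\<^sup>2)) * (2 * y))"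
        using that by (subst ennreal_mult; (subst ennreal_mult)?) (auto simp: f_def)
      then show ?thesis by (simp only: eq)
    qed
    then show "ennreal (y powr s * exp (- t * y\<^sup>2)) * indicator {0<..} y = f (y\<^sup>2) * ennreal (2 * y) * indicator {0..} y"
      by (cases "y > 0"; cases "y = 0") (auto simp: f_def)
  qed
  also have "\<dots> = (\<integral>\<^sup>+w. f w * indicator {0..} w \<partial>lborel)" by (rule nn_integral_square_substitution[symmetric]) simp
  also have "\<dots> = (\<integral>\<^sup>+w. f w \<partial>lborel)" by (intro nn_integral_cong) (auto simp: f_def indicator_def)
  also have "\<dots> = ennreal (1/2) * ennreal (Gamma p * t powr (- p))"
    unfolding f_def by (subst nn_integral_cmult) (use nn_integral_Gamma_scaled[OF p assms(2)] in auto)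
  also have "\<dots> = ennreal (Gamma p * t powr (- p) / 2)"
    using p by (subst ennreal_mult[symmetric]) (auto simp: field_simps)
  finally show ?thesis by (simp add: p_def)
qed

text \<open>Write 1 / (1 + y^2) as the integral of exp (- t (1 + y^2)) over t > 0 and exchange: the
  inner integral is a Gaussian moment, the outer one a Gamma integral. The value is kept as a
  product of Gammas, since one of them later meets the duplication formula.\<close>

lemma nn_integral_powr_over_quadratic_1:
  fixes s :: real
  assumes s: "-1 < s" "s < 1"
  shows "(\<integral>\<^sup>+y. ennreal (y powr s / (1 + y\<^sup>2)) * indicator {0<..} y \<partial>lborel)
     = ennreal (Gamma ((s + 1) / 2) * Gamma ((1 - s) / 2) / 2)"
proof -
  define p where "p = (s + 1) / 2"
  have p: "p > 0" "1 - p > 0" "1 - p = (1 - s) / 2" using s by (auto simp: p_def field_simps)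
  have "(\<integral>\<^sup>+y. ennreal (y powr s / (1 + y\<^sup>2)) * indicator {0<..} y \<partial>lborel)
     = (\<integral>\<^sup>+y. (\<integral>\<^sup>+t. ennreal (y powr s * exp (- t * (1 + y\<^sup>2))) * indicator {0<..} t * indicator {0<..} y \<partial>lborel) \<partial>lborel)"
  proof (rule nn_integral_cong)
    fix y :: real
    have y: "1 + y\<^sup>2 > 0" by (rule add_pos_nonneg) auto
    have "(\<integral>\<^sup>+t. ennreal (y powr s * exp (- t * (1 + y\<^sup>2))) * indicator {0<..} t * indicator {0<..} y \<partial>lborel)
       = (\<integral>\<^sup>+t. (ennreal (y powr s) * indicator {0<..} y) * (ennreal (t powr (1 - 1) * exp (- (1 + y\<^sup>2) * t)) * indicator {0<..} t) \<partial>lborel)"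
      by (intro nn_integral_cong) (auto simp: indicator_def ennreal_mult[symmetric] algebra_simps)
    also have "\<dots> = (ennreal (y powr s) * indicator {0<..} y) * ennreal (Gamma 1 * (1 + y\<^sup>2) powr (- 1))"
      using nn_integral_Gamma_scaled[of 1 "1 + y\<^sup>2"] y by (subst nn_integral_cmult) auto
    also have "\<dots> = ennreal (y powr s / (1 + y\<^sup>2)) * indicator {0<..} y"
      using y by (auto simp: indicator_def ennreal_mult[symmetric] powr_minus field_simps)
    finally show "ennreal (y powr s / (1 + y\<^sup>2)) * indicator {0<..} y =
      (\<integral>\<^sup>+t. ennreal (y powr s * exp (- t * (1 + y\<^sup>2))) * indicator {0<..} t * indicator {0<..} y \<partial>lborel)" by simp
  qed
  also have "\<dots> = (\<integral>\<^sup>+t. (\<integral>\<^sup>+y. ennreal (y powr s * exp (- t * (1 + y\<^sup>2))) * indicator {0<..} t * indicator {0<..} y \<partial>lborel) \<partial>lborel)"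
    by (rule lborel_pair.Fubini') measurable
  also have "\<dots> = (\<integral>\<^sup>+t. ennreal (Gamma p / 2) * (ennreal (t powr (1 - p - 1) * exp (- 1 * t)) * indicator {0<..} t) \<partial>lborel)"
  proof (rule nn_integral_cong)
    fix t :: real
    show "(\<integral>\<^sup>+y. ennreal (y powr s * exp (- t * (1 + y\<^sup>2))) * indicator {0<..} t * indicator {0<..} y \<partial>lborel)
      = ennreal (Gamma p / 2) * (ennreal (t powr (1 - p - 1) * exp (- 1 * t)) * indicator {0<..} t)"
    proof (cases "t > 0")
      case True
      have "(\<integral>\<^sup>+y. ennreal (y powr s * exp (- t * (1 + y\<^sup>2))) * indicator {0<..} t * indicator {0<..} y \<partial>lborel)
        = (\<integral>\<^sup>+y. ennreal (exp (- t)) * (ennreal (y powr s * exp (- t * y\<^sup>2)) * indicator {0<..} y) \<partial>lborel)"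
      proof (rule nn_integral_cong)
        fix y :: real
        have eq: "y powr s * exp (- t * (1 + y\<^sup>2)) = exp (- t) * (y powr s * exp (- t * y\<^sup>2))"
        proof -
          have "- t * (1 + y\<^sup>2) = - t + - t * y\<^sup>2" by (simp add: algebra_simps)
          then show ?thesis by (simp only: exp_add mult_ac)
        qed
        show "ennreal (y powr s * exp (- t * (1 + y\<^sup>2))) * indicator {0<..} t * indicator {0<..} y =
           ennreal (exp (- t)) * (ennreal (y powr s * exp (- t * y\<^sup>2)) * indicator {0<..} y)"
          unfolding eq using True by (simp add: ennreal_mult mult_ac)
      qed
      also have "\<dots> = ennreal (exp (- t)) * ennreal (Gamma p * t powr (- p) / 2)"
        using nn_integral_gaussian_moment[OF s(1) True] by (subst nn_integral_cmult) (auto simp: p_def)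
      also have "\<dots> = ennreal (Gamma p / 2) * ennreal (t powr (1 - p - 1) * exp (- 1 * t))"
        using p by (subst (1 2) ennreal_mult[symmetric]) (auto simp: field_simps)
      finally show ?thesis using True by simp
    qed auto
  qed
  also have "\<dots> = ennreal (Gamma p / 2) * ennreal (Gamma (1 - p) * 1 powr (- (1 - p)))"
    by (subst nn_integral_cmult) (use nn_integral_Gamma_scaled[OF p(2), of 1] in auto)
  also have "\<dots> = ennreal (Gamma p * Gamma (1 - p) / 2)"
    using p by (subst ennreal_mult[symmetric]) (auto simp: field_simps)
  finally show ?thesis by (simp add: p_def[symmetric] p(3))
qed

lemma nn_integral_powr_over_quadratic:
  fixes s a :: real
  assumes s: "-1 < s" "s < 1" and a: "a > 0"
  shows "(\<integral>\<^sup>+x. ennreal (x powr (s - 1) * (2 * x / (x\<^sup>2 + a\<^sup>2))) * indicator {0<..} x \<partial>lborel)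
     = ennreal (a powr (s - 1) * (Gamma ((s + 1) / 2) * Gamma ((1 - s) / 2)))"
proof -
  have "(\<integral>\<^sup>+x. ennreal (x powr (s - 1) * (2 * x / (x\<^sup>2 + a\<^sup>2))) * indicator {0<..} x \<partial>lborel)
     = ennreal \<bar>a\<bar> * (\<integral>\<^sup>+x. ennreal ((0 + a * x) powr (s - 1) * (2 * (0 + a * x) / ((0 + a * x)\<^sup>2 + a\<^sup>2))) * indicator {0<..} (0 + a * x) \<partial>lborel)"
    by (rule nn_integral_real_affine) (use a in auto)
  also have "(\<integral>\<^sup>+x. ennreal ((0 + a * x) powr (s - 1) * (2 * (0 + a * x) / ((0 + a * x)\<^sup>2 + a\<^sup>2))) * indicator {0<..} (0 + a * x) \<partial>lborel)
     = (\<integral>\<^sup>+x. ennreal (2 * a powr (s - 2)) * (ennreal (x powr s / (1 + x\<^sup>2)) * indicator {0<..} x) \<partial>lborel)"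
  proof (rule nn_integral_cong)
    fix x :: real
    have "(a * x) powr (s - 1) * (2 * (a * x) / ((a * x)\<^sup>2 + a\<^sup>2)) = 2 * a powr (s - 2) * (x powr s / (1 + x\<^sup>2))" if "x > 0"
    proof -
      have den: "1 + x\<^sup>2 \<noteq> 0" by (smt (verit) zero_le_power2)
      have e1: "2 * (a * x) / ((a * x)\<^sup>2 + a\<^sup>2) = (2 / a) * (x / (1 + x\<^sup>2))"
      proof -
        have "(a * x)\<^sup>2 + a\<^sup>2 = a * (a * (1 + x\<^sup>2))" by (simp add: power2_eq_square algebra_simps)
        then show ?thesis using a den by (simp add: divide_simps)
      qed
      have e2: "(a * x) powr (s - 1) = a powr (s - 2) * a * (x powr s / x)"
      proof -
        have "a powr (s - 1) = a powr (s - 2) * a powr 1" by (simp only: powr_add[symmetric]) simp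
        then show ?thesis using a that by (simp add: powr_mult powr_diff power2_eq_square)
      qed
      show ?thesis unfolding e1 e2 using a that by simp
    qed
    then show "ennreal ((0 + a * x) powr (s - 1) * (2 * (0 + a * x) / ((0 + a * x)\<^sup>2 + a\<^sup>2))) * indicator {0<..} (0 + a * x)
       = ennreal (2 * a powr (s - 2)) * (ennreal (x powr s / (1 + x\<^sup>2)) * indicator {0<..} x)"
      using a by (cases "x > 0") (auto simp: indicator_def ennreal_mult[symmetric] zero_less_mult_iff)
  qed
  also have "\<dots> = ennreal (2 * a powr (s - 2)) * ennreal (Gamma ((s + 1) / 2) * Gamma ((1 - s) / 2) / 2)"
    by (subst nn_integral_cmult) (use nn_integral_powr_over_quadratic_1[OF s] in auto)
  also have "ennreal \<bar>a\<bar> * \<dots> = ennreal (a * (2 * a powr (s - 2) * (Gamma ((s + 1) / 2) * Gamma ((1 - s) / 2) / 2)))"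
    using a s by (simp add: ennreal_mult[symmetric] Gamma_real_nonneg)
  also have "a * (2 * a powr (s - 2) * (Gamma ((s + 1) / 2) * Gamma ((1 - s) / 2) / 2)) = a powr (s - 1) * (Gamma ((s + 1) / 2) * Gamma ((1 - s) / 2))"
  proof -
    have "a powr (s - 1) = a powr (s - 2) * a powr 1" by (simp only: powr_add[symmetric]) simp
    then show ?thesis using a by simp
  qed
  finally show ?thesis .
qed

text \<open>Differentiating Euler's reflection formula expresses pi cot (pi w) by a difference of
  Digamma values, and the limit formula for Digamma turns that difference into a series. At w = i x
  / (2 pi) the cotangent becomes hyperbolic.\<close>

lemma coth_partial_fractions:
  fixes x :: real
  assumes x: "x > 0"
  shows "(\<lambda>n. 2 * x / (x\<^sup>2 + (2 * pi * (real n + 1))\<^sup>2)) sums (1 / (exp x - 1) - 1 / x + 1 / 2)"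
proof -
  define y where "y = x / (2 * pi)"
  have y: "y > 0" using x by (simp add: y_def)
  define w where "w = \<i> * complex_of_real y"
  have w0: "w \<noteq> 0" using y by (simp add: w_def)
  have nI: "1 + w \<notin> \<int>\<^sub>\<le>\<^sub>0" "1 - w \<notin> \<int>\<^sub>\<le>\<^sub>0" "1 + w \<noteq> 0" "1 - w \<noteq> 0"
    using y by (auto simp: w_def complex_eq_iff elim!: nonpos_Ints_cases)
  have snz: "sin (of_real pi * w) \<noteq> 0"
  proof
    assume "sin (of_real pi * w) = 0"
    then obtain n :: int where "of_real pi * w = of_real (n * pi)" unfolding sin_eq_0 by blast
    then have "Im (of_real pi * w) = 0" by simp
    then show False using y by (simp add: w_def)
  qed
  \<comment> \<open>The reflection formula with 1/Gamma(u) rewritten as u/Gamma(1 + u), so that all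
    factors are regular near w; both sides are then differentiated.\<close>
  have prod_eq: "rGamma (1 + u) * rGamma (1 - u) * u * of_real pi = sin (of_real pi * u)" for u :: complex
  proof -
    have "rGamma u = u * rGamma (1 + u)" using rGamma_plus1[of u] by (simp add: add.commute)
    then show ?thesis using rGamma_reflection_complex[of u] by (simp add: field_simps)
  qed
  have "((\<lambda>u. rGamma (1 + u) * rGamma (1 - u) * u * of_real pi) has_field_derivative
      ((- rGamma (1 + w) * Digamma (1 + w)) * rGamma (1 - w) + rGamma (1 + w) * (rGamma (1 - w) * Digamma (1 - w))) * w * of_real pi
      + rGamma (1 + w) * rGamma (1 - w) * of_real pi) (at w)"
    using nI by (auto intro!: derivative_eq_intros simp: algebra_simps)
  then have "((\<lambda>u. sin (of_real pi * u)) has_field_derivative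
      ((- rGamma (1 + w) * Digamma (1 + w)) * rGamma (1 - w) + rGamma (1 + w) * (rGamma (1 - w) * Digamma (1 - w))) * w * of_real pi
      + rGamma (1 + w) * rGamma (1 - w) * of_real pi) (at w)"
    unfolding prod_eq .
  moreover have "((\<lambda>u. sin (of_real pi * u)) has_field_derivative of_real pi * cos (of_real pi * w)) (at w)"
    by (auto intro!: derivative_eq_intros)
  ultimately have "of_real pi * cos (of_real pi * w) =
      ((- rGamma (1 + w) * Digamma (1 + w)) * rGamma (1 - w) + rGamma (1 + w) * (rGamma (1 - w) * Digamma (1 - w))) * w * of_real pi
      + rGamma (1 + w) * rGamma (1 - w) * of_real pi"
    by (rule DERIV_unique[rotated])
  also have "\<dots> = sin (of_real pi * w) * (Digamma (1 - w) - Digamma (1 + w)) + sin (of_real pi * w) / w"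
    unfolding prod_eq[of w, symmetric] using w0 by (simp add: algebra_simps)
  finally have key: "Digamma (1 + w) - Digamma (1 - w) = 1 / w - of_real pi * cos (of_real pi * w) / sin (of_real pi * w)"
    using snz by (simp add: field_simps)
  \<comment> \<open>The logarithms in the two limit formulas cancel, leaving partial sums of a
    convergent series.\<close>
  have "(\<lambda>m. (of_real (ln (real m)) - (\<Sum>n<m. inverse (1 + w + of_nat n))) - (of_real (ln (real m)) - (\<Sum>n<m. inverse (1 - w + of_nat n))))
     \<longlonglongrightarrow> Digamma (1 + w) - Digamma (1 - w)"
    by (intro tendsto_diff Digamma_LIMSEQ nI)
  then have "(\<lambda>n. inverse (1 - w + of_nat n) - inverse (1 + w + of_nat n)) sums (Digamma (1 + w) - Digamma (1 - w))"
    unfolding sums_def by (simp add: sum_subtractf)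
  moreover have "inverse (1 - w + of_nat n) - inverse (1 + w + of_nat n) = \<i> * of_real (2 * y / (y\<^sup>2 + (real n + 1)\<^sup>2))" for n
  proof -
    have ne: "1 - w + of_nat n \<noteq> 0" "1 + w + of_nat n \<noteq> 0" using y by (auto simp: w_def complex_eq_iff)
    have "(1 - w + of_nat n) * (1 + w + of_nat n) = of_real (y\<^sup>2 + (real n + 1)\<^sup>2)"
      by (simp add: w_def complex_eq_iff power2_eq_square algebra_simps)
    moreover have "inverse (1 - w + of_nat n) - inverse (1 + w + of_nat n) = 2 * w / ((1 - w + of_nat n) * (1 + w + of_nat n))"
      using ne by (simp add: field_simps)
    ultimately show ?thesis by (simp add: w_def)
  qed
  ultimately have "(\<lambda>n. \<i> * of_real (2 * y / (y\<^sup>2 + (real n + 1)\<^sup>2))) sums (1 / w - of_real pi * cos (of_real pi * w) / sin (of_real pi * w))"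
    by (simp only: key)
  from sums_mult[OF this, of "- \<i>"]
  have "(\<lambda>n. complex_of_real (2 * y / (y\<^sup>2 + (real n + 1)\<^sup>2))) sums (- \<i> * (1 / w - of_real pi * cos (of_real pi * w) / sin (of_real pi * w)))"
    by (simp add: mult.assoc[symmetric])
  moreover have "- \<i> * (1 / w - of_real pi * cos (of_real pi * w) / sin (of_real pi * w)) = of_real (- 1 / y + pi * (exp x + 1) / (exp x - 1))"
  proof -
    define E where "E = complex_of_real (exp (x / 2))"
    have E0: "E \<noteq> 0" by (simp add: E_def)
    have piw: "of_real pi * w = \<i> * of_real (x / 2)" by (simp add: w_def y_def)
    have iw: "\<i> * (of_real pi * w) = - of_real (x / 2)" unfolding piw by (simp add: mult.assoc[symmetric])
    have ex: "exp (\<i> * (of_real pi * w)) = inverse E" "exp (- (\<i> * (of_real pi * w))) = E"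
      unfolding iw by (simp_all only: E_def exp_minus exp_of_real minus_minus)
    have s: "sin (of_real pi * w) = (inverse E - E) / (2 * \<i>)" and c: "cos (of_real pi * w) = (inverse E + E) / 2"
      by (simp_all only: sin_exp_eq cos_exp_eq ex)
    have EE: "E * E = of_real (exp x)" by (simp add: E_def flip: of_real_mult exp_add)
    have x1: "complex_of_real (exp x) \<noteq> 1" using x by (metis exp_eq_one_iff less_irrefl of_real_eq_1_iff)
    have iE: "inverse E + E = (E * E + 1) / E" "inverse E - E = (1 - E * E) / E" using E0 by (simp_all add: field_simps)
    have "- \<i> * (of_real pi * cos (of_real pi * w) / sin (of_real pi * w)) = - (of_real pi * (of_real (exp x) + 1) / (of_real (exp x) - 1))"
      unfolding s c iE EE using E0 x1 by (simp add: field_simps)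
    moreover have "- \<i> * (1 / w) = - 1 / of_real y" using y by (simp add: w_def field_simps)
    ultimately show ?thesis by (simp add: algebra_simps)
  qed
  ultimately have "(\<lambda>n. complex_of_real (2 * y / (y\<^sup>2 + (real n + 1)\<^sup>2))) sums of_real (- 1 / y + pi * (exp x + 1) / (exp x - 1))"
    by simp
  then have "(\<lambda>n. 2 * y / (y\<^sup>2 + (real n + 1)\<^sup>2)) sums (- 1 / y + pi * (exp x + 1) / (exp x - 1))"
    by (simp only: sums_of_real_iff)
  from sums_mult[OF this, of "1 / (2 * pi)"]
  have "(\<lambda>n. 1 / (2 * pi) * (2 * y / (y\<^sup>2 + (real n + 1)\<^sup>2))) sums (1 / (2 * pi) * (- 1 / y + pi * (exp x + 1) / (exp x - 1)))" .
  moreover have "1 / (2 * pi) * (2 * y / (y\<^sup>2 + (real n + 1)\<^sup>2)) = 2 * x / (x\<^sup>2 + (2 * pi * (real n + 1))\<^sup>2)" for n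
  proof -
    have "x = 2 * pi * y" by (simp add: y_def)
    moreover have "(2 * pi * y)\<^sup>2 + (2 * pi * (real n + 1))\<^sup>2 = (2 * pi)\<^sup>2 * (y\<^sup>2 + (real n + 1)\<^sup>2)"
      by (simp only: power_mult_distrib[of "2 * pi"] distrib_left[of "(2 * pi)\<^sup>2"])
    moreover have "y\<^sup>2 + (real n + 1)\<^sup>2 \<noteq> 0" using y by (simp add: sum_power2_eq_zero_iff)
    ultimately show ?thesis by (simp add: power2_eq_square)
  qed
  moreover have "1 / (2 * pi) * (- 1 / y + pi * (exp x + 1) / (exp x - 1)) = 1 / (exp x - 1) - 1 / x + 1 / 2"
  proof -
    have "exp x > 1" using x by simp
    then show ?thesis using x by (simp add: y_def divide_simps) (simp add: algebra_simps)
  qed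
  ultimately show ?thesis by simp
qed

text \<open>The trapezoid errors on \<open>[n, n + 1]\<close> of \<open>exp (- x u)\<close> and, below, of \<open>u powr (- s)\<close>, the latter
  divided by \<open>s (s + 1)\<close> to make it positive; both are integrals against the Peano kernel
  \<open>u (1 - u) / 2\<close>, so Tonelli's theorem applies. The summand \<open>n = 0\<close> is not among the
  summands of \<open>zeta_reg\<close>, which start at \<open>[1, 2]\<close>.\<close>

definition exp_trap :: "nat \<Rightarrow> real \<Rightarrow> real" where
  "exp_trap n x = (exp (- real n * x) + exp (- (real n + 1) * x)) / 2 - (exp (- real n * x) - exp (- (real n + 1) * x)) / x"

lemma exp_trap_peano:
  assumes x: "x > 0"
  shows "((\<lambda>u. (u * (1 - u) / 2) * (x\<^sup>2 * exp (- (real n + u) * x))) has_integral exp_trap n x) {0..1}"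
proof -
  have d: "((\<lambda>v. c * exp (- v * x)) has_vector_derivative (- c * x) * exp (- v * x)) (at v)" for c v
    unfolding has_real_derivative_iff_has_vector_derivative[symmetric] by (auto intro!: derivative_eq_intros)
  have "((\<lambda>u. (u * (1 - u) / 2) *\<^sub>R (x\<^sup>2 * exp (- (real n + u) * x))) has_integral
      ((1/2) *\<^sub>R (1 * exp (- real n * x) + 1 * exp (- (real n + 1) * x)) - ((- 1 / x) * exp (- (real n + 1) * x) - (- 1 / x) * exp (- real n * x)))) {0..1}"
  proof (rule trapezoid_peano[where f' = "\<lambda>v. (- x) * exp (- v * x)"])
    fix v
    show "((\<lambda>v. (- 1 / x) * exp (- v * x)) has_vector_derivative 1 * exp (- v * x)) (at v)"
      using d[of "- 1 / x" v] x by simp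
    show "((\<lambda>v. 1 * exp (- v * x)) has_vector_derivative (- x) * exp (- v * x)) (at v)"
      using d[of 1 v] by simp
    show "((\<lambda>v. (- x) * exp (- v * x)) has_vector_derivative x\<^sup>2 * exp (- v * x)) (at v)"
      using d[of "- x" v] by (simp add: power2_eq_square)
  qed
  moreover have "(1/2) *\<^sub>R (1 * exp (- real n * x) + 1 * exp (- (real n + 1) * x)) - ((- 1 / x) * exp (- (real n + 1) * x) - (- 1 / x) * exp (- real n * x)) = exp_trap n x"
    using x by (simp add: exp_trap_def field_simps)
  ultimately show ?thesis by simp
qed

lemma exp_trap_sums:
  assumes x: "x > 0"
  shows "(\<lambda>n. exp_trap n x) sums (1 / (exp x - 1) - 1 / x + 1 / 2)"
proof -
  define q where "q = exp (- x)"
  have q: "0 < q" "q < 1" using x by (auto simp: q_def)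
  have e: "exp (- real n * x) = q ^ n" "exp (- (real n + 1) * x) = q * q ^ n" for n
    by (auto simp: q_def exp_of_nat_mult[symmetric] algebra_simps simp flip: exp_add)
  have g: "(\<lambda>n. q ^ n) sums (1 / (1 - q))" using q by (intro geometric_sums) auto
  have "(\<lambda>n. q ^ n * ((1 + q) / 2 - (1 - q) / x)) sums (1 / (1 - q) * ((1 + q) / 2 - (1 - q) / x))"
    by (rule sums_mult2[OF g])
  moreover have "exp_trap n x = q ^ n * ((1 + q) / 2 - (1 - q) / x)" for n
    unfolding exp_trap_def e using x by (simp add: field_simps)
  moreover have "1 / (1 - q) * ((1 + q) / 2 - (1 - q) / x) = 1 / (exp x - 1) - 1 / x + 1 / 2"
  proof -
    have "exp x = 1 / q" by (simp add: q_def exp_minus field_simps)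
    then show ?thesis using q x by (simp add: divide_simps) (simp add: algebra_simps)
  qed
  ultimately show ?thesis by simp
qed

lemma exp_trap_nonneg: "x > 0 \<Longrightarrow> exp_trap n x \<ge> 0"
  by (rule has_integral_nonneg[OF exp_trap_peano]) auto

definition powr_trap :: "real \<Rightarrow> nat \<Rightarrow> real" where
  "powr_trap s n = (case n of 0 \<Rightarrow> (1 / (- s) - 1 / (1 - s)) / 2
     | Suc m \<Rightarrow> Re (zeta_term m (of_real s)) / ((s - 1) * s * (s + 1)))"

lemma powr_trap_peano:
  assumes s: "-1 < s" "s < 0"
  shows "((\<lambda>u. (u * (1 - u) / 2) * (real n + u) powr (- s - 2)) has_integral powr_trap s n) {0..1}"
proof (cases n)
  case 0
  \<comment> \<open>On [0, 1] the second derivative is singular at 0, so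
    \<open>trapezoid_peano\<close> does not apply. The factor u of the kernel leaves the exponent -
    s - 1 > -1, and the integral is computed directly.\<close>
  have "((\<lambda>u. (u powr (- s - 1) - u powr (- s)) / 2) has_integral
      (1 powr (- s - 1 + 1) / (- s - 1 + 1) - 1 powr (- s + 1) / (- s + 1)) / 2) {0..1}"
    using s by (intro has_integral_divide has_integral_diff has_integral_powr_from_0) auto
  moreover have "(u powr (- s - 1) - u powr (- s)) / 2 = (u * (1 - u) / 2) * (real n + u) powr (- s - 2)" if "u \<in> {0..1}" for u
  proof (cases "u = 0")
    case False
    then have u: "u > 0" using that by auto
    have e: "- s - 1 = (- s - 2) + 1" "- s = (- s - 2) + 2" by simp_all
    have "u powr (- s - 1) = u powr (- s - 2) * u powr 1" "u powr (- s) = u powr (- s - 2) * u powr 2"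
      using arg_cong[OF e(1), of "(powr) u"] arg_cong[OF e(2), of "(powr) u"] unfolding powr_add .
    then show ?thesis using 0 u by (simp add: power2_eq_square algebra_simps)
  qed (use 0 in auto)
  ultimately have "((\<lambda>u. (u * (1 - u) / 2) * (real n + u) powr (- s - 2)) has_integral
      (1 powr (- s - 1 + 1) / (- s - 1 + 1) - 1 powr (- s + 1) / (- s + 1)) / 2) {0..1}"
    by (rule has_integral_eq[rotated])
  then show ?thesis using 0 by (simp add: powr_trap_def)
next
  case (Suc m)
  define c where "c = (s - 1) * s * (s + 1)"
  have c: "c \<noteq> 0" using s by (simp add: c_def)
  have d: "((\<lambda>x. k * x powr p) has_vector_derivative (k * p) * x powr (p - 1)) (at x)" if "x > 0" for x p k :: real
    unfolding has_real_derivative_iff_has_vector_derivative[symmetric]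
    using that by (auto intro!: derivative_eq_intros)
  have "((\<lambda>u. (u * (1 - u) / 2) *\<^sub>R (c * (real m + 1 + u) powr (- s - 2))) has_integral
     ((1/2) *\<^sub>R ((s - 1) * (real m + 1) powr (- s) + (s - 1) * (real m + 1 + 1) powr (- s))
      - ((- 1) * (real m + 1 + 1) powr (1 - s) - (- 1) * (real m + 1) powr (1 - s)))) {0..1}"
  proof (rule trapezoid_peano[where f' = "\<lambda>x. ((s - 1) * (- s)) * x powr (- s - 1)"])
    fix x assume "x \<in> {real m + 1..real m + 1 + 1}"
    then have x: "x > 0" by auto
    show "((\<lambda>x. (- 1) * x powr (1 - s)) has_vector_derivative (s - 1) * x powr (- s)) (at x)"
      using d[OF x, of "-1" "1 - s"] by simp
    show "((\<lambda>x. (s - 1) * x powr (- s)) has_vector_derivative ((s - 1) * (- s)) * x powr (- s - 1)) (at x)"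
      using d[OF x, of "s - 1" "- s"] by simp
    have e: "(s - 1) * (- s) * (- s - 1) = c" "- s - 1 - 1 = - s - 2" by (simp_all add: c_def algebra_simps)
    show "((\<lambda>x. ((s - 1) * (- s)) * x powr (- s - 1)) has_vector_derivative c * x powr (- s - 2)) (at x)"
      using d[OF x, of "(s - 1) * (- s)" "- s - 1"] unfolding e .
  qed
  moreover have "(1/2) *\<^sub>R ((s - 1) * (real m + 1) powr (- s) + (s - 1) * (real m + 1 + 1) powr (- s))
      - ((- 1) * (real m + 1 + 1) powr (1 - s) - (- 1) * (real m + 1) powr (1 - s)) = Re (zeta_term m (of_real s))"
  proof -
    have e: "real m + 1 + 1 = real m + 2" by simp
    have "zeta_term m (of_real s) = of_real ((s - 1) * ((real m + 1) powr (- s) + (real m + 2) powr (- s)) / 2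
       + ((real m + 2) powr (1 - s) - (real m + 1) powr (1 - s)))"
    proof -
      have p: "complex_of_real x powr (- of_real s) = of_real (x powr (- s))"
        "complex_of_real x powr (1 - of_real s) = of_real (x powr (1 - s))" if "x \<ge> 0" for x
        using powr_of_real[OF that, of "- s"] powr_of_real[OF that, of "1 - s"] by simp_all
      have "real m + 1 \<ge> 0" "real m + 2 \<ge> 0" by simp_all
      then show ?thesis unfolding zeta_term_def by (simp only: p) simp
    qed
    then have "Re (zeta_term m (of_real s)) = (s - 1) * ((real m + 1) powr (- s) + (real m + 2) powr (- s)) / 2
       + ((real m + 2) powr (1 - s) - (real m + 1) powr (1 - s))" by (simp only: Re_complex_of_real)
    then show ?thesis unfolding e by (simp add: field_simps)
  qed
  ultimately have "((\<lambda>u. (u * (1 - u) / 2) *\<^sub>R (c * (real m + 1 + u) powr (- s - 2))) has_integral Re (zeta_term m (of_real s))) {0..1}"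
    by simp
  from has_integral_divide[OF this, of c] show ?thesis
  proof (rule has_integral_eq_rhs[OF has_integral_eq[rotated]])
    fix u :: real
    have "real m + 1 + u = real n + u" using Suc by simp
    then show "(u * (1 - u) / 2) *\<^sub>R (c * (real m + 1 + u) powr (- s - 2)) / c = (u * (1 - u) / 2) * (real n + u) powr (- s - 2)"
      using c by simp
  qed (simp add: Suc powr_trap_def c_def)
qed

text \<open>By Tonelli the Mellin transform passes under the Peano integral, where x^(s - 1) x^2 exp
  (- (n + u) x) integrates to Gamma (s + 2) (n + u)^(- s - 2): exponential errors become power
  errors with the same kernel.\<close>

lemma nn_integral_exp_trap:
  fixes s :: real
  assumes s: "-1 < s" "s < 0"
  shows "(\<integral>\<^sup>+x. ennreal (x powr (s - 1) * exp_trap n x) * indicator {0<..} x \<partial>lborel) = ennreal (Gamma (s + 2) * powr_trap s n)"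
proof -
  define k where "k = (\<lambda>x u::real. ennreal (x powr (s - 1) * ((u * (1 - u) / 2) * (x\<^sup>2 * exp (- (real n + u) * x)))) * indicator {0..1} u * indicator {0<..} x)"
  have [measurable]: "(\<lambda>(x, u). k x u) \<in> borel_measurable (lborel \<Otimes>\<^sub>M lborel)" unfolding k_def by measurable
  have "(\<integral>\<^sup>+x. ennreal (x powr (s - 1) * exp_trap n x) * indicator {0<..} x \<partial>lborel) = (\<integral>\<^sup>+x. (\<integral>\<^sup>+u. k x u \<partial>lborel) \<partial>lborel)"
  proof (rule nn_integral_cong)
    fix x :: real
    show "ennreal (x powr (s - 1) * exp_trap n x) * indicator {0<..} x = (\<integral>\<^sup>+u. k x u \<partial>lborel)"
    proof (cases "x > 0")
      case True
      have "(\<integral>\<^sup>+u. k x u \<partial>lborel) = (\<integral>\<^sup>+u. ennreal (x powr (s - 1) * ((u * (1 - u) / 2) * (x\<^sup>2 * exp (- (real n + u) * x)))) * indicator {0..1} u \<partial>lborel)"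
        using True by (simp add: k_def)
      also have "\<dots> = ennreal (x powr (s - 1) * exp_trap n x)"
        by (rule nn_integral_has_integral_lebesgue'[OF _ has_integral_mult_right[OF exp_trap_peano[OF True]]]) auto
      finally show ?thesis using True by simp
    qed (simp add: k_def)
  qed
  also have "\<dots> = (\<integral>\<^sup>+u. (\<integral>\<^sup>+x. k x u \<partial>lborel) \<partial>lborel)"
    by (rule lborel_pair.Fubini'[symmetric]) simp
  also have "\<dots> = (\<integral>\<^sup>+u. ennreal (Gamma (s + 2) * ((u * (1 - u) / 2) * (real n + u) powr (- s - 2))) * indicator {0..1} u \<partial>lborel)"
  proof (rule nn_integral_cong)
    fix u :: real
    show "(\<integral>\<^sup>+x. k x u \<partial>lborel) = ennreal (Gamma (s + 2) * ((u * (1 - u) / 2) * (real n + u) powr (- s - 2))) * indicator {0..1} u"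
    \<comment> \<open>At the ends the kernel vanishes; taking them out avoids n + u = 0, where the
      Gamma integral diverges.\<close>
    proof (cases "u \<in> {0<..<1}")
      case False
      then have "u = 0 \<or> u = 1 \<or> u \<notin> {0..1}" by auto
      then show ?thesis by (auto simp: k_def)
    next
      case True
      then have u: "0 < real n + u" "0 < u" "u < 1" by auto
      have "(\<integral>\<^sup>+x. k x u \<partial>lborel) = (\<integral>\<^sup>+x. ennreal (u * (1 - u) / 2) * (ennreal (x powr (s + 2 - 1) * exp (- (real n + u) * x)) * indicator {0<..} x) \<partial>lborel)"
      proof (rule nn_integral_cong)
        fix x :: real
        have "x powr (s - 1) * ((u * (1 - u) / 2) * (x\<^sup>2 * exp (- (real n + u) * x))) = (u * (1 - u) / 2) * (x powr (s + 2 - 1) * exp (- (real n + u) * x))" if "x > 0"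
        proof -
          have "s + 2 - 1 = (s - 1) + 2" by simp
          then have "x powr (s + 2 - 1) = x powr (s - 1) * x\<^sup>2" using that by (simp only: powr_add powr_numeral)
          then show ?thesis by (simp only: mult_ac)
        qed
        then show "k x u = ennreal (u * (1 - u) / 2) * (ennreal (x powr (s + 2 - 1) * exp (- (real n + u) * x)) * indicator {0<..} x)"
          using u by (cases "x > 0") (auto simp: k_def ennreal_mult[symmetric])
      qed
      also have "\<dots> = ennreal (u * (1 - u) / 2) * ennreal (Gamma (s + 2) * (real n + u) powr (- (s + 2)))"
        using nn_integral_Gamma_scaled[of "s + 2" "real n + u"] s u by (subst nn_integral_cmult) auto
      also have "\<dots> = ennreal (Gamma (s + 2) * ((u * (1 - u) / 2) * (real n + u) powr (- s - 2)))"
      proof -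
        have "- (s + 2) = - s - 2" by simp
        then show ?thesis using u s by (simp add: ennreal_mult[symmetric] mult_ac Gamma_real_nonneg)
      qed
      finally show ?thesis using u by simp
    qed
  qed
  also have "\<dots> = ennreal (Gamma (s + 2) * powr_trap s n)"
    by (rule nn_integral_has_integral_lebesgue'[OF _ has_integral_mult_right[OF powr_trap_peano[OF s]]])
       (use s in \<open>auto intro!: mult_nonneg_nonneg Gamma_real_nonneg\<close>)
  finally show ?thesis .
qed

lemma powr_trap_nonneg:
  assumes "-1 < s" "s < 0" shows "powr_trap s n \<ge> 0"
  by (rule has_integral_nonneg[OF powr_trap_peano[OF assms]]) auto

lemma summable_powr_trap:
  assumes "-1 < s" "s < 0" shows "summable (powr_trap s)"
proof -
  have "summable (\<lambda>m. Re (zeta_term m (of_real s)))"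
    using summable_zeta_term[of "of_real s"] assms by (simp add: summable_Re)
  then have "summable (\<lambda>m. powr_trap s (Suc m))" by (simp add: powr_trap_def summable_divide)
  then show ?thesis by (simp add: summable_Suc_iff)
qed

text \<open>For s < 0 the explicit part 1 + (s - 1)/2 = (s + 1)/2 of \<open>zeta_reg\<close> is
  exactly the scaled trapezoid error on [0, 1], so that the sum may start at 0.\<close>

lemma Re_zeta_reg_powr_trap:
  assumes s: "-1 < s" "s < 0"
  shows "Re (zeta_reg (of_real s)) = (s - 1) * s * (s + 1) * (\<Sum>n. powr_trap s n)"
proof -
  define c where "c = (s - 1) * s * (s + 1)"
  have c: "c \<noteq> 0" using s by (simp add: c_def)
  have sm: "summable (\<lambda>m. zeta_term m (of_real s))" using summable_zeta_term[of "of_real s"] s by simp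
  have "(\<Sum>n. powr_trap s n) = powr_trap s 0 + (\<Sum>m. powr_trap s (Suc m))"
    using suminf_split_head[OF summable_powr_trap[OF s]] by simp
  also have "(\<Sum>m. powr_trap s (Suc m)) = (\<Sum>m. Re (zeta_term m (of_real s))) / c"
    using suminf_divide[OF summable_Re[OF sm]] by (simp add: powr_trap_def c_def)
  also have "(\<Sum>m. Re (zeta_term m (of_real s))) = Re (\<Sum>m. zeta_term m (of_real s))" using Re_suminf[OF sm] by simp
  finally have "c * (\<Sum>n. powr_trap s n) = c * powr_trap s 0 + Re (\<Sum>m. zeta_term m (of_real s))"
    using c by (simp add: algebra_simps)
  moreover have "c * powr_trap s 0 = (s + 1) / 2"
    using s by (simp add: c_def powr_trap_def field_simps)
  ultimately show ?thesis unfolding c_def by (simp add: zeta_reg_def field_simps)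
qed

text \<open>The Mellin transform at s of one kernel K, computed twice: A expands K into trapezoid
  errors, B into partial fractions. The series on the right is zeta(1 - s).\<close>

lemma zeta_functional_equation_real:
  fixes s :: real
  assumes s: "-1 < s" "s < 0"
  shows "Gamma (s + 2) * (\<Sum>n. powr_trap s n) =
     (2 * pi) powr (s - 1) * (Gamma ((s + 1) / 2) * Gamma ((1 - s) / 2)) * (\<Sum>n. (real n + 1) powr (s - 1))"
proof -
  define C where "C = Gamma ((s + 1) / 2) * Gamma ((1 - s) / 2)"
  have C: "C \<ge> 0" using s by (auto simp: C_def intro!: mult_nonneg_nonneg Gamma_real_nonneg)
  define K where "K = (\<lambda>x::real. 1 / (exp x - 1) - 1 / x + 1 / 2)"
  have GP: "Gamma (s + 2) * powr_trap s n \<ge> 0" for n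
    using s powr_trap_nonneg[OF s] by (auto intro!: mult_nonneg_nonneg Gamma_real_nonneg)
  have A: "(\<integral>\<^sup>+x. ennreal (x powr (s - 1) * K x) * indicator {0<..} x \<partial>lborel) = ennreal (Gamma (s + 2) * (\<Sum>n. powr_trap s n))"
  proof -
    have "(\<integral>\<^sup>+x. ennreal (x powr (s - 1) * K x) * indicator {0<..} x \<partial>lborel)
       = (\<integral>\<^sup>+x. (\<Sum>n. ennreal (x powr (s - 1) * exp_trap n x) * indicator {0<..} x) \<partial>lborel)"
    proof (rule nn_integral_cong)
      fix x :: real
      show "ennreal (x powr (s - 1) * K x) * indicator {0<..} x = (\<Sum>n. ennreal (x powr (s - 1) * exp_trap n x) * indicator {0<..} x)"
      proof (cases "x > 0")
        case True
        have "(\<lambda>n. x powr (s - 1) * exp_trap n x) sums (x powr (s - 1) * K x)"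
          unfolding K_def by (intro sums_mult exp_trap_sums True)
        then have "(\<Sum>n. ennreal (x powr (s - 1) * exp_trap n x)) = ennreal (x powr (s - 1) * K x)"
          using exp_trap_nonneg[OF True] by (intro suminf_ennreal_eq) auto
        then show ?thesis using True by simp
      qed simp
    qed
    also have "\<dots> = (\<Sum>n. \<integral>\<^sup>+x. ennreal (x powr (s - 1) * exp_trap n x) * indicator {0<..} x \<partial>lborel)"
      by (rule nn_integral_suminf) (auto simp: exp_trap_def)
    also have "\<dots> = (\<Sum>n. ennreal (Gamma (s + 2) * powr_trap s n))" by (simp only: nn_integral_exp_trap[OF s])
    also have "\<dots> = ennreal (Gamma (s + 2) * (\<Sum>n. powr_trap s n))"
      by (rule suminf_ennreal_eq[OF GP]) (intro sums_mult summable_sums summable_powr_trap s)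
    finally show ?thesis .
  qed
  have B: "(\<integral>\<^sup>+x. ennreal (x powr (s - 1) * K x) * indicator {0<..} x \<partial>lborel) = ennreal ((2 * pi) powr (s - 1) * C * (\<Sum>n. (real n + 1) powr (s - 1)))"
  proof -
    have "(\<integral>\<^sup>+x. ennreal (x powr (s - 1) * K x) * indicator {0<..} x \<partial>lborel)
       = (\<integral>\<^sup>+x. (\<Sum>n. ennreal (x powr (s - 1) * (2 * x / (x\<^sup>2 + (2 * pi * (real n + 1))\<^sup>2))) * indicator {0<..} x) \<partial>lborel)"
    proof (rule nn_integral_cong)
      fix x :: real
      show "ennreal (x powr (s - 1) * K x) * indicator {0<..} x
        = (\<Sum>n. ennreal (x powr (s - 1) * (2 * x / (x\<^sup>2 + (2 * pi * (real n + 1))\<^sup>2))) * indicator {0<..} x)"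
      proof (cases "x > 0")
        case True
        have "(\<lambda>n. x powr (s - 1) * (2 * x / (x\<^sup>2 + (2 * pi * (real n + 1))\<^sup>2))) sums (x powr (s - 1) * K x)"
          unfolding K_def by (intro sums_mult coth_partial_fractions True)
        then have "(\<Sum>n. ennreal (x powr (s - 1) * (2 * x / (x\<^sup>2 + (2 * pi * (real n + 1))\<^sup>2)))) = ennreal (x powr (s - 1) * K x)"
          using True by (intro suminf_ennreal_eq) auto
        then show ?thesis using True by simp
      qed simp
    qed
    also have "\<dots> = (\<Sum>n. \<integral>\<^sup>+x. ennreal (x powr (s - 1) * (2 * x / (x\<^sup>2 + (2 * pi * (real n + 1))\<^sup>2))) * indicator {0<..} x \<partial>lborel)"
      by (rule nn_integral_suminf) auto
    also have "\<dots> = (\<Sum>n. ennreal ((2 * pi) powr (s - 1) * C * (real n + 1) powr (s - 1)))"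
    proof (rule suminf_cong)
      fix n
      have "(\<integral>\<^sup>+x. ennreal (x powr (s - 1) * (2 * x / (x\<^sup>2 + (2 * pi * (real n + 1))\<^sup>2))) * indicator {0<..} x \<partial>lborel)
         = ennreal ((2 * pi * (real n + 1)) powr (s - 1) * C)"
        unfolding C_def by (rule nn_integral_powr_over_quadratic) (use s in auto)
      also have "(2 * pi * (real n + 1)) powr (s - 1) = (2 * pi) powr (s - 1) * (real n + 1) powr (s - 1)"
        by (rule powr_mult)
      finally show "(\<integral>\<^sup>+x. ennreal (x powr (s - 1) * (2 * x / (x\<^sup>2 + (2 * pi * (real n + 1))\<^sup>2))) * indicator {0<..} x \<partial>lborel)
         = ennreal ((2 * pi) powr (s - 1) * C * (real n + 1) powr (s - 1))" by (simp only: mult_ac)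
    qed
    also have "\<dots> = ennreal ((2 * pi) powr (s - 1) * C * (\<Sum>n. (real n + 1) powr (s - 1)))"
      by (rule suminf_ennreal_eq) (use C s in \<open>auto intro!: sums_mult summable_sums summable_Suc_powr\<close>)
    finally show ?thesis .
  qed
  have "Gamma (s + 2) * (\<Sum>n. powr_trap s n) \<ge> 0"
    using s powr_trap_nonneg[OF s] summable_powr_trap[OF s] by (intro mult_nonneg_nonneg Gamma_real_nonneg suminf_nonneg) auto
  moreover have "(2 * pi) powr (s - 1) * C * (\<Sum>n. (real n + 1) powr (s - 1)) \<ge> 0"
    using C s by (intro mult_nonneg_nonneg suminf_nonneg summable_Suc_powr) auto
  ultimately show ?thesis using A B unfolding C_def by (simp add: ennreal_inj)
qed

text \<open>The sieve of Eratosthenes, applied to a supposed zero. Removing the multiples of a prime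
  p multiplies the sum by 1 - p^(-s), so the sum over the numbers without divisors in {2..m} stays
  0. But these are 1 and numbers above m, and for large m the tail is too small to cancel the term
  1.\<close>

lemma zeta_reg_nonzero:
  assumes s: "Re s > 1"
  shows "zeta_reg s \<noteq> 0"
proof
  assume z0: "zeta_reg s = 0"
  define f where "f = (\<lambda>n::nat. of_nat n powr (- s))"
  define A where "A = (\<lambda>m. {n::nat. \<forall>d\<in>{2..m}. \<not> d dvd n})"
  have nf: "norm (f n) = real n powr (- Re s)" for n
    using norm_powr_real_powr[of "of_nat n" "- s"] by (simp add: f_def)
  have sn: "summable (\<lambda>n. norm (f n))" unfolding nf using s by (simp add: summable_real_powr_iff)
  have su: "f summable_on B" for B
    using norm_summable_imp_summable_on[OF sn] by (rule summable_on_subset_banach) simp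
  have sun: "(\<lambda>n. norm (f n)) summable_on B" for B
  proof -
    have "(\<lambda>n. norm (f n)) summable_on UNIV" using sn by (intro norm_summable_imp_summable_on) simp
    then show ?thesis by (rule summable_on_subset_banach) simp
  qed
  have f_mult: "f (p * n) = f p * f n" for p n
    using powr_times_real[of "of_nat p" "of_nat n" "- s"] by (simp add: f_def)
  have S: "infsum f (A m) = 0" for m
  proof (induction m)
    \<comment> \<open>No divisor is excluded at m = 0, so all naturals take part; the number 0 adds
      nothing because \<open>0 powr (- s)\<close> is 0.\<close>
    case 0
    have "f sums infsum f UNIV" using has_sum_infsum[OF su] by (rule has_sum_imp_sums)
    then have "(\<lambda>n. f (Suc n)) sums infsum f UNIV"
      by (subst sums_Suc_iff) (simp add: f_def)
    moreover have "(\<lambda>n. f (Suc n)) sums (zeta_reg s / (s - 1))"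
      unfolding f_def by (rule zeta_series_sums[OF s])
    ultimately have "infsum f UNIV = zeta_reg s / (s - 1)" by (rule sums_unique2)
    then show ?case using z0 by (simp add: A_def)
  next
    case (Suc m)
    show ?case
    proof (cases "prime (Suc m)")
      case True
      define p where "p = Suc m"
      have p: "prime p" using True by (simp add: p_def)
      have p2: "p \<ge> 2" using p by (rule prime_ge_2_nat)
      have ASuc: "A p = {n \<in> A m. \<not> p dvd n}"
        using p2 by (auto simp: A_def p_def atLeastAtMostSuc_conv)
      have cop: "d dvd p * n \<longleftrightarrow> d dvd n" if "d \<in> {2..m}" for d n
      proof -
        have "coprime d p"
          using p that by (metis One_nat_def atLeastAtMost_iff coprime_commute dvd_imp_le le_imp_less_Suc less_le_trans linorder_not_less not_numeral_le_zero not_gr_zero p_def prime_imp_coprime)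
        then show ?thesis by (simp add: coprime_dvd_mult_right_iff)
      qed
      \<comment> \<open>The divisors d <= m = p - 1 are coprime to p, so multiplication by p
        preserves membership in \<open>A m\<close>.\<close>
      have img: "{n \<in> A m. p dvd n} = (\<lambda>n. p * n) ` A m"
      proof -
        have "p * n \<in> A m \<longleftrightarrow> n \<in> A m" for n using cop by (simp add: A_def)
        then show ?thesis by (auto elim!: dvdE)
      qed
      have "infsum f (A m) = infsum f ({n \<in> A m. \<not> p dvd n} \<union> {n \<in> A m. p dvd n})"
        by (rule arg_cong[where f = "infsum f"]) auto
      also have "\<dots> = infsum f (A p) + infsum f ((\<lambda>n. p * n) ` A m)"
        unfolding ASuc img[symmetric] by (rule infsum_Un_disjoint[OF su su]) auto
      also have "infsum f ((\<lambda>n. p * n) ` A m) = infsum (f \<circ> (\<lambda>n. p * n)) (A m)"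
        using p2 by (intro infsum_reindex inj_onI) simp
      also have "\<dots> = f p * infsum f (A m)"
        unfolding o_def f_mult by (rule infsum_cmult_right')
      finally show ?thesis using Suc by (simp add: p_def)
    next
      case False
      \<comment> \<open>A composite number has a smaller divisor which was sieved before.\<close>
      have "A (Suc m) = A m"
      proof (cases "Suc m \<ge> 2")
        case True
        obtain d where d: "d dvd Suc m" "d \<noteq> 1" "d \<noteq> Suc m"
          using False True by (auto simp: prime_nat_iff)
        then have "d \<noteq> 0" by auto
        moreover have "d \<le> Suc m" using d(1) by (intro dvd_imp_le) auto
        ultimately have dm: "d \<in> {2..m}" using d by auto
        have "\<not> Suc m dvd n" if "n \<in> A m" for n
        proof
          assume "Suc m dvd n"
          then have "d dvd n" by (rule dvd_trans[OF d(1)])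
          then show False using that dm by (auto simp: A_def)
        qed
        moreover have "A (Suc m) = {n \<in> A m. \<not> Suc m dvd n}"
          using True by (auto simp: A_def atLeastAtMostSuc_conv)
        ultimately show ?thesis by auto
      qed (auto simp: A_def)
      then show ?thesis using Suc by simp
    qed
  qed
  define T where "T = infsum (\<lambda>n. norm (f n)) UNIV"
  have "(\<lambda>n. norm (f n)) sums T"
    unfolding T_def using has_sum_infsum[OF sun] by (rule has_sum_imp_sums)
  then have "(\<lambda>m. \<Sum>n<m. norm (f n)) \<longlonglongrightarrow> T" by (simp add: sums_def)
  then have "eventually (\<lambda>m. dist (\<Sum>n<m. norm (f n)) T < 1) sequentially" by (rule tendstoD) simp
  then obtain m0 where m0: "\<And>m. m \<ge> m0 \<Longrightarrow> dist (\<Sum>n<m. norm (f n)) T < 1"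
    unfolding eventually_sequentially by blast
  define m where "m = max 2 m0"
  have m: "m \<ge> 2" "dist (\<Sum>n<m. norm (f n)) T < 1" using m0[of m] by (auto simp: m_def)
  \<comment> \<open>A number n in {2..m} divides itself and is therefore removed; 0 is removed by
    the divisor 2.\<close>
  have sub: "A m - {1} \<subseteq> {m..}"
  proof
    fix n assume n: "n \<in> A m - {1}"
    have "\<not> 2 dvd n" using n m(1) by (auto simp: A_def)
    then have "n \<noteq> 0" by (rule contrapos_nn) simp
    show "n \<in> {m..}"
    proof (rule ccontr)
      assume "n \<notin> {m..}"
      then have nm: "n \<in> {2..m}" using n \<open>n \<noteq> 0\<close> by auto
      have "\<forall>d\<in>{2..m}. \<not> d dvd n" using n by (simp add: A_def)
      then have "\<not> n dvd n" using nm by (rule bspec)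
      then show False by simp
    qed
  qed
  have "1 \<in> A m" by (auto simp: A_def)
  then have "infsum f (A m) = infsum f ({1} \<union> (A m - {1}))" by (simp add: insert_absorb)
  also have "\<dots> = infsum f {1} + infsum f (A m - {1})" by (rule infsum_Un_disjoint[OF su su]) auto
  finally have "infsum f (A m - {1}) = - 1" using S[of m] by (simp add: f_def eq_neg_iff_add_eq_0 add.commute)
  then have "1 = norm (infsum f (A m - {1}))" by simp
  also have "\<dots> \<le> infsum (\<lambda>n. norm (f n)) (A m - {1})" by (rule norm_infsum_bound[OF sun])
  also have "\<dots> \<le> infsum (\<lambda>n. norm (f n)) {m..}" by (rule infsum_mono2[OF sun sun sub]) simp
  also have "\<dots> = T - (\<Sum>n<m. norm (f n))"
  proof -
    have "T = infsum (\<lambda>n. norm (f n)) ({..<m} \<union> {m..})" unfolding T_def by (rule arg_cong2[where f = infsum]) auto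
    also have "\<dots> = infsum (\<lambda>n. norm (f n)) {..<m} + infsum (\<lambda>n. norm (f n)) {m..}"
      by (rule infsum_Un_disjoint[OF sun sun]) auto
    finally show ?thesis by simp
  qed
  also have "\<dots> < 1" using m(2) by (simp add: dist_real_def abs_if split: if_splits)
  finally show False by simp
qed

section \<open>The entire function xi\<close>

text \<open>Riemann's xi: s - 1 is contained in \<open>zeta_reg\<close>, and s/2 has been absorbed
  into Gamma (s/2 + 1). The formula is used where \<open>zeta_reg\<close> is known to be
  holomorphic, on Re s > -1.\<close>

definition xi_half :: "complex \<Rightarrow> complex" where
  "xi_half s = zeta_reg s * of_real pi powr (- s / 2) * Gamma (s / 2 + 1)"

lemma xi_half_holomorphic: "xi_half holomorphic_on {s. Re s > -1}"
proof -
  have "s / 2 + 1 \<notin> \<int>\<^sub>\<le>\<^sub>0" if "Re s > -1" for s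
    using that by (auto elim!: nonpos_Ints_cases simp: complex_eq_iff)
  then show ?thesis unfolding xi_half_def
    by (intro holomorphic_intros holomorphic_on_compose_gen[OF _ zeta_reg_holomorphic, unfolded o_def] zeta_reg_holomorphic)
       (auto simp: complex_nonpos_Reals_iff)
qed

lemma zeta_reg_of_real:
  assumes "x > -1"
  shows "zeta_reg (of_real x) = of_real (Re (zeta_reg (of_real x)))"
proof -
  have p: "complex_of_real y powr (- of_real x) = of_real (y powr (- x))"
    "complex_of_real y powr (1 - of_real x) = of_real (y powr (1 - x))" if "y \<ge> 0" for y
    using powr_of_real[OF that, of "- x"] powr_of_real[OF that, of "1 - x"] by simp_all
  have im: "Im (zeta_term n (of_real x)) = 0" for n
  proof -
    have "real n + 1 \<ge> 0" "real n + 2 \<ge> 0" by simp_all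
    then show ?thesis unfolding zeta_term_def by (simp only: p) simp
  qed
  have sm: "summable (\<lambda>n. zeta_term n (of_real x))" using summable_zeta_term[of "of_real x"] assms by simp
  have "Im (\<Sum>n. zeta_term n (of_real x)) = (\<Sum>n. Im (zeta_term n (of_real x)))"
    by (rule bounded_linear.suminf[OF bounded_linear_Im sm])
  then have "Im (zeta_reg (of_real x)) = 0" by (simp add: im zeta_reg_def)
  then show ?thesis by (simp add: complex_eq_iff)
qed

text \<open>The functional equation of the previous section in symmetric form. With a = (s + 1)/2
  and c = s/2 + 1 = a + 1/2, Legendre's duplication formula evaluates Gamma a * Gamma c by Gamma (s
  + 1).\<close>

lemma xi_half_symmetric_real:
  fixes s :: real
  assumes s: "-1 < s" "s < 0"
  shows "xi_half (of_real s) = xi_half (1 - of_real s)"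
proof -
  define P where "P = (\<Sum>n. powr_trap s n)"
  define S where "S = (\<Sum>n. (real n + 1) powr (s - 1))"
  define a b c where "a = (s + 1) / 2" and "b = (1 - s) / 2" and "c = s / 2 + 1"
  have pos: "a > 0" "b > 0" "c > 0" "s + 1 > 0" using s by (auto simp: a_def b_def c_def)
  have z1: "zeta_reg (of_real s) = of_real ((s - 1) * s * (s + 1) * P)"
    using zeta_reg_of_real[of s] Re_zeta_reg_powr_trap[OF s] s by (simp add: P_def)
  have z2: "zeta_reg (1 - of_real s) = of_real (- s * S)"
  proof -
    have "(\<lambda>n. of_nat (Suc n) powr (- (1 - of_real s))) sums (zeta_reg (1 - of_real s) / (1 - of_real s - 1))"
      using s by (intro zeta_series_sums) simp
    moreover have "of_nat (Suc n) powr (- (1 - of_real s)) = complex_of_real ((real n + 1) powr (s - 1))" for n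
      using powr_of_real[of "real n + 1" "s - 1"] by (simp add: add.commute)
    ultimately have "(\<lambda>n. complex_of_real ((real n + 1) powr (s - 1))) sums (zeta_reg (1 - of_real s) / (1 - of_real s - 1))"
      by simp
    moreover have "(\<lambda>n. complex_of_real ((real n + 1) powr (s - 1))) sums of_real S"
      unfolding S_def sums_of_real_iff using s by (intro summable_sums summable_Suc_powr) simp
    ultimately have "zeta_reg (1 - of_real s) / (1 - of_real s - 1) = of_real S" by (rule sums_unique2)
    then have "zeta_reg (1 - of_real s) = of_real S * (1 - of_real s - 1)"
      using s by (subst (asm) nonzero_divide_eq_eq) auto
    then show ?thesis by simp
  qed
  have fe: "Gamma (s + 2) * P = (2 * pi) powr (s - 1) * (Gamma a * Gamma b) * S"
    unfolding P_def S_def a_def b_def by (rule zeta_functional_equation_real[OF s])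
  have nint: "complex_of_real x \<notin> \<int>\<^sub>\<le>\<^sub>0" if "x > 0" for x
    using that by (auto elim!: nonpos_Ints_cases simp: complex_eq_iff)
  have dup: "Gamma a * Gamma c = 2 powr (- s) * sqrt pi * Gamma (s + 1)"
  proof -
    have ac: "complex_of_real a + 1/2 = of_real c" "2 * complex_of_real a = of_real (s + 1)" "1 - 2 * complex_of_real a = of_real (- s)"
      by (auto simp: a_def c_def complex_eq_iff field_simps)
    have e: "1 - complex_of_real (s + 1) = of_real (- s)" by simp
    have "Gamma (complex_of_real a) * Gamma (complex_of_real a + 1/2) =
             exp ((1 - 2 * complex_of_real a) * of_real (ln 2)) * of_real (sqrt pi) * Gamma (2 * complex_of_real a)"
      using nint[OF pos(1)] nint[OF pos(3)] by (intro Gamma_legendre_duplication) (auto simp: ac)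
    then have "complex_of_real (Gamma a * Gamma c) = of_real (exp (- s * ln 2) * sqrt pi * Gamma (s + 1))"
      unfolding ac Gamma_complex_of_real e of_real_mult[symmetric] exp_of_real .
    then show ?thesis by (simp only: of_real_eq_iff powr_def) simp
  qed
  have nintr: "x \<notin> \<int>\<^sub>\<le>\<^sub>0" if "x > 0" for x :: real
    using that by (auto elim!: nonpos_Ints_cases)
  have "s + 2 = (s + 1) + 1" by simp
  then have G2: "Gamma (s + 2) = (s + 1) * Gamma (s + 1)"
    using Gamma_plus1[OF nintr[OF pos(4)]] by (simp only:)
  have Gb: "Gamma (b + 1) = b * Gamma b"
    by (rule Gamma_plus1[OF nintr[OF pos(2)]])
  have Gs: "Gamma (s + 1) > 0" using pos by (intro Gamma_real_pos) auto
  have key: "(s - 1) * s * (s + 1) * P * pi powr (- s / 2) * Gamma c = - s * S * pi powr (- (1 - s) / 2) * Gamma (b + 1)"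
  proof -
    have pw: "(2 * pi) powr (s - 1) * pi powr (- s / 2) * 2 powr (- s) * sqrt pi = pi powr (- (1 - s) / 2) / 2"
    proof -
      have "(2 * pi) powr (s - 1) = 2 powr (s - 1) * pi powr (s - 1)" by (rule powr_mult)
      moreover have "sqrt pi = pi powr (1/2)" by (simp add: powr_half_sqrt)
      ultimately have "(2 * pi) powr (s - 1) * pi powr (- s / 2) * 2 powr (- s) * sqrt pi
         = (2 powr (s - 1) * 2 powr (- s)) * ((pi powr (s - 1) * pi powr (- s / 2)) * pi powr (1/2))" by (simp only: mult_ac)
      also have "\<dots> = 2 powr (s - 1 + - s) * pi powr (s - 1 + - s / 2 + 1/2)" by (simp only: powr_add)
      also have "s - 1 + - s = -1" by simp
      also have "s - 1 + - s / 2 + 1/2 = - (1 - s) / 2" by (simp add: field_simps)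
      finally show ?thesis by (simp add: powr_minus)
    qed
    \<comment> \<open>The positive factor Gamma (s + 1) is inserted to form Gamma (s + 2), to which
      the functional equation applies; duplication returns it on the other side, where it is
      cancelled.\<close>
    have "Gamma (s + 1) * ((s - 1) * s * (s + 1) * P * pi powr (- s / 2) * Gamma c)
       = (s - 1) * s * (Gamma (s + 2) * P) * pi powr (- s / 2) * Gamma c" unfolding G2 by (simp only: mult_ac)
    also have "\<dots> = (s - 1) * s * (2 * pi) powr (s - 1) * Gamma b * S * pi powr (- s / 2) * (Gamma a * Gamma c)"
      unfolding fe by (simp only: mult_ac)
    also have "\<dots> = Gamma (s + 1) * ((s - 1) * s * Gamma b * S * ((2 * pi) powr (s - 1) * pi powr (- s / 2) * 2 powr (- s) * sqrt pi))"
      unfolding dup by (simp only: mult_ac)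
    also have "\<dots> = Gamma (s + 1) * (- s * S * pi powr (- (1 - s) / 2) * Gamma (b + 1))"
      unfolding pw Gb by (simp add: b_def field_simps)
    finally have eq: "Gamma (s + 1) * ((s - 1) * s * (s + 1) * P * pi powr (- s / 2) * Gamma c) =
       Gamma (s + 1) * (- s * S * pi powr (- (1 - s) / 2) * Gamma (b + 1))" .
    from Gs have "Gamma (s + 1) \<noteq> 0" by simp
    from mult_left_cancel[OF this] eq show ?thesis by blast
  qed
  have "xi_half (of_real s) = of_real ((s - 1) * s * (s + 1) * P * pi powr (- s / 2) * Gamma c)"
  proof -
    have "complex_of_real pi powr (- of_real s / 2) = of_real (pi powr (- s / 2))"
      using powr_of_real[of pi "- s / 2"] by simp
    moreover have "Gamma (complex_of_real s / 2 + 1) = of_real (Gamma c)"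
      using Gamma_complex_of_real[of c] by (simp add: c_def)
    ultimately show ?thesis by (simp only: xi_half_def z1 of_real_mult)
  qed
  also have "\<dots> = xi_half (1 - of_real s)"
  proof -
    have "complex_of_real pi powr (- (1 - of_real s) / 2) = of_real (pi powr (- (1 - s) / 2))"
      using powr_of_real[of pi "- (1 - s) / 2"] by simp
    moreover have "Gamma ((1 - complex_of_real s) / 2 + 1) = of_real (Gamma (b + 1))"
      using Gamma_complex_of_real[of "b + 1"] by (simp add: b_def)
    ultimately show ?thesis by (simp only: xi_half_def z2 of_real_mult key)
  qed
  finally show ?thesis .
qed

text \<open>Continuation from the real segment (-1, 0) to the strip in which both s and 1 - s have
  real part above -1.\<close>

lemma xi_half_symmetric:
  assumes "-1 < Re s" "Re s < 2"
  shows "xi_half s = xi_half (1 - s)"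
proof -
  define A where "A = {s. Re s > -1} \<inter> {s. Re s < 2}"
  have A: "open A" "connected A"
    unfolding A_def by (auto intro!: open_Int open_halfspace_Re_gt open_halfspace_Re_lt convex_connected convex_Int convex_halfspace_Re_gt convex_halfspace_Re_lt)
  define U where "U = complex_of_real ` {-1<..<0}"
  have lim: "of_real (-1/2) islimpt U"
  proof -
    have "(-1/2 :: real) islimpt {-1<..<0}" by (rule open_imp_islimpt) auto
    then obtain f where f: "\<And>n. f n \<in> {-1<..<0} - {-1/2 :: real}" "f \<longlonglongrightarrow> -1/2"
      unfolding islimpt_sequential by blast
    then have "\<And>n. complex_of_real (f n) \<in> U - {of_real (-1/2)}" "(\<lambda>n. complex_of_real (f n)) \<longlonglongrightarrow> of_real (-1/2)"
      by (auto simp: U_def simp del: of_real_divide of_real_minus intro!: tendsto_of_real)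
    then show ?thesis unfolding islimpt_sequential by (intro exI[of _ "\<lambda>n. complex_of_real (f n)"]) blast
  qed
  have h1: "xi_half holomorphic_on A" by (rule holomorphic_on_subset[OF xi_half_holomorphic]) (auto simp: A_def)
  have "(xi_half \<circ> (\<lambda>s. 1 - s)) holomorphic_on A"
    by (rule holomorphic_on_compose_gen[OF _ h1]) (auto intro!: holomorphic_intros simp: A_def)
  then have h2: "(\<lambda>s. xi_half s - xi_half (1 - s)) holomorphic_on A"
    using h1 by (intro holomorphic_intros) (auto simp: o_def)
  have "xi_half s - xi_half (1 - s) = 0"
  proof (rule analytic_continuation[OF h2 A _ _ lim])
    show "U \<subseteq> A" "of_real (-1/2) \<in> A" "s \<in> A" using assms by (auto simp: U_def A_def)
    show "xi_half z - xi_half (1 - z) = 0" if "z \<in> U" for z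
      using that xi_half_symmetric_real by (auto simp: U_def)
  qed
  then show ?thesis by simp
qed

definition xi :: "complex \<Rightarrow> complex" where
  "xi s = (if Re s > -1 then xi_half s else xi_half (1 - s))"

lemma xi_eq_xi_half: "Re s > -1 \<Longrightarrow> xi s = xi_half s"
  by (simp add: xi_def)

text \<open>By symmetry the second branch is valid on the open half-plane Re s < 2, which overlaps
  the domain of the first; the two together make xi entire.\<close>

lemma xi_eq_xi_half': "Re s < 2 \<Longrightarrow> xi s = xi_half (1 - s)"
  using xi_half_symmetric[of s] by (auto simp: xi_def)

lemma xi_reflect: "xi (1 - s) = xi s"
proof (cases "Re s > -1")
  case True
  then show ?thesis using xi_eq_xi_half'[of "1 - s"] xi_eq_xi_half[of s] by simp
next
  case False
  then show ?thesis using xi_eq_xi_half[of "1 - s"] by (simp add: xi_def)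
qed

lemma xi_holomorphic: "xi holomorphic_on UNIV"
proof -
  have "xi holomorphic_on {s. Re s > -1}"
    by (rule holomorphic_transform[OF xi_half_holomorphic]) (simp add: xi_eq_xi_half)
  moreover have "xi holomorphic_on {s. Re s < 2}"
  proof (rule holomorphic_transform)
    have "(xi_half \<circ> (\<lambda>s. 1 - s)) holomorphic_on {s. Re s < 2}"
      by (rule holomorphic_on_compose_gen[OF _ xi_half_holomorphic]) (auto intro!: holomorphic_intros)
    then show "(\<lambda>s. xi_half (1 - s)) holomorphic_on {s. Re s < 2}" by (simp add: o_def)
  qed (simp add: xi_eq_xi_half')
  ultimately have "xi holomorphic_on {s. Re s > -1} \<union> {s. Re s < 2}"
    by (intro holomorphic_on_Un open_halfspace_Re_gt open_halfspace_Re_lt)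
  moreover have "{s. Re s > -1} \<union> {s. Re s < 2} = (UNIV :: complex set)" by auto
  ultimately show ?thesis by simp
qed

text \<open>The quotient zeta / xi. Written with the entire \<open>rGamma\<close>, it is holomorphic
  away from 1, and its zeros are the trivial zeros of zeta.\<close>

definition zeta_cofactor :: "complex \<Rightarrow> complex" where
  "zeta_cofactor s = of_real pi powr (s / 2) * rGamma (s / 2 + 1) / (s - 1)"

lemma xi_half_times_cofactor:
  assumes "Re s > -1" "s \<noteq> 1"
  shows "xi s * zeta_cofactor s = zeta_reg s / (s - 1)"
proof -
  have "s / 2 + 1 \<notin> \<int>\<^sub>\<le>\<^sub>0"
    using assms by (auto elim!: nonpos_Ints_cases simp: complex_eq_iff)
  then have "Gamma (s / 2 + 1) * rGamma (s / 2 + 1) = 1"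
    using Gamma_nonzero[of "s / 2 + 1"] by (simp add: rGamma_inverse_Gamma)
  moreover have "complex_of_real pi powr (- s / 2) * of_real pi powr (s / 2) = 1"
    by (simp add: powr_minus)
  moreover have "xi s * zeta_cofactor s = zeta_reg s * (of_real pi powr (- s / 2) * of_real pi powr (s / 2)) * (Gamma (s / 2 + 1) * rGamma (s / 2 + 1)) / (s - 1)"
    using assms by (simp add: xi_eq_xi_half xi_half_def zeta_cofactor_def)
  ultimately show ?thesis by simp
qed

text \<open>The candidate meets the three conditions in the definition of zeta, and the identity
  theorem on the connected set - {1} gives uniqueness, so the description operator can be
  evaluated.\<close>

lemma zeta_eq: "zeta s = (if s = 1 then 0 else xi s * zeta_cofactor s)"
proof -
  define P where "P = (\<lambda>f. f holomorphic_on - {1} \<and>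
                  (\<forall>s. Re s > 1 \<longrightarrow> (\<lambda>n. of_nat (Suc n) powr (- s)) sums f s) \<and> f 1 = (0::complex))"
  define Z where "Z = (\<lambda>s. if s = 1 then 0 else xi s * zeta_cofactor s)"
  have "P Z"
    unfolding P_def
  proof (intro conjI allI impI)
    have "(\<lambda>s. xi s * zeta_cofactor s) holomorphic_on - {1}"
      unfolding zeta_cofactor_def
      by (intro holomorphic_intros holomorphic_on_subset[OF xi_holomorphic]) (auto simp: complex_nonpos_Reals_iff)
    then show "Z holomorphic_on - {1}" by (rule holomorphic_transform) (auto simp: Z_def)
    show "Z 1 = 0" by (simp add: Z_def)
    fix s :: complex assume "Re s > 1"
    moreover from this have "Z s = zeta_reg s / (s - 1)" by (auto simp: Z_def intro!: xi_half_times_cofactor)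
    ultimately show "(\<lambda>n. of_nat (Suc n) powr (- s)) sums Z s" using zeta_series_sums by simp
  qed
  moreover have "f = Z" if "P f" for f
  proof
    fix s
    have eq: "f s = Z s" if "Re s > 1" for s
      using \<open>P f\<close> \<open>P Z\<close> that unfolding P_def by (meson sums_unique2)
    show "f s = Z s"
    proof (cases "s = 1")
      case True
      then show ?thesis using \<open>P f\<close> \<open>P Z\<close> by (simp add: P_def)
    next
      case False
      have "(\<lambda>s. f s - Z s) holomorphic_on - {1}" using \<open>P f\<close> \<open>P Z\<close> unfolding P_def by (intro holomorphic_intros) auto
      then have "f s - Z s = 0"
      proof (rule analytic_continuation[where U = "{s. Re s > 1}" and \<xi> = 2])
        show "open (- {1::complex})" by auto
        show "connected (- {1::complex})" by (intro connected_punctured_universe) simp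
        show "{s. Re s > 1} \<subseteq> - {1::complex}" by auto
        have "(2::complex) \<in> {s. Re s > 1}" by simp
        then show "(2::complex) islimpt {s. Re s > 1}" by (intro open_imp_islimpt open_halfspace_Re_gt) auto
      qed (use False eq in auto)
      then show ?thesis by simp
    qed
  qed
  ultimately have "(THE f. P f) = Z" by (rule the_equality)
  then have "zeta = Z" unfolding zeta_def P_def .
  then have "zeta s = Z s" by (rule fun_cong)
  then show ?thesis by (simp only: Z_def)
qed

section \<open>Zeros and orders off the real axis\<close>

lemma zeta_cofactor_nonzero: "Im s \<noteq> 0 \<Longrightarrow> zeta_cofactor s \<noteq> 0"
proof -
  assume s: "Im s \<noteq> 0"
  then have "s / 2 + 1 \<notin> \<int>\<^sub>\<le>\<^sub>0" "s \<noteq> 1" by (auto elim!: nonpos_Ints_cases simp: complex_eq_iff)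
  then show ?thesis by (simp add: zeta_cofactor_def rGamma_eq_zero_iff)
qed

lemma zeta_eq_0_iff: "Im s \<noteq> 0 \<Longrightarrow> zeta s = 0 \<longleftrightarrow> xi s = 0"
  using zeta_cofactor_nonzero[of s] by (auto simp: zeta_eq)

lemma zorder_zeta:
  assumes "Im s \<noteq> 0"
  shows "zorder zeta s = zorder xi s"
proof -
  have op: "open {z. Im z \<noteq> 0}" by (intro open_Collect_neq continuous_intros)
  have cof: "zeta_cofactor analytic_on {s}"
    unfolding analytic_at zeta_cofactor_def[abs_def]
    using assms op by (intro exI[of _ "{z. Im z \<noteq> 0}"] conjI holomorphic_intros) (auto simp: complex_nonpos_Reals_iff)
  have "xi analytic_on {s}" using xi_holomorphic by (auto simp: analytic_at)
  moreover have "eventually (\<lambda>z. xi z * zeta_cofactor z \<noteq> 0) (at s)"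
  proof -
    have "zeta_reg 2 \<noteq> 0" using zeta_reg_near_1[of 2] by (auto simp: norm_minus_commute)
    then have "xi 2 \<noteq> 0" using xi_half_times_cofactor[of 2] by auto
    then have "eventually (\<lambda>z. xi z \<noteq> 0) (at s)"
      using non_zero_neighbour_alt[OF xi_holomorphic open_UNIV connected_UNIV UNIV_I UNIV_I] by auto
    moreover have "eventually (\<lambda>z. z \<in> {z. Im z \<noteq> 0}) (at s)"
      using op assms by (intro eventually_at_in_open') auto
    ultimately show ?thesis by eventually_elim (use zeta_cofactor_nonzero in auto)
  qed
  ultimately have "zorder (\<lambda>z. xi z * zeta_cofactor z) s = zorder xi s + zorder zeta_cofactor s"
    by (intro zorder_times_analytic cof)
  also have "zorder zeta_cofactor s = 0" by (rule zorder_eq_0I[OF cof zeta_cofactor_nonzero[OF assms]])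
  also have "zorder (\<lambda>z. xi z * zeta_cofactor z) s = zorder zeta s"
  proof (rule zorder_cong)
    have "eventually (\<lambda>z. z \<in> {z. Im z \<noteq> 0}) (at s)"
      using op assms by (intro eventually_at_in_open') auto
    then show "eventually (\<lambda>z. xi z * zeta_cofactor z = zeta z) (at s)"
      by eventually_elim (auto simp: zeta_eq)
  qed simp
  finally show ?thesis by simp
qed

text \<open>Centred at 1/2 but not rotated as Riemann's Xi is: the zeros lie along the imaginary
  axis, and discs about 0 are adapted to the symmetry.\<close>

definition Xi :: "complex \<Rightarrow> complex" where
  "Xi z = xi (1/2 + z)"

lemma Xi_holomorphic: "Xi holomorphic_on UNIV"
proof -
  have "(xi \<circ> (\<lambda>z. 1/2 + z)) holomorphic_on UNIV"
    by (rule holomorphic_on_compose_gen[OF _ xi_holomorphic]) (auto intro!: holomorphic_intros)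
  then show ?thesis by (simp add: o_def Xi_def[abs_def])
qed

lemma Xi_even: "Xi (- z) = Xi z"
  using xi_reflect[of "1/2 + z"] by (simp add: Xi_def algebra_simps)

lemma zorder_Xi: "zorder Xi z = zorder xi (1/2 + z)"
proof -
  have "zorder Xi z = zorder (\<lambda>u. Xi (u + z)) 0" by (rule zorder_shift)
  also have "(\<lambda>u. Xi (u + z)) = (\<lambda>u. xi (u + (1/2 + z)))" by (simp add: Xi_def fun_eq_iff add_ac)
  also have "zorder \<dots> 0 = zorder xi (1/2 + z)" by (rule zorder_shift[symmetric])
  finally show ?thesis .
qed

text \<open>Jensen's formula needs a nonzero value at the centre. At s = 1/2 the explicit part of
  \<open>zeta_reg\<close> is 3/4, while the trapezoid errors add up to at most (3/64) (pi^2/6) <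
  3/16.\<close>

lemma Xi_0_nonzero: "Xi 0 \<noteq> 0"
proof
  assume "Xi 0 = 0"
  then have "xi_half (1/2) = 0" by (simp add: Xi_def xi_eq_xi_half)
  moreover have "complex_of_real (5/4) \<notin> \<int>\<^sub>\<le>\<^sub>0" by (auto elim!: nonpos_Ints_cases simp: complex_eq_iff)
  then have "Gamma ((1/2) / 2 + 1 :: complex) \<noteq> 0" using Gamma_nonzero[of "complex_of_real (5/4)"] by simp
  ultimately have z: "zeta_reg (1/2) = 0" by (simp add: xi_half_def)
  have tb: "cmod (zeta_term n (1/2)) \<le> (3/64) * (1 / (real n + 1)\<^sup>2)" for n
  proof -
    have "cmod (zeta_term n (1/2)) \<le> cmod (1/2 - 1) * cmod (1/2) * cmod (1/2 + 1) / 8 * (real n + 1) powr (- Re (1/2) - 2)"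
      by (rule zeta_term_bound) simp
    also have "cmod (1/2 - 1) = 1/2" using norm_of_real[of "1/2 - 1 :: real", where 'a = complex] by simp
    also have "cmod (1/2 + 1) = 3/2" using norm_of_real[of "1/2 + 1 :: real", where 'a = complex] by simp
    also have "1/2 * cmod (1/2) * (3/2) / 8 * (real n + 1) powr (- Re (1/2) - 2) = (3/64) * (real n + 1) powr (- 5/2)" by simp
    also have "(real n + 1) powr (- 5/2) \<le> (real n + 1) powr (- 2)" by (intro powr_mono) auto
    also have "(real n + 1) powr (- 2) = 1 / (real n + 1)\<^sup>2" by (simp add: powr_minus powr_numeral inverse_eq_divide)
    finally show ?thesis by simp
  qed
  have sm: "(\<lambda>n. (3/64) * (1 / (real n + 1)\<^sup>2)) sums ((3/64) * (pi\<^sup>2 / 6))"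
    using sums_mult[OF inverse_squares_sums, of "3/64"] by (simp add: add.commute)
  have "cmod (\<Sum>n. zeta_term n (1/2)) \<le> (3/64) * (pi\<^sup>2 / 6)"
    using norm_suminf_le[OF tb sums_summable[OF sm]] sums_unique[OF sm] by simp
  also have "\<dots> \<le> (3/64) * 4"
    using pi_less_4 pi_gt_zero power_mono[of pi 4 2] by (intro mult_left_mono) auto
  finally have "cmod (\<Sum>n. zeta_term n (1/2)) \<le> 3/16" by simp
  moreover have "(\<Sum>n. zeta_term n (1/2)) = - of_real (3/4)" using z by (simp add: zeta_reg_def eq_neg_iff_add_eq_0 add.commute)
  then have "cmod (\<Sum>n. zeta_term n (1/2)) = 3/4" by (simp only: norm_minus_cancel norm_of_real)
  ultimately show False by simp
qed

lemma zmult_Xi_uminus: "zmult Xi (- z) = zmult Xi (z :: complex)"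
proof -
  have an: "Xi analytic_on {- z}" using Xi_holomorphic by (auto simp: analytic_at)
  have "zorder (Xi \<circ> uminus) z = zorder Xi (- z) * zorder (\<lambda>x. - x - - z) z"
  proof (rule zorder_compose')
    show "isolated_singularity_at Xi (- z)" using an by (rule isolated_singularity_at_analytic)
    show "not_essential Xi (- z)" using an by (rule not_essential_analytic)
    show "uminus analytic_on {z}" by (intro analytic_intros)
    show "eventually (\<lambda>w. Xi w \<noteq> 0) (at (- z))"
      using non_zero_neighbour_alt[OF Xi_holomorphic open_UNIV connected_UNIV UNIV_I UNIV_I Xi_0_nonzero] by simp
    show "eventually (\<lambda>w. - w \<noteq> - z) (at z)" by (simp add: eventually_at_filter)
  qed
  moreover have "zorder (\<lambda>x. - x - - z) z = 1"
    by (rule zorder_eqI[where S = UNIV and g = "\<lambda>_. - 1"]) (auto intro!: holomorphic_intros)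
  moreover have "Xi \<circ> uminus = Xi" by (auto simp: Xi_even fun_eq_iff)
  ultimately show ?thesis by (simp add: zmult_def)
qed

lemma xi_nonzero_right: "Re s > 1 \<Longrightarrow> xi s \<noteq> 0"
  using xi_half_times_cofactor[of s] zeta_reg_nonzero[of s] by fastforce

lemma Xi_zero_strip: "Xi z = 0 \<Longrightarrow> \<bar>Re z\<bar> \<le> 1/2"
proof (rule ccontr)
  assume "Xi z = 0" "\<not> \<bar>Re z\<bar> \<le> 1/2"
  then have "Re (1/2 + z) > 1 \<or> Re (1/2 - z) > 1" by auto
  then have "Xi z \<noteq> 0 \<or> Xi (- z) \<noteq> 0"
    using xi_nonzero_right[of "1/2 + z"] xi_nonzero_right[of "1/2 - z"] by (auto simp: Xi_def)
  with \<open>Xi z = 0\<close> show False by (simp add: Xi_even)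
qed

section \<open>The size of \<open>Xi\<close>\<close>

lemma norm_Xi:
  assumes "Re z \<ge> 0"
  shows "cmod (Xi z) = cmod (zeta_reg (1/2 + z)) * pi powr (- (1/2 + Re z) / 2) * cmod (Gamma (z / 2 + 5/4))"
proof -
  have "(1/2 + z) / 2 + 1 = z / 2 + 5/4" by (simp add: field_simps)
  moreover have "cmod (of_real pi powr (- (1/2 + z) / 2)) = pi powr (- (1/2 + Re z) / 2)"
    by (simp add: norm_powr_real_powr)
  ultimately show ?thesis using assms by (simp only: Xi_def xi_eq_xi_half xi_half_def norm_mult) (simp add: Xi_def xi_eq_xi_half xi_half_def norm_mult)
qed

lemma norm_Ln_le:
  assumes "1 \<le> cmod w" "cmod w \<le> r"
  shows "cmod (Ln w) \<le> ln r + 4"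
proof -
  have w: "w \<noteq> 0" using assms by auto
  have "cmod (Ln w) \<le> \<bar>Re (Ln w)\<bar> + \<bar>Im (Ln w)\<bar>" by (rule cmod_le)
  also have "\<bar>Re (Ln w)\<bar> = ln (cmod w)" using w assms by simp
  also have "ln (cmod w) \<le> ln r" using assms by (intro ln_mono) auto
  also have "\<bar>Im (Ln w)\<bar> \<le> pi" using mpi_less_Im_Ln[OF w] Im_Ln_le_pi[OF w] by linarith
  finally show ?thesis using pi_less_4 by linarith
qed

lemma ln_ge_1: "r \<ge> 3 \<Longrightarrow> ln r \<ge> (1::real)"
  using e_less_272 by (subst ln_ge_iff) auto

text \<open>For Re z >= 0 the Gamma argument z/2 + 5/4 has real part at least 1, so Stirling's
  formula applies; evenness covers the left half-plane.\<close>

lemma Xi_upper_bound: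
  assumes r: "r \<ge> 3" and z: "cmod z \<le> r"
  shows "cmod (Xi z) \<le> exp (10 * r * ln r)"
proof -
  have main: "cmod (Xi z) \<le> exp (10 * r * ln r)" if z: "cmod z \<le> r" and Re: "Re z \<ge> 0" for z
  proof -
    define w where "w = z / 2 + 5/4"
    have Rw: "Re w \<ge> 1" using Re by (simp add: w_def)
    have lr: "ln r \<ge> 1" by (rule ln_ge_1[OF r])
    have "cmod w \<le> cmod (z / 2) + cmod (5/4 :: complex)" unfolding w_def by (rule norm_triangle_ineq)
    also have "\<dots> = cmod z / 2 + 5/4" by (simp add: norm_divide)
    finally have nw: "cmod w \<le> r" using r z by linarith
    have nw1: "1 \<le> cmod w" using Rw complex_Re_le_cmod[of w] by linarith
    have "cmod (w - 1/2) \<le> r"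
    proof -
      have "w - 1/2 = z / 2 + 3/4" by (simp add: w_def)
      then have "cmod (w - 1/2) \<le> cmod (z / 2) + cmod (3/4 :: complex)" by (simp only: norm_triangle_ineq)
      also have "\<dots> = cmod z / 2 + 3/4" by (simp add: norm_divide)
      finally show ?thesis using r z by linarith
    qed
    then have "cmod (w - 1/2) * cmod (Ln w) \<le> r * (ln r + 4)"
      using norm_Ln_le[OF nw1 nw] r by (intro mult_mono) auto
    then have "Re ((w - 1/2) * Ln w) \<le> r * (ln r + 4)"
      using complex_Re_le_cmod[of "(w - 1/2) * Ln w"] by (simp only: norm_mult)
    then have "Re (stirling w) \<le> r * (ln r + 4)" using Rw by (simp add: stirling_def)
    then have "ln (cmod (Gamma w)) \<le> r * (ln r + 4) + 2" using stirling_bound[OF Rw] by linarith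
    moreover have "cmod (Gamma w) > 0"
    proof -
      have "w \<notin> \<int>\<^sub>\<le>\<^sub>0" using Rw by (auto elim!: nonpos_Ints_cases)
      then show ?thesis using Gamma_nonzero by simp
    qed
    ultimately have G: "cmod (Gamma w) \<le> exp (r * (ln r + 4) + 2)" by (simp add: ln_le_cancel_iff[symmetric, of "cmod (Gamma w)"])
    have s: "cmod (1/2 + z) \<le> r + 1/2" using norm_triangle_ineq[of "1/2" z] z by simp
    have "cmod (zeta_reg (1/2 + z)) \<le> (cmod (1/2 + z) + 2) ^ 3" using Re by (intro zeta_reg_bound) simp
    also have "\<dots> \<le> (r\<^sup>2) ^ 3"
    proof (intro power_mono)
      have "r\<^sup>2 \<ge> 3 * r" using r by (simp add: power2_eq_square)
      then show "cmod (1/2 + z) + 2 \<le> r\<^sup>2" using s r by linarith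
    qed simp
    also have "\<dots> = exp (6 * ln r)"
      using r by (simp add: exp_of_nat_mult[of 6, simplified] flip: power_mult)
    finally have zb: "cmod (zeta_reg (1/2 + z)) \<le> exp (6 * ln r)" .
    have pb: "pi powr (- (1/2 + Re z) / 2) \<le> 1"
      using powr_mono[of "- (1/2 + Re z) / 2" 0 pi] Re pi_ge_two by simp
    have "cmod (Xi z) \<le> exp (6 * ln r) * 1 * exp (r * (ln r + 4) + 2)"
      unfolding norm_Xi[OF Re] w_def[symmetric] using zb pb G by (intro mult_mono) auto
    also have "\<dots> = exp (6 * ln r + r * (ln r + 4) + 2)" by (simp add: exp_add)
    also have "\<dots> \<le> exp (10 * r * ln r)"
    proof -
      have a: "3 * ln r \<le> r * ln r" "r * 1 \<le> r * ln r" "3 * 1 \<le> r * ln r"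
        using r lr by (intro mult_right_mono mult_left_mono mult_mono; simp)+
      have "r * (ln r + 4) = r * ln r + 4 * r" by (simp add: algebra_simps)
      then show ?thesis using a by simp
    qed
    finally show ?thesis .
  qed
  show ?thesis
  proof (cases "Re z \<ge> 0")
    case False
    then show ?thesis using main[of "- z"] z by (simp add: Xi_even)
  qed (use main z in blast)
qed

text \<open>The mean value inequality on a horizontal segment: in the right half-plane, moving to
  the right increases the modulus, so |1/u| is largest at z.\<close>

lemma Ln_shift_bound:
  assumes "Re z > 0" "h \<ge> 0"
  shows "cmod (Ln (z + of_real h) - Ln z) \<le> h / cmod z"
proof -
  have ge: "cmod z \<le> cmod (z + of_real t)" if "t \<ge> 0" for t
  proof -
    have "(Re z)\<^sup>2 \<le> (Re (z + of_real t))\<^sup>2" using assms(1) that by (intro power_mono) auto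
    then show ?thesis unfolding cmod_def by (intro real_sqrt_le_mono) simp
  qed
  have z0: "cmod z > 0" using assms by auto
  have "cmod (Ln (z + of_real h) - Ln z) \<le> 1 / cmod z * cmod (z + of_real h - z)"
  proof (rule field_differentiable_bound[of "closed_segment z (z + of_real h)" Ln "\<lambda>u. inverse u"])
    fix u assume "u \<in> closed_segment z (z + of_real h)"
    then obtain t where t: "0 \<le> t" "t \<le> 1" "u = (1 - t) *\<^sub>R z + t *\<^sub>R (z + of_real h)" by (auto simp: closed_segment_def)
    then have u: "u = z + of_real (t * h)" by (simp add: scaleR_conv_of_real algebra_simps)
    then have Re: "Re u > 0" using assms t by (simp add: add_pos_nonneg)
    then show "(Ln has_field_derivative inverse u) (at u within closed_segment z (z + of_real h))"
      by (intro has_field_derivative_at_within[OF has_field_derivative_Ln]) (auto simp: complex_nonpos_Reals_iff)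
    have "cmod z \<le> cmod u" unfolding u using t assms by (intro ge) simp
    then show "cmod (inverse u) \<le> 1 / cmod z" using z0 le_imp_inverse_le[of "cmod z" "cmod u"] by (simp add: norm_inverse divide_inverse)
  qed (rule convex_closed_segment, simp_all)
  then show ?thesis using assms by simp
qed

text \<open>The part of ln |Xi z| of order above ln |z| in the right half-plane: Stirling's main
  term at z/2 together with the power of pi.\<close>

definition Xi_main :: "complex \<Rightarrow> real" where
  "Xi_main z = Re (z / 2 * Ln (z / 2) - z / 2) - Re z / 2 * ln pi"

text \<open>Re z >= 3/2 means Re s >= 2 for s = 1/2 + z, where |zeta| lies between 3/10 and 17/10.
  The polynomial factor and the shift from z/2 to z/2 + 5/4 in Stirling's formula contribute at most
  multiples of ln R.\<close>

lemma Xi_asymptotics: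
  assumes z: "Re z \<ge> 3/2" and R: "cmod z = R" "R \<ge> 3"
  shows "Xi z \<noteq> 0" "\<bar>ln (cmod (Xi z)) - Xi_main z\<bar> \<le> 20 * ln R"
proof -
  define w where "w = z / 2 + 5/4"
  have Rw: "Re w \<ge> 1" using z by (simp add: w_def)
  have lr: "ln R \<ge> 1" by (rule ln_ge_1[OF R(2)])
  have "cmod w \<le> cmod (z / 2) + cmod (5/4 :: complex)" unfolding w_def by (rule norm_triangle_ineq)
  also have "\<dots> = cmod z / 2 + 5/4" by (simp add: norm_divide)
  finally have nw: "cmod w \<le> R" using R by linarith
  have nw1: "1 \<le> cmod w" using Rw complex_Re_le_cmod[of w] by linarith
  have wG: "w \<notin> \<int>\<^sub>\<le>\<^sub>0" using Rw by (auto elim!: nonpos_Ints_cases)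
  have Gpos: "cmod (Gamma w) > 0" using Gamma_nonzero[OF wG] by simp
  define q where "q = zeta_reg (1/2 + z) / (1/2 + z - 1)"
  have q1: "cmod (q - 1) \<le> 7/10" unfolding q_def by (rule zeta_reg_near_1) (use z in simp)
  have q: "3/10 \<le> cmod q" "cmod q \<le> 17/10"
    using q1 norm_triangle_ineq2[of 1 "1 - q"] norm_triangle_ineq2[of q 1] by (auto simp: norm_minus_commute)
  have s1: "cmod (z - 1/2) \<ge> 1" using complex_Re_le_cmod[of "z - 1/2"] z by simp
  have s2: "cmod (z - 1/2) \<le> R\<^sup>2"
  proof -
    have "cmod (z - 1/2) \<le> R + 1/2" using norm_triangle_ineq4[of z "1/2"] R by simp
    moreover have "R\<^sup>2 \<ge> 3 * R" using R by (simp add: power2_eq_square)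
    ultimately show ?thesis using R(2) by linarith
  qed
  have "1/2 + z - 1 = z - 1/2" by simp
  moreover have "z - 1/2 \<noteq> 0"
  proof
    assume e: "z - 1/2 = 0"
    from s1 show False unfolding e by simp
  qed
  ultimately have zq: "zeta_reg (1/2 + z) = (z - 1/2) * q" by (simp add: q_def)
  have norm: "cmod (Xi z) = (cmod (z - 1/2) * cmod q) * pi powr (- (1/2 + Re z) / 2) * cmod (Gamma w)"
    using norm_Xi[of z] z unfolding zq w_def by (simp add: norm_mult)
  have qpos: "cmod q > 0" "cmod (z - 1/2) > 0" using q s1 by linarith+
  show "Xi z \<noteq> 0" using norm Gpos qpos by auto
  have lnX: "ln (cmod (Xi z)) = ln (cmod (z - 1/2)) + ln (cmod q) - (1/2 + Re z) / 2 * ln pi + ln (cmod (Gamma w))"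
  proof -
    have gen: "ln (a * b * c * d) = ln a + ln b + ln c + ln d" if "a > 0" "b > 0" "c > 0" "d > 0" for a b c d :: real
      using that by (simp add: ln_mult_pos)
    have "ln (pi powr (- (1/2 + Re z) / 2)) = - ((1/2 + Re z) / 2 * ln pi)" by (simp add: ln_powr) (simp add: algebra_simps)
    then show ?thesis unfolding norm using gen[OF qpos(2,1) _ Gpos, of "pi powr (- (1/2 + Re z) / 2)"] by simp
  qed
  have l1: "0 \<le> ln (cmod (z - 1/2))" "ln (cmod (z - 1/2)) \<le> 2 * ln R"
  proof -
    show "0 \<le> ln (cmod (z - 1/2))" using s1 by simp
    have "ln (cmod (z - 1/2)) \<le> ln (R\<^sup>2)" using s2 qpos by (intro ln_mono) auto
    then show "ln (cmod (z - 1/2)) \<le> 2 * ln R" using R by (simp add: ln_realpow)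
  qed
  have l2: "\<bar>ln (cmod q)\<bar> \<le> 3"
  proof -
    have "ln (cmod q) \<le> cmod q - 1" using qpos by (intro ln_le_minus_one)
    moreover have "ln (1 / cmod q) \<le> 1 / cmod q - 1" using qpos by (intro ln_le_minus_one) simp
    moreover have "ln (1 / cmod q) = - ln (cmod q)" using qpos by (simp add: ln_div)
    moreover have "1 / cmod q \<le> 10/3" using q by (simp add: divide_simps)
    ultimately show ?thesis using q by linarith
  qed
  have lnpi: "0 \<le> ln pi" "ln pi \<le> 3"
    using pi_ge_two pi_less_4 ln_le_minus_one[of pi] by auto
  have dL: "cmod (Ln w - Ln (z / 2)) \<le> (5/4) / cmod (z / 2)"
    using Ln_shift_bound[of "z / 2" "5/4"] z by (simp add: w_def)
  have "cmod (z / 2 * (Ln w - Ln (z / 2))) \<le> 5/4"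
  proof -
    have "cmod (z / 2) > 0" using R by (simp add: norm_divide)
    then have "cmod (z / 2) * cmod (Ln w - Ln (z / 2)) \<le> cmod (z / 2) * ((5/4) / cmod (z / 2))"
      by (intro mult_left_mono dL) simp
    also have "\<dots> = 5/4" using \<open>cmod (z / 2) > 0\<close> by simp
    finally show ?thesis by (simp only: norm_mult)
  qed
  then have a1: "\<bar>Re (z / 2 * (Ln w - Ln (z / 2)))\<bar> \<le> 5/4" using abs_Re_le_cmod order_trans by blast
  have "\<bar>Re (Ln w)\<bar> \<le> ln R + 4" using norm_Ln_le[OF nw1 nw] abs_Re_le_cmod order_trans by blast
  moreover have "Re (stirling w) = Re (z / 2 * Ln (z / 2) - z / 2) + Re (z / 2 * (Ln w - Ln (z / 2))) + 3/4 * Re (Ln w) - 5/4"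
  proof -
    have "stirling w = (z / 2 * Ln (z / 2) - z / 2) + z / 2 * (Ln w - Ln (z / 2)) + of_real (3/4) * Ln w - of_real (5/4)"
      by (simp add: stirling_def w_def algebra_simps)
    moreover have "Re (a + b + of_real (3/4) * c - of_real (5/4)) = Re a + Re b + 3/4 * Re c - 5/4" for a b c by simp
    ultimately show ?thesis by (simp only:)
  qed
  moreover have "(1/2 + Re z) / 2 * ln pi = Re z / 2 * ln pi + ln pi / 4" by (simp add: algebra_simps)
  ultimately show "\<bar>ln (cmod (Xi z)) - Xi_main z\<bar> \<le> 20 * ln R"
    using stirling_bound[OF Rw] a1 l1 l2 lnpi lr unfolding lnX Xi_main_def by linarith
qed

section \<open>Counting the zeros\<close>

text \<open>The sum in Jensen's formula; equivalently the integral of n(t)/t over (0, R), where n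
  counts zeros in the disc of radius t.\<close>

definition zero_log_sum :: "real \<Rightarrow> real" where
  "zero_log_sum R = (\<Sum>w\<in>{z \<in> ball 0 R. Xi z = 0}. real (zmult Xi w) * ln (R / cmod w))"

text \<open>R times its derivative is R / pi * (ln (R / (2 pi)) - 1), the main term of the zero
  count.\<close>

definition zero_log_main :: "real \<Rightarrow> real" where
  "zero_log_main R = R / pi * (ln (R / (2 * pi)) - 2)"

lemma Xi_main_cis:
  assumes R: "R > 0" and \<theta>: "\<bar>\<theta>\<bar> \<le> pi / 2"
  shows "Xi_main (of_real R * cis \<theta>) = R / 2 * (cos \<theta> * (ln (R / (2 * pi)) - 1) - \<theta> * sin \<theta>)"
proof -
  have "Ln (of_real (R / 2) * cis \<theta>) = of_real (ln (R / 2)) + Ln (cis \<theta>)"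
    using Ln_times_of_real[of "R / 2" "cis \<theta>"] Ln_of_real[of "R / 2"] R by simp
  moreover have "Ln (cis \<theta>) = \<i> * of_real \<theta>"
  proof -
    have "- pi < \<theta>" "\<theta> \<le> pi" using \<theta> pi_gt_zero by linarith+
    then show ?thesis unfolding cis_conv_exp by (intro Ln_exp) simp_all
  qed
  ultimately have L: "Ln (of_real (R / 2) * cis \<theta>) = of_real (ln (R / 2)) + \<i> * of_real \<theta>" by simp
  have l: "ln (R / (2 * pi)) = ln (R / 2) - ln pi" using R by (simp add: ln_div ln_mult_pos)
  have "of_real R * cis \<theta> / 2 = of_real (R / 2) * cis \<theta>" by simp
  then have "Xi_main (of_real R * cis \<theta>) = Re (of_real (R / 2) * cis \<theta> * (of_real (ln (R / 2)) + \<i> * of_real \<theta>) - of_real (R / 2) * cis \<theta>)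
     - Re (of_real R * cis \<theta>) / 2 * ln pi"
    unfolding Xi_main_def by (simp only: L)
  also have "\<dots> = R / 2 * (cos \<theta> * (ln (R / 2) - ln pi - 1) - \<theta> * sin \<theta>)"
    by (simp add: algebra_simps)
  finally show ?thesis unfolding l .
qed

section \<open>Jensen's integral over the right half circle\<close>

lemma half_circle_angle:
  assumes "t \<in> {0..1/2}" shows "\<bar>2 * pi * t - pi / 2\<bar> \<le> pi / 2"
proof -
  have "0 \<le> 2 * pi * t" "2 * pi * t \<le> 2 * pi * (1/2)" using assms by (auto intro: mult_left_mono)
  then show ?thesis by linarith
qed

lemma half_le_sin:
  assumes "0 \<le> x" "x \<le> pi / 3" shows "x / 2 \<le> sin x"
proof -
  have "sin 0 - 0 / 2 \<le> sin x - x / 2"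
  proof (rule DERIV_nonneg_imp_nondecreasing[OF assms(1)])
    fix t assume t: "0 \<le> t" "t \<le> x"
    have "cos (pi / 3) \<le> cos t" using t assms pi_gt_zero by (intro cos_monotone_0_pi_le) auto
    then have "0 \<le> cos t - 1 / 2" by (simp add: cos_60)
    moreover have "((\<lambda>t. sin t - t / 2) has_real_derivative cos t - 1 / 2) (at t)"
      by (auto intro!: derivative_eq_intros)
    ultimately show "\<exists>y. ((\<lambda>t. sin t - t / 2) has_real_derivative y) (at t) \<and> 0 \<le> y" by blast
  qed
  then show ?thesis by simp
qed

text \<open>Points of the right half circle at parameter distance at least 1/R from its ends have
  real part at least 3/2, as \<open>Xi_asymptotics\<close> demands. R >= 6 makes 2 pi / R <= pi/3,
  where sin x >= x/2.\<close>

lemma sin_ge_on_circle: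
  assumes R: "R \<ge> 6" and t: "1 / R \<le> t" "t \<le> 1/2 - 1 / R"
  shows "3 / 2 \<le> R * sin (2 * pi * t)"
proof -
  have small: "2 * pi * (1 / R) \<le> pi / 3" using R by (simp add: field_simps)
  have "pi / R \<le> sin (2 * pi * (1 / R))" using half_le_sin[OF _ small] R by simp
  moreover have "sin (2 * pi * (1 / R)) \<le> sin (2 * pi * t)"
  proof (cases "t \<le> 1/4")
    case True
    have "2 * pi * (1 / R) \<le> 2 * pi * t" using t by (intro mult_left_mono) auto
    moreover have "2 * pi * t \<le> pi / 2" using True by simp
    moreover have "- (pi / 2) \<le> 2 * pi * (1 / R)" using R pi_gt_zero by (smt (verit) divide_nonneg_nonneg mult_nonneg_nonneg)
    ultimately show ?thesis by (intro sin_monotone_2pi_le)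
  next
    case False
    have "2 * pi * (1 / R) \<le> 2 * pi * (1/2 - t)" using t by (intro mult_left_mono) auto
    moreover have "2 * pi * (1/2 - t) \<le> pi / 2" using False by (simp add: algebra_simps)
    moreover have "- (pi / 2) \<le> 2 * pi * (1 / R)" using R pi_gt_zero by (smt (verit) divide_nonneg_nonneg mult_nonneg_nonneg)
    ultimately have "sin (2 * pi * (1 / R)) \<le> sin (2 * pi * (1/2 - t))" by (intro sin_monotone_2pi_le)
    also have "2 * pi * (1/2 - t) = pi - 2 * pi * t" by (simp add: algebra_simps)
    finally show ?thesis by simp
  qed
  ultimately have "pi / R \<le> sin (2 * pi * t)" by linarith
  then have "pi \<le> R * sin (2 * pi * t)" using R by (simp add: field_simps)
  then show ?thesis using pi_ge_two by linarith
qed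

text \<open>Evenness makes the integrand periodic with period 1/2, so the right half circle, where
  Stirling's formula is available, carries half of Jensen's integral.\<close>

lemma zero_log_sum_half:
  assumes R: "R > 0" and nz: "\<And>z. cmod z = R \<Longrightarrow> Xi z \<noteq> 0"
  shows "((\<lambda>t. ln (cmod (Xi (of_real R * cis (2 * pi * t - pi / 2))))) has_integral
     (ln (cmod (Xi 0)) + zero_log_sum R) / 2) {0..1/2}"
proof -
  define g where "g = (\<lambda>t. ln (cmod (Xi (of_real R * cis (2 * pi * t - pi / 2)))))"
  have "- \<i> * of_real R * cis (2 * pi * t) = of_real R * cis (2 * pi * t - pi / 2)" for t
    by (simp add: complex_eq_iff cos_diff sin_diff)
  then have I: "(g has_integral ln (cmod (Xi 0)) + zero_log_sum R) {0..1}"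
    using jensen_circle[OF Xi_holomorphic Xi_0_nonzero R nz, of "- \<i>"] unfolding g_def zero_log_sum_def by simp
  have per: "g (t + 1/2) = g t" for t
  proof -
    have "2 * pi * (t + 1/2) - pi / 2 = 2 * pi * t - pi / 2 + pi" by (simp add: algebra_simps)
    moreover have "cis (x + pi) = - cis x" for x by (simp add: complex_eq_iff)
    ultimately have "of_real R * cis (2 * pi * (t + 1/2) - pi / 2) = - (of_real R * cis (2 * pi * t - pi / 2))"
      by (simp only: mult_minus_right)
    then show ?thesis unfolding g_def by (simp only: Xi_even)
  qed
  have int: "g integrable_on {0..1/2}" "g integrable_on {1/2..1}"
    using I by (auto intro: integrable_on_subinterval[of g "{0..1}"] simp: has_integral_integrable)
  have "integral {1/2..1} g = integral {0..1/2} (\<lambda>t. g (t + 1/2))"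
    using integral_shift_real_ivl[of "1/2" "1/2" "1" g] by simp
  then have "integral {1/2..1} g = integral {0..1/2} g" by (simp only: per)
  moreover have "integral {0..1/2} g + integral {1/2..1} g = integral {0..1} g"
    using I by (intro Henstock_Kurzweil_Integration.integral_combine) (auto simp: has_integral_integrable)
  moreover have "integral {0..1} g = ln (cmod (Xi 0)) + zero_log_sum R" using I by (rule integral_unique)
  ultimately have "integral {0..1/2} g = (ln (cmod (Xi 0)) + zero_log_sum R) / 2" by simp
  then show ?thesis using int(1) unfolding g_def[symmetric] by (metis integrable_integral)
qed

lemma Xi_main_integral:
  assumes R: "R > 0"
  shows "((\<lambda>t. Xi_main (of_real R * cis (2 * pi * t - pi / 2))) has_integral zero_log_main R / 2) {0..1/2}"
proof -
  define a where "a = ln (R / (2 * pi)) - 1"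
  define W where "W = (\<lambda>t. R / (4 * pi) * (a * sin (2 * pi * t - pi / 2) - sin (2 * pi * t - pi / 2) + (2 * pi * t - pi / 2) * cos (2 * pi * t - pi / 2)))"
  have "((\<lambda>t. R / 2 * (cos (2 * pi * t - pi / 2) * a - (2 * pi * t - pi / 2) * sin (2 * pi * t - pi / 2))) has_integral (W (1/2) - W 0)) {0..1/2}"
  proof (rule fundamental_theorem_of_calculus)
    fix t :: real
    have "(W has_real_derivative R / 2 * (cos (2 * pi * t - pi / 2) * a - (2 * pi * t - pi / 2) * sin (2 * pi * t - pi / 2))) (at t)"
      unfolding W_def by (auto intro!: derivative_eq_intros simp: field_simps)
    then show "(W has_vector_derivative R / 2 * (cos (2 * pi * t - pi / 2) * a - (2 * pi * t - pi / 2) * sin (2 * pi * t - pi / 2))) (at t within {0..1/2})"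
      by (simp add: has_real_derivative_iff_has_vector_derivative has_vector_derivative_at_within)
  qed simp
  moreover have "W (1/2) - W 0 = zero_log_main R / 2"
  proof -
    have "2 * pi * (1/2) - pi / 2 = pi / 2" by simp
    then show ?thesis unfolding W_def zero_log_main_def a_def by (simp add: field_simps)
  qed
  ultimately have "((\<lambda>t. R / 2 * (cos (2 * pi * t - pi / 2) * a - (2 * pi * t - pi / 2) * sin (2 * pi * t - pi / 2))) has_integral zero_log_main R / 2) {0..1/2}"
    by simp
  then show ?thesis
  proof (rule has_integral_eq[rotated])
    fix t :: real assume "t \<in> {0..1/2}"
    then have "\<bar>2 * pi * t - pi / 2\<bar> \<le> pi / 2" by (rule half_circle_angle)
    then show "R / 2 * (cos (2 * pi * t - pi / 2) * a - (2 * pi * t - pi / 2) * sin (2 * pi * t - pi / 2)) = Xi_main (of_real R * cis (2 * pi * t - pi / 2))"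
      unfolding a_def by (rule Xi_main_cis[OF R, symmetric])
  qed
qed

text \<open>Stirling's formula is used where \<open>Re z \<ge> 3/2\<close>; on the rest of the circle, two arcs of angle
  \<open>O(1/R)\<close>, a bound of order \<open>R (ln R)\<^sup>2\<close> for \<open>B\<close> is enough.\<close>

lemma zero_log_sum_estimate:
  assumes R: "R \<ge> 6" and nz: "\<And>z. cmod z = R \<Longrightarrow> Xi z \<noteq> 0"
    and B: "\<And>z. cmod z = R \<Longrightarrow> \<bar>ln (cmod (Xi z))\<bar> \<le> B" "B \<ge> 0"
  shows "\<bar>ln (cmod (Xi 0)) + zero_log_sum R - zero_log_main R\<bar> \<le> 4 * (B + R * (ln R + 5)) / R + 20 * ln R"
proof -
  have Rpos: "R > 0" using R by simp
  define z where "z = (\<lambda>t. of_real R * cis (2 * pi * t - pi / 2))"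
  define D where "D = (\<lambda>t. ln (cmod (Xi (z t))) - Xi_main (z t))"
  have nz': "cmod (z t) = R" for t using Rpos by (simp add: z_def norm_mult)
  have DI: "(D has_integral ((ln (cmod (Xi 0)) + zero_log_sum R) / 2 - zero_log_main R / 2)) {0..1/2}"
    unfolding D_def z_def by (intro has_integral_diff zero_log_sum_half[OF Rpos nz] Xi_main_integral[OF Rpos])
  have lnR: "ln R \<ge> 1" using R by (intro ln_ge_1) simp
  have Dall: "\<bar>D t\<bar> \<le> B + R * (ln R + 5)" if t: "t \<in> {0..1/2}" for t
  proof -
    define \<theta> where "\<theta> = 2 * pi * t - pi / 2"
    have th: "\<bar>\<theta>\<bar> \<le> pi / 2"
      unfolding \<theta>_def by (rule half_circle_angle[OF t])
    have l: "\<bar>ln (R / (2 * pi)) - 1\<bar> \<le> ln R + 4"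
    proof -
      have "ln (R / (2 * pi)) = ln R - ln (2 * pi)" using Rpos by (simp add: ln_div)
      moreover have "ln (2 * pi) \<ge> 0" using pi_ge_two by simp
      moreover have "ln (2 * pi) \<le> 3"
      proof -
        have "ln (2 * pi) = ln 2 + ln pi" by (simp add: ln_mult_pos)
        moreover have "ln pi = ln 2 + ln (pi / 2)" by (simp add: ln_div)
        moreover have "ln (pi / 2) \<le> pi / 2 - 1" by (intro ln_le_minus_one) simp
        moreover have "ln (2::real) \<le> 1" using ln_le_minus_one[of 2] by simp
        ultimately show ?thesis using pi_less_4 by linarith
      qed
      ultimately show ?thesis using lnR by linarith
    qed
    have "\<bar>cos \<theta> * (ln (R / (2 * pi)) - 1)\<bar> \<le> 1 * (ln R + 4)"
      unfolding abs_mult using l by (intro mult_mono) auto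
    moreover have "\<bar>\<theta> * sin \<theta>\<bar> \<le> (pi / 2) * 1" unfolding abs_mult using th by (intro mult_mono) auto
    moreover have "\<bar>x - y\<bar> \<le> 2 * (l + 5)" if "\<bar>x\<bar> \<le> 1 * (l + 4)" "\<bar>y\<bar> \<le> (pi / 2) * 1" "1 \<le> l" for x y l :: real
    proof -
      have "\<bar>x - y\<bar> \<le> \<bar>x\<bar> + \<bar>y\<bar>" by (rule abs_triangle_ineq4)
      also have "\<dots> \<le> (l + 4) + 2"
      proof (rule add_mono)
        show "\<bar>x\<bar> \<le> l + 4" using that(1) by simp
        show "\<bar>y\<bar> \<le> 2" using that(2) pi_less_4 by simp
      qed
      also have "\<dots> \<le> 2 * (l + 5)" using that(3) by simp
      finally show ?thesis .
    qed
    ultimately have "\<bar>cos \<theta> * (ln (R / (2 * pi)) - 1) - \<theta> * sin \<theta>\<bar> \<le> 2 * (ln R + 5)"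
      using lnR by blast
    then have "\<bar>R / 2 * (cos \<theta> * (ln (R / (2 * pi)) - 1) - \<theta> * sin \<theta>)\<bar> \<le> R / 2 * (2 * (ln R + 5))"
      unfolding abs_mult using Rpos by (intro mult_mono) auto
    also have "R / 2 * (2 * (ln R + 5)) = R * (ln R + 5)" by simp
    finally have "\<bar>Xi_main (z t)\<bar> \<le> R * (ln R + 5)"
      unfolding z_def \<theta>_def[symmetric] Xi_main_cis[OF Rpos th] .
    then show ?thesis using B(1)[OF nz', of t] unfolding D_def by linarith
  qed
  have Dmid: "\<bar>D t\<bar> \<le> 20 * ln R" if t: "t \<in> {1 / R..1/2 - 1 / R}" for t
  proof -
    have "Re (z t) = R * sin (2 * pi * t)" by (simp add: z_def cos_diff)
    then have "Re (z t) \<ge> 3/2" using sin_ge_on_circle[OF R, of t] t by simp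
    then show ?thesis unfolding D_def using Xi_asymptotics(2)[OF _ nz'] R by simp
  qed
  have Dint: "D integrable_on {a..b}" if "0 \<le> a" "b \<le> 1/2" for a b
    by (rule integrable_on_subinterval[OF has_integral_integrable[OF DI]]) (use that in auto)
  have R1: "0 \<le> 1 / R" "1 / R \<le> 1/2 - 1 / R" "1/2 - 1 / R \<le> 1/2" using R by (auto simp: field_simps)
  have bnd: "\<bar>integral {a..b} D\<bar> \<le> C * (b - a)" if "0 \<le> a" "a \<le> b" "b \<le> 1/2" "\<And>t. t \<in> {a..b} \<Longrightarrow> \<bar>D t\<bar> \<le> C" "0 \<le> C" for a b C
    using has_integral_bound_real[OF that(5) finite.emptyI integrable_integral[OF Dint[OF that(1,3)]]] that by simp
  have "integral {0..1/2} D = integral {0..1/R} D + integral {1/R..1/2} D"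
    using R1 Dint[of 0 "1/2"] by (intro Henstock_Kurzweil_Integration.integral_combine[symmetric]) auto
  also have "integral {1/R..1/2} D = integral {1/R..1/2-1/R} D + integral {1/2-1/R..1/2} D"
    using R1 Dint[of "1/R" "1/2"] by (intro Henstock_Kurzweil_Integration.integral_combine[symmetric]) auto
  finally have split: "integral {0..1/2} D = integral {0..1/R} D + (integral {1/R..1/2-1/R} D + integral {1/2-1/R..1/2} D)" .
  define C where "C = B + R * (ln R + 5)"
  have C0: "C \<ge> 0" using B(2) lnR Rpos by (simp add: C_def)
  have b1: "\<bar>integral {0..1/R} D\<bar> \<le> C * (1/R - 0)"
    by (rule bnd) (use R1 C0 Dall in \<open>auto simp: C_def\<close>)
  have b2: "\<bar>integral {1/2-1/R..1/2} D\<bar> \<le> C * (1/2 - (1/2 - 1/R))"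
    by (rule bnd) (use R1 C0 Dall in \<open>auto simp: C_def\<close>)
  have b3: "\<bar>integral {1/R..1/2-1/R} D\<bar> \<le> 20 * ln R * (1/2 - 1/R - 1/R)"
    by (rule bnd) (use R1 lnR Dmid in auto)
  have "20 * ln R * (1/2 - 1/R - 1/R) \<le> 20 * ln R * (1/2)"
    using lnR R by (intro mult_left_mono) auto
  with b3 have b3': "\<bar>integral {1/R..1/2-1/R} D\<bar> \<le> 10 * ln R" by simp
  have b1': "\<bar>integral {0..1/R} D\<bar> \<le> C / R" and b2': "\<bar>integral {1/2-1/R..1/2} D\<bar> \<le> C / R"
    using b1 b2 by simp_all
  have I: "integral {0..1/2} D = (ln (cmod (Xi 0)) + zero_log_sum R) / 2 - zero_log_main R / 2"
    using DI by (rule integral_unique)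
  \<comment> \<open>Two arcs of parameter length 1/R contribute C/R each and the middle 10 ln R; all
    is doubled because D integrates to half the difference.\<close>
  have gen: "\<bar>u - v\<bar> \<le> 4 * c + 20 * l" if "x + (y + z) = u / 2 - v / 2" "\<bar>x\<bar> \<le> c" "\<bar>y\<bar> \<le> 10 * l" "\<bar>z\<bar> \<le> c"
    for u v x y z c l :: real
    using that by (simp only: abs_le_iff) linarith
  have "\<bar>(ln (cmod (Xi 0)) + zero_log_sum R) - zero_log_main R\<bar> \<le> 4 * (C / R) + 20 * ln R"
    by (rule gen[OF _ b1' b3' b2']) (use split I in simp)
  then show ?thesis unfolding C_def by simp
qed

text \<open>On a circle supplied by \<open>minimum_modulus\<close>, |ln |Xi|| is O(R ln^2 R)
  everywhere; the arcs near the imaginary axis have length O(1/R) in the parameter, so they cost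
  only O(ln^2 R).\<close>

lemma exists_zero_log_sum_radius:
  obtains C R0 where "C > 0" "R0 \<ge> 15"
    "\<And>R. R \<ge> R0 \<Longrightarrow> \<exists>r. R \<le> r \<and> r \<le> R + 1 \<and> \<bar>zero_log_sum r - zero_log_main r\<bar> \<le> C * (ln r)\<^sup>2"
proof -
  define c0 where "c0 = ln (cmod (Xi 0))"
  \<comment> \<open>The lower bound of \<open>minimum_modulus\<close> for A = 10 (15 R) ln (15 R),
    the growth bound of \<open>Xi\<close> on the disc of radius 15 R.\<close>
  define LB where "LB = (\<lambda>R. c0 - 2 * (10 * (15 * R) * ln (15 * R) - c0) - (10 * (15 * R) * ln (15 * R) - c0) / ln 2 * ln (20 * R * ((10 * (15 * R) * ln (15 * R) - c0) / ln 2 + 1)))"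
  have "(\<lambda>R. \<bar>LB R\<bar> + 10 * (R + 1) * ln (R + 1)) \<in> O(\<lambda>R. R * (ln R)\<^sup>2)" unfolding LB_def by real_asymp
  then obtain K where "K > 0" and K: "eventually (\<lambda>R. norm (\<bar>LB R\<bar> + 10 * (R + 1) * ln (R + 1)) \<le> K * norm (R * (ln R)\<^sup>2)) at_top"
    unfolding bigo_def by blast
  then obtain R1 where K1: "\<And>R. R \<ge> R1 \<Longrightarrow> norm (\<bar>LB R\<bar> + 10 * (R + 1) * ln (R + 1)) \<le> K * norm (R * (ln R)\<^sup>2)"
    unfolding eventually_at_top_linorder by blast
  define R0 where "R0 = max 15 R1"
  \<comment> \<open>The 44 is 4 (1 + 5) + 20, from the terms 4 (ln r + 5) and 20 ln r after each of
    1 and ln r is bounded by (ln r)^2.\<close>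
  define C where "C = 4 * K + 44 + \<bar>c0\<bar>"
  show ?thesis
  proof (rule that[of C R0])
    show "C > 0" using \<open>K > 0\<close> by (simp add: C_def)
    show "R0 \<ge> 15" by (simp add: R0_def)
    fix R assume "R \<ge> R0"
    then have R: "R \<ge> 15" "R \<ge> R1" by (auto simp: R0_def)
    have ub: "cmod (Xi z) \<le> exp (10 * (15 * R) * ln (15 * R))" if "cmod z \<le> 15 * R" for z
      by (rule Xi_upper_bound) (use R that in auto)
    have R1: "1 \<le> R" using R by simp
    have LBR: "LB R = c0 - 2 * (10 * (15 * R) * ln (15 * R) - c0) - (10 * (15 * R) * ln (15 * R) - c0) / ln 2 * ln (20 * R * ((10 * (15 * R) * ln (15 * R) - c0) / ln 2 + 1))"
      by (simp only: LB_def)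
    obtain r where r: "R \<le> r" "r \<le> R + 1" and nz: "\<And>z. cmod z = r \<Longrightarrow> Xi z \<noteq> 0"
      and lb: "\<And>z. cmod z = r \<Longrightarrow> LB R \<le> ln (cmod (Xi z))"
      by (rule minimum_modulus[OF Xi_holomorphic Xi_0_nonzero R1, of "10 * (15 * R) * ln (15 * R)", folded c0_def, folded LBR])
         (erule ub, rule that)
    define B where "B = \<bar>LB R\<bar> + 10 * (R + 1) * ln (R + 1)"
    have B0: "B \<ge> 0" using R by (simp add: B_def)
    have Bz: "\<bar>ln (cmod (Xi z))\<bar> \<le> B" if z: "cmod z = r" for z
    proof -
      have "cmod (Xi z) \<le> exp (10 * (R + 1) * ln (R + 1))" by (rule Xi_upper_bound) (use R r z in auto)
      then have "ln (cmod (Xi z)) \<le> 10 * (R + 1) * ln (R + 1)"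
        using nz[OF z] ln_le_cancel_iff[of "cmod (Xi z)" "exp (10 * (R + 1) * ln (R + 1))"] by simp
      moreover have "10 * (R + 1) * ln (R + 1) \<ge> 0" using R by simp
      ultimately show ?thesis using lb[OF z] unfolding B_def by linarith
    qed
    have l1: "ln r \<ge> 1" by (rule ln_ge_1) (use R r in simp)
    have l2: "ln r \<le> (ln r)\<^sup>2" using l1 mult_left_mono[of 1 "ln r" "ln r"] by (simp add: power2_eq_square)
    have l3: "1 \<le> (ln r)\<^sup>2" using l1 l2 by linarith
    have "B \<le> K * (R * (ln R)\<^sup>2)" using K1[OF R(2)] R by (simp add: B_def)
    also have "\<dots> \<le> K * (r * (ln r)\<^sup>2)" using \<open>K > 0\<close> R r by (intro mult_left_mono mult_mono power_mono) auto
    finally have BK: "B / r \<le> K * (ln r)\<^sup>2" using R r by (simp add: field_simps)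
    have "\<bar>c0 + zero_log_sum r - zero_log_main r\<bar> \<le> 4 * (B + r * (ln r + 5)) / r + 20 * ln r"
      unfolding c0_def using nz Bz B0 R r by (intro zero_log_sum_estimate) auto
    also have "4 * (B + r * (ln r + 5)) / r = 4 * (B / r) + 4 * (ln r + 5)" using R r by (simp add: field_simps)
    finally have "\<bar>zero_log_sum r - zero_log_main r\<bar> \<le> \<bar>c0\<bar> + 4 * (B / r) + 4 * (ln r + 5) + 20 * ln r" by linarith
    also have "\<dots> \<le> \<bar>c0\<bar> * (ln r)\<^sup>2 + 4 * (K * (ln r)\<^sup>2) + 4 * ((ln r)\<^sup>2 + 5 * (ln r)\<^sup>2) + 20 * (ln r)\<^sup>2"
      using BK l2 l3 mult_left_mono[OF l3, of "\<bar>c0\<bar>"] by (intro add_mono) auto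
    also have "\<dots> = C * (ln r)\<^sup>2" by (simp add: C_def algebra_simps)
    finally show "\<exists>r. R \<le> r \<and> r \<le> R + 1 \<and> \<bar>zero_log_sum r - zero_log_main r\<bar> \<le> C * (ln r)\<^sup>2" using r by blast
  qed
qed


text \<open>When the radius grows from R to R', each zero in the smaller disc gains exactly ln
  (R'/R), and each new zero contributes between 0 and ln (R'/R).\<close>

lemma zero_log_sum_diff:
  assumes R: "0 < R" "R \<le> R'"
  shows "(\<Sum>w\<in>{z \<in> ball 0 R. Xi z = 0}. real (zmult Xi w)) * ln (R' / R) \<le> zero_log_sum R' - zero_log_sum R"
    and "zero_log_sum R' - zero_log_sum R \<le> (\<Sum>w\<in>{z \<in> ball 0 R'. Xi z = 0}. real (zmult Xi w)) * ln (R' / R)"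
proof -
  define A where "A = {z \<in> ball 0 R. Xi z = 0}"
  define B where "B = {z \<in> ball 0 R'. Xi z = 0} - A"
  have fin: "finite A" "finite B"
  proof -
    have f: "finite {z \<in> ball 0 a. Xi z = 0}" for a
      by (rule finite_zeros_ball[OF Xi_holomorphic Xi_0_nonzero bounded_ball])
    show "finite A" "finite B" unfolding A_def B_def by (intro finite_Diff f)+
  qed
  have AB: "{z \<in> ball 0 R'. Xi z = 0} = A \<union> B" "A \<inter> B = {}" using R by (auto simp: A_def B_def)
  have A0: "w \<noteq> 0" if "w \<in> A \<union> B" for w using that Xi_0_nonzero by (auto simp: A_def B_def)
  have J': "zero_log_sum R' = (\<Sum>w\<in>A. real (zmult Xi w) * ln (R' / cmod w)) + (\<Sum>w\<in>B. real (zmult Xi w) * ln (R' / cmod w))"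
    unfolding zero_log_sum_def AB(1) by (rule sum.union_disjoint[OF fin AB(2)])
  have "(\<Sum>w\<in>A. real (zmult Xi w) * ln (R' / cmod w)) = (\<Sum>w\<in>A. real (zmult Xi w) * ln (R / cmod w) + real (zmult Xi w) * ln (R' / R))"
  proof (rule sum.cong[OF refl])
    fix w assume "w \<in> A"
    then have "ln (R' / cmod w) = ln (R / cmod w) + ln (R' / R)" using A0 R by (simp add: ln_div)
    then show "real (zmult Xi w) * ln (R' / cmod w) = real (zmult Xi w) * ln (R / cmod w) + real (zmult Xi w) * ln (R' / R)"
      by (simp only: distrib_left)
  qed
  also have "\<dots> = zero_log_sum R + (\<Sum>w\<in>A. real (zmult Xi w)) * ln (R' / R)"
    by (simp add: sum.distrib zero_log_sum_def A_def sum_distrib_right)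
  finally have D: "zero_log_sum R' - zero_log_sum R = (\<Sum>w\<in>A. real (zmult Xi w)) * ln (R' / R) + (\<Sum>w\<in>B. real (zmult Xi w) * ln (R' / cmod w))"
    using J' by simp
  have Bw: "0 \<le> ln (R' / cmod w)" "ln (R' / cmod w) \<le> ln (R' / R)" if "w \<in> B" for w
  proof -
    have w: "R \<le> cmod w" "cmod w < R'" using that by (auto simp: B_def A_def)
    then have "0 < cmod w" using R by linarith
    then show "0 \<le> ln (R' / cmod w)" using w by (intro ln_ge_zero) (simp add: le_divide_eq)
    have "R' / cmod w \<le> R' / R" using w R by (intro divide_left_mono mult_pos_pos) auto
    then show "ln (R' / cmod w) \<le> ln (R' / R)" using w R \<open>0 < cmod w\<close> by (subst ln_le_cancel_iff) auto
  qed
  have "0 \<le> (\<Sum>w\<in>B. real (zmult Xi w) * ln (R' / cmod w))" using Bw by (intro sum_nonneg mult_nonneg_nonneg) auto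
  then show "(\<Sum>w\<in>{z \<in> ball 0 R. Xi z = 0}. real (zmult Xi w)) * ln (R' / R) \<le> zero_log_sum R' - zero_log_sum R"
    unfolding D A_def by simp
  have "(\<Sum>w\<in>B. real (zmult Xi w) * ln (R' / cmod w)) \<le> (\<Sum>w\<in>B. real (zmult Xi w)) * ln (R' / R)"
    unfolding sum_distrib_right using Bw by (intro sum_mono mult_left_mono) auto
  then show "zero_log_sum R' - zero_log_sum R \<le> (\<Sum>w\<in>{z \<in> ball 0 R'. Xi z = 0}. real (zmult Xi w)) * ln (R' / R)"
    unfolding D AB(1) sum.union_disjoint[OF fin AB(2)] by (simp add: distrib_right)
qed

section \<open>From Jensen sums to zero counts\<close>

definition zero_count :: "real \<Rightarrow> real" where
  "zero_count R = (\<Sum>w\<in>{z \<in> ball 0 R. Xi z = 0}. real (zmult Xi w))"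

lemma zero_log_main_altdef:
  "R > 0 \<Longrightarrow> zero_log_main R = (R * (ln R - (ln (2 * pi) + 2))) / pi"
  by (simp add: zero_log_main_def ln_div)

lemma zero_log_sum_mono:
  assumes "0 < R" "R \<le> R'" shows "zero_log_sum R \<le> zero_log_sum R'"
proof -
  have "0 \<le> (\<Sum>w\<in>{z \<in> ball 0 R. Xi z = 0}. real (zmult Xi w)) * ln (R' / R)"
    using assms by (intro mult_nonneg_nonneg sum_nonneg ln_ge_zero) (auto simp: le_divide_eq)
  then show ?thesis using zero_log_sum_diff(1)[OF assms] by linarith
qed

lemma zero_log_main_mono:
  assumes "20 \<le> R" "R \<le> R'" shows "zero_log_main R \<le> zero_log_main R'"
proof (rule DERIV_nonneg_imp_nondecreasing[OF assms(2)])
  fix x assume x: "R \<le> x" "x \<le> R'"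
  \<comment> \<open>The threshold 20 is chosen for this: 20/7 exceeds e, so the derivative of
    \<open>zero_log_main\<close> is nonnegative.\<close>
  have "exp 1 \<le> x / (2 * pi)"
  proof -
    have "exp (1::real) \<le> 272/100" using e_less_272 by simp
    moreover have "2 * pi \<le> 7" using pi_approx by simp
    then have "20 / 7 \<le> x / (2 * pi)" using x assms by (intro frac_le) auto
    ultimately show ?thesis by linarith
  qed
  moreover have "x / (2 * pi) > 0" using x assms by simp
  ultimately have l: "1 \<le> ln (x / (2 * pi))" by (simp add: ln_ge_iff)
  have "(zero_log_main has_real_derivative (ln (x / (2 * pi)) - 1) / pi) (at x)"
    unfolding zero_log_main_def[abs_def] using x assms
    by (auto intro!: derivative_eq_intros simp: field_simps)
  then show "\<exists>y. (zero_log_main has_real_derivative y) (at x) \<and> 0 \<le> y"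
    using l by (intro exI conjI) auto
qed

text \<open>From good radii to all radii: both functions increase, every unit interval contains a
  good radius, and the main term changes by at most (ln R)^2 over it. The radius above R yields the
  upper bound, the one in [R - 1, R] the lower bound.\<close>

lemma zero_log_sum_asymptotics:
  obtains C where "C > 0" "eventually (\<lambda>R. \<bar>zero_log_sum R - zero_log_main R\<bar> \<le> C * (ln R)\<^sup>2) at_top"
proof -
  obtain C R0 where C: "C > 0" and R0: "R0 \<ge> 15"
    and ex: "\<And>R. R \<ge> R0 \<Longrightarrow> \<exists>r. R \<le> r \<and> r \<le> R + 1 \<and> \<bar>zero_log_sum r - zero_log_main r\<bar> \<le> C * (ln r)\<^sup>2"
    using exists_zero_log_sum_radius by blast
  define a where "a = ln (2 * pi) + 2"
  have e1: "eventually (\<lambda>R. (R + 1) * (ln (R + 1) - a) - R * (ln R - a) \<le> (ln R)\<^sup>2) at_top" by real_asymp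
  have e2: "eventually (\<lambda>R. R * (ln R - a) - (R - 1) * (ln (R - 1) - a) \<le> (ln R)\<^sup>2) at_top" by real_asymp
  have e3: "eventually (\<lambda>R::real. (ln (R + 1))\<^sup>2 \<le> 2 * (ln R)\<^sup>2) at_top" by real_asymp
  have "eventually (\<lambda>R. \<bar>zero_log_sum R - zero_log_main R\<bar> \<le> (2 * C + 1) * (ln R)\<^sup>2) at_top"
    using e1 e2 e3 eventually_ge_at_top[of "R0 + 10"]
  proof eventually_elim
    case (elim R)
    have R: "R \<ge> 25" "R \<ge> R0 + 1" using elim(4) R0 by auto
    have "zero_log_main (R + 1) - zero_log_main R = ((R + 1) * (ln (R + 1) - a) - R * (ln R - a)) / pi"
      using R by (simp add: zero_log_main_altdef a_def diff_divide_distrib)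
    also have "\<dots> \<le> (ln R)\<^sup>2 / pi" using elim(1) by (intro divide_right_mono) auto
    also have "\<dots> \<le> (ln R)\<^sup>2" using pi_ge_two by (simp add: divide_le_eq mult_le_cancel_left1)
    finally have m1: "zero_log_main (R + 1) - zero_log_main R \<le> (ln R)\<^sup>2" .
    have "zero_log_main R - zero_log_main (R - 1) = (R * (ln R - a) - (R - 1) * (ln (R - 1) - a)) / pi"
      using R by (simp add: zero_log_main_altdef a_def diff_divide_distrib)
    also have "\<dots> \<le> (ln R)\<^sup>2 / pi" using elim(2) by (intro divide_right_mono) auto
    also have "\<dots> \<le> (ln R)\<^sup>2" using pi_ge_two by (simp add: divide_le_eq mult_le_cancel_left1)
    finally have m2: "zero_log_main R - zero_log_main (R - 1) \<le> (ln R)\<^sup>2" .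
    obtain r where r: "R \<le> r" "r \<le> R + 1" "\<bar>zero_log_sum r - zero_log_main r\<bar> \<le> C * (ln r)\<^sup>2"
      using ex[of R] R by auto
    have "C * (ln r)\<^sup>2 \<le> C * (ln (R + 1))\<^sup>2" using C r R by (intro mult_left_mono power_mono) auto
    also have "\<dots> \<le> C * (2 * (ln R)\<^sup>2)" using C elim(3) by (intro mult_left_mono) auto
    finally have u1: "C * (ln r)\<^sup>2 \<le> 2 * C * (ln R)\<^sup>2" by simp
    have "zero_log_sum R \<le> zero_log_sum r" "zero_log_main r \<le> zero_log_main (R + 1)"
      using r R by (auto intro!: zero_log_sum_mono zero_log_main_mono)
    then have up: "zero_log_sum R - zero_log_main R \<le> (2 * C + 1) * (ln R)\<^sup>2"
      using r(3) u1 m1 by (simp add: algebra_simps)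
    obtain q where q: "R - 1 \<le> q" "q \<le> R" "\<bar>zero_log_sum q - zero_log_main q\<bar> \<le> C * (ln q)\<^sup>2"
      using ex[of "R - 1"] R by auto
    have "C * (ln q)\<^sup>2 \<le> C * (ln R)\<^sup>2" using C q R by (intro mult_left_mono power_mono) auto
    moreover have "0 \<le> C * (ln R)\<^sup>2" using C by simp
    moreover have "zero_log_sum q \<le> zero_log_sum R" "zero_log_main (R - 1) \<le> zero_log_main q"
      using q R by (auto intro!: zero_log_sum_mono zero_log_main_mono)
    ultimately have "zero_log_main R - zero_log_sum R \<le> (2 * C + 1) * (ln R)\<^sup>2"
      using q(3) m2 by (simp add: algebra_simps)
    with up show ?case by linarith
  qed
  then show ?thesis using C by (intro that[of "2 * C + 1"]) auto
qed

text \<open>The difference quotients of \<open>zero_log_sum\<close> to the left and right of \<open>R\<close> sandwich the monotone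
  function \<open>zero_count\<close>.\<close>

lemma zero_count_asymptotics:
  "eventually (\<lambda>R. \<bar>zero_count R - R / pi * (ln (R / (2 * pi)) - 1)\<bar> \<le> R powr (3/4)) at_top"
proof -
  obtain C where C: "C > 0" and ev: "eventually (\<lambda>R. \<bar>zero_log_sum R - zero_log_main R\<bar> \<le> C * (ln R)\<^sup>2) at_top"
    by (rule zero_log_sum_asymptotics)
  define a where "a = ln (2 * pi) + 2"
  define K where "K = 2 * C * pi"
  have K: "K > 0" using C by (simp add: K_def)
  \<comment> \<open>The step sqrt R balances two errors. Replacing the derivative by a quotient
    costs O(sqrt R ln R), and dividing the error ln^2 R by ln (1 + 1 / sqrt R) costs O(sqrt R ln^2
    R); both are below R^(3/4). K combines the errors at both ends, multiplied by pi to share the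
    denominator of the main term.\<close>
  have e1: "eventually (\<lambda>R. ((R + sqrt R) * (ln (R + sqrt R) - a) - R * (ln R - a) + K * (ln (R + sqrt R))\<^sup>2) / ln ((R + sqrt R) / R)
      \<le> R * (ln R - (a - 1)) + R powr (3/4)) at_top"
    using K by real_asymp
  have e2: "eventually (\<lambda>R. (R * (ln R - a) - (R - sqrt R) * (ln (R - sqrt R) - a) - K * (ln R)\<^sup>2) / ln (R / (R - sqrt R))
      \<ge> R * (ln R - (a - 1)) - R powr (3/4)) at_top"
    using K by real_asymp
  have f1: "eventually (\<lambda>R. \<bar>zero_log_sum (R + sqrt R) - zero_log_main (R + sqrt R)\<bar> \<le> C * (ln (R + sqrt R))\<^sup>2) at_top"
    by (rule eventually_compose_filterlim[OF ev]) real_asymp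
  have f2: "eventually (\<lambda>R. \<bar>zero_log_sum (R - sqrt R) - zero_log_main (R - sqrt R)\<bar> \<le> C * (ln (R - sqrt R))\<^sup>2) at_top"
    by (rule eventually_compose_filterlim[OF ev]) real_asymp
  show ?thesis
    using e1 e2 f1 f2 ev eventually_ge_at_top[of 9]
  proof eventually_elim
    case (elim R)
    have sq: "sqrt R > 0" "sqrt R * 3 \<le> R"
    proof -
      show "sqrt R > 0" using elim(6) by simp
      have "3 \<le> sqrt R" using elim(6) real_le_rsqrt[of 3 R] by simp
      then have "sqrt R * 3 \<le> sqrt R * sqrt R" using elim(6) by (intro mult_left_mono) auto
      then show "sqrt R * 3 \<le> R" using elim(6) by simp
    qed
    have alt: "zero_log_main R = (R * (ln R - (ln (2 * pi) + 2))) / pi"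
      "zero_log_main (R + sqrt R) = ((R + sqrt R) * (ln (R + sqrt R) - (ln (2 * pi) + 2))) / pi"
      "zero_log_main (R - sqrt R) = ((R - sqrt R) * (ln (R - sqrt R) - (ln (2 * pi) + 2))) / pi"
      using sq elim(6) by (intro zero_log_main_altdef; linarith)+
    define m where "m = R / pi * (ln (R / (2 * pi)) - 1)"
    have m: "m = (R * (ln R - (a - 1))) / pi" using elim(6) by (simp add: m_def a_def ln_div)
    have lnmono: "(ln R)\<^sup>2 \<le> (ln (R + sqrt R))\<^sup>2" "(ln (R - sqrt R))\<^sup>2 \<le> (ln R)\<^sup>2"
    proof -
      have "0 \<le> ln R" "0 \<le> ln (R - sqrt R)" using sq elim(6) by (auto intro!: ln_ge_zero)
      moreover have "ln R \<le> ln (R + sqrt R)" "ln (R - sqrt R) \<le> ln R"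
        using sq elim(6) by (intro ln_mono; linarith)+
      ultimately show "(ln R)\<^sup>2 \<le> (ln (R + sqrt R))\<^sup>2" "(ln (R - sqrt R))\<^sup>2 \<le> (ln R)\<^sup>2"
        by (auto intro: power_mono)
    qed
    have pw: "R powr (3/4) / pi \<le> R powr (3/4)" using pi_ge_two by (simp add: divide_le_eq mult_le_cancel_left1)
    have up: "zero_count R \<le> m + R powr (3/4)"
    proof -
      have l: "ln ((R + sqrt R) / R) > 0"
        by (rule ln_gt_zero) (use sq elim(6) in \<open>simp add: less_divide_eq\<close>)
      have "zero_count R * ln ((R + sqrt R) / R) \<le> zero_log_sum (R + sqrt R) - zero_log_sum R"
        unfolding zero_count_def using sq elim(6) by (intro zero_log_sum_diff(1)) auto
      also have "\<dots> \<le> zero_log_main (R + sqrt R) - zero_log_main R + 2 * C * (ln (R + sqrt R))\<^sup>2"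
      proof -
        have "C * (ln R)\<^sup>2 \<le> C * (ln (R + sqrt R))\<^sup>2" using C lnmono by (intro mult_left_mono) auto
        then show ?thesis using elim(3,5) by linarith
      qed
      also have "\<dots> = ((R + sqrt R) * (ln (R + sqrt R) - a) - R * (ln R - a) + K * (ln (R + sqrt R))\<^sup>2) / pi"
        unfolding alt a_def[symmetric] K_def by (simp add: add_divide_distrib diff_divide_distrib)
      finally have "zero_count R \<le> ((R + sqrt R) * (ln (R + sqrt R) - a) - R * (ln R - a) + K * (ln (R + sqrt R))\<^sup>2) / pi / ln ((R + sqrt R) / R)"
        by (rule pos_le_divide_eq[OF l, THEN iffD2])
      also have "\<dots> = ((R + sqrt R) * (ln (R + sqrt R) - a) - R * (ln R - a) + K * (ln (R + sqrt R))\<^sup>2) / ln ((R + sqrt R) / R) / pi"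
        by (simp add: mult.commute)
      also have "\<dots> \<le> (R * (ln R - (a - 1)) + R powr (3/4)) / pi" using elim(1) by (intro divide_right_mono) auto
      finally show ?thesis using pw unfolding m add_divide_distrib by linarith
    qed
    have low: "m - R powr (3/4) \<le> zero_count R"
    proof -
      have l: "ln (R / (R - sqrt R)) > 0"
        by (rule ln_gt_zero) (use sq elim(6) in \<open>simp add: less_divide_eq\<close>)
      have "(R * (ln R - a) - (R - sqrt R) * (ln (R - sqrt R) - a) - K * (ln R)\<^sup>2) / pi
          = zero_log_main R - zero_log_main (R - sqrt R) - 2 * C * (ln R)\<^sup>2"
        unfolding alt a_def[symmetric] K_def by (simp add: diff_divide_distrib)
      also have "\<dots> \<le> zero_log_sum R - zero_log_sum (R - sqrt R)"
      proof -
        have "C * (ln (R - sqrt R))\<^sup>2 \<le> C * (ln R)\<^sup>2" using C lnmono by (intro mult_left_mono) auto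
        then show ?thesis using elim(4,5) by linarith
      qed
      also have "\<dots> \<le> zero_count R * ln (R / (R - sqrt R))"
        unfolding zero_count_def using sq elim(6) by (intro zero_log_sum_diff(2)) auto
      finally have "(R * (ln R - a) - (R - sqrt R) * (ln (R - sqrt R) - a) - K * (ln R)\<^sup>2) / pi / ln (R / (R - sqrt R)) \<le> zero_count R"
        by (rule pos_divide_le_eq[OF l, THEN iffD2])
      moreover have "(R * (ln R - (a - 1)) - R powr (3/4)) / pi \<le> (R * (ln R - a) - (R - sqrt R) * (ln (R - sqrt R) - a) - K * (ln R)\<^sup>2) / ln (R / (R - sqrt R)) / pi"
        using elim(2) by (intro divide_right_mono) auto
      moreover have "(R * (ln R - a) - (R - sqrt R) * (ln (R - sqrt R) - a) - K * (ln R)\<^sup>2) / ln (R / (R - sqrt R)) / pi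
          = (R * (ln R - a) - (R - sqrt R) * (ln (R - sqrt R) - a) - K * (ln R)\<^sup>2) / pi / ln (R / (R - sqrt R))"
        by (simp add: mult.commute)
      ultimately have "(R * (ln R - (a - 1)) - R powr (3/4)) / pi \<le> zero_count R" by linarith
      then show ?thesis using pw unfolding m diff_divide_distrib by linarith
    qed
    show ?case using up low unfolding m_def by linarith
  qed
qed

section \<open>Counting by height instead of modulus\<close>

definition upper_zeros :: "real \<Rightarrow> complex set" where
  "upper_zeros T = {z. Xi z = 0 \<and> 0 < Im z \<and> Im z \<le> T}"

lemma upper_zeros_subset: "upper_zeros T \<subseteq> {z \<in> ball 0 (T + 1). Xi z = 0}"
proof
  fix z assume z: "z \<in> upper_zeros T"
  then have "cmod z \<le> 1/2 + T"
    using cmod_le[of z] Xi_zero_strip[of z] by (auto simp: upper_zeros_def)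
  then show "z \<in> {z \<in> ball 0 (T + 1). Xi z = 0}" using z by (auto simp: upper_zeros_def)
qed

lemma finite_zeros_ball_Xi: "finite {z \<in> ball 0 R. Xi z = 0}"
  by (rule finite_zeros_ball[OF Xi_holomorphic Xi_0_nonzero bounded_ball])

lemma finite_upper_zeros: "finite (upper_zeros T)"
  using finite_zeros_ball_Xi upper_zeros_subset by (rule rev_finite_subset)

lemma zeros_upto_eq: "zeros_upto T = (\<lambda>z. 1/2 + z) ` upper_zeros T"
proof (intro set_eqI iffI)
  fix s assume s: "s \<in> zeros_upto T"
  then have "Im s \<noteq> 0" "zeta s = 0" by (auto simp: zeros_upto_def nontrivial_zeros_def)
  then have "Xi (s - 1/2) = 0" using zeta_eq_0_iff by (simp add: Xi_def)
  then have "s - 1/2 \<in> upper_zeros T" using s by (auto simp: upper_zeros_def zeros_upto_def)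
  then show "s \<in> (\<lambda>z. 1/2 + z) ` upper_zeros T" by (intro image_eqI[of _ _ "s - 1/2"]) auto
next
  fix s assume "s \<in> (\<lambda>z. 1/2 + z) ` upper_zeros T"
  then obtain z where z: "s = 1/2 + z" "Xi z = 0" "0 < Im z" "Im z \<le> T" by (auto simp: upper_zeros_def)
  then have "zeta s = 0" using zeta_eq_0_iff[of s] by (simp add: Xi_def)
  moreover have "s \<notin> trivial_zeros" using z by (auto simp: trivial_zeros_def complex_eq_iff)
  moreover have "s \<noteq> 1" using z by (auto simp: complex_eq_iff)
  ultimately show "s \<in> zeros_upto T" using z by (simp add: zeros_upto_def nontrivial_zeros_def)
qed

lemma zorder_zeta_Xi: "Im z > 0 \<Longrightarrow> of_int (zorder zeta (1/2 + z)) = real (zmult Xi z)"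
  using zorder_zeta[of "1/2 + z"] zorder_Xi[of z] zorder_entire(2)[OF Xi_holomorphic Xi_0_nonzero, of z]
  by (simp add: zmult_def)

lemma N_eq: "of_int (N T) = (\<Sum>z\<in>upper_zeros T. real (zmult Xi z))"
proof -
  have "of_int (N T) = (\<Sum>z\<in>upper_zeros T. of_int (zorder zeta (1/2 + z)))"
    unfolding N_def zeros_upto_eq by (subst sum.reindex) (auto simp: inj_on_def)
  also have "\<dots> = (\<Sum>z\<in>upper_zeros T. real (zmult Xi z))"
    by (intro sum.cong refl zorder_zeta_Xi) (auto simp: upper_zeros_def)
  finally show ?thesis .
qed

lemma G_eq: "G T = (\<Sum>z\<in>upper_zeros T. real (zmult Xi z) * (1 / Im z))"
proof -
  have "G T = (\<Sum>z\<in>upper_zeros T. of_int (zorder zeta (1/2 + z)) * (1 / Im z))"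
    unfolding G_def zeros_upto_eq by (subst sum.reindex) (auto simp: inj_on_def)
  also have "\<dots> = (\<Sum>z\<in>upper_zeros T. real (zmult Xi z) * (1 / Im z))"
    by (intro sum.cong refl) (auto simp: upper_zeros_def zorder_zeta_Xi)
  finally show ?thesis .
qed

text \<open>The zeros up to height T and their negatives lie in the disc of radius T + 1, because
  |Re z| <= 1/2. Conversely the disc of radius T adds to them at most real zeros, which lie in the
  unit disc and are absorbed by the constant \<open>zero_count 1\<close>.\<close>

lemma zero_count_N:
  assumes T: "T \<ge> 1"
  shows "2 * of_int (N T) \<le> zero_count (T + 1)"
    and "zero_count T \<le> 2 * of_int (N T) + zero_count 1"
proof -
  define m where "m = (\<lambda>w. real (zmult Xi w))"
  have neg: "(\<Sum>w\<in>uminus ` A. m w) = (\<Sum>w\<in>A. m w)" for A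
    by (subst sum.reindex) (auto simp: m_def zmult_Xi_uminus)
  have NT: "of_int (N T) = (\<Sum>w\<in>upper_zeros T. m w)" by (simp add: N_eq m_def)
  have disj: "upper_zeros T \<inter> uminus ` upper_zeros T = {}" by (auto simp: upper_zeros_def)
  have fin: "finite (upper_zeros T)" "finite (uminus ` upper_zeros T)" using finite_upper_zeros by auto
  have sum2: "(\<Sum>w\<in>upper_zeros T \<union> uminus ` upper_zeros T. m w) = 2 * of_int (N T)"
    unfolding sum.union_disjoint[OF fin disj] neg NT by simp
  have "2 * of_int (N T) = (\<Sum>w\<in>upper_zeros T \<union> uminus ` upper_zeros T. m w)" using sum2 by simp
  also have "\<dots> \<le> zero_count (T + 1)"
    unfolding zero_count_def m_def[symmetric]
  proof (rule sum_mono2[OF finite_zeros_ball_Xi])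
    show "upper_zeros T \<union> uminus ` upper_zeros T \<subseteq> {z \<in> ball 0 (T + 1). Xi z = 0}"
      using upper_zeros_subset[of T] by (auto simp: Xi_even)
  qed (simp add: m_def)
  finally show "2 * of_int (N T) \<le> zero_count (T + 1)" .
  have "{z \<in> ball 0 T. Xi z = 0} \<subseteq> (upper_zeros T \<union> uminus ` upper_zeros T) \<union> {z \<in> ball 0 1. Xi z = 0}"
  proof
    fix z assume z: "z \<in> {z \<in> ball 0 T. Xi z = 0}"
    have "\<bar>Im z\<bar> \<le> T" using z abs_Im_le_cmod[of z] by auto
    consider "Im z > 0" | "Im z < 0" | "Im z = 0" by linarith
    then show "z \<in> (upper_zeros T \<union> uminus ` upper_zeros T) \<union> {z \<in> ball 0 1. Xi z = 0}"
    proof cases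
      case 1
      then show ?thesis using z \<open>\<bar>Im z\<bar> \<le> T\<close> by (auto simp: upper_zeros_def)
    next
      case 2
      then have "- z \<in> upper_zeros T" using z \<open>\<bar>Im z\<bar> \<le> T\<close> by (auto simp: upper_zeros_def Xi_even)
      then have "- (- z) \<in> uminus ` upper_zeros T" by (rule imageI)
      then show ?thesis by simp
    next
      case 3
      then show ?thesis using z cmod_le[of z] Xi_zero_strip[of z] by auto
    qed
  qed
  then have "zero_count T \<le> (\<Sum>w\<in>(upper_zeros T \<union> uminus ` upper_zeros T) \<union> {z \<in> ball 0 1. Xi z = 0}. m w)"
    unfolding zero_count_def m_def[symmetric] using fin finite_zeros_ball_Xi
    by (intro sum_mono2) (auto simp: m_def)
  also have "\<dots> \<le> (\<Sum>w\<in>upper_zeros T \<union> uminus ` upper_zeros T. m w) + (\<Sum>w\<in>{z \<in> ball 0 1. Xi z = 0}. m w)"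
    using fin finite_zeros_ball_Xi by (subst sum_Un) (auto simp: m_def intro!: sum_nonneg)
  finally show "zero_count T \<le> 2 * of_int (N T) + zero_count 1"
    unfolding sum2 by (simp add: zero_count_def m_def)
qed

text \<open>The shift from T to T + 1 costs O(ln T); this, the constants and the error T^(3/4) all
  fit below T^(4/5).\<close>

lemma Q_bound: "eventually (\<lambda>T. \<bar>Q T\<bar> \<le> T powr (4/5)) at_top"
proof -
  define K where "K = zero_count 1"
  have e1: "eventually (\<lambda>T::real. ((T + 1) / pi * (ln ((T + 1) / (2 * pi)) - 1) + (T + 1) powr (3/4)) / 2
     \<le> T / (2 * pi) * (ln (T / (2 * pi)) - 1) + 7 / 8 + T powr (4/5)) at_top" by real_asymp
  have e2: "eventually (\<lambda>T. (T / pi * (ln (T / (2 * pi)) - 1) - T powr (3/4) - K) / 2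
     \<ge> T / (2 * pi) * (ln (T / (2 * pi)) - 1) + 7 / 8 - T powr (4/5)) at_top" by real_asymp
  have f: "eventually (\<lambda>T. \<bar>zero_count (T + 1) - (T + 1) / pi * (ln ((T + 1) / (2 * pi)) - 1)\<bar> \<le> (T + 1) powr (3/4)) at_top"
    by (rule eventually_compose_filterlim[OF zero_count_asymptotics]) real_asymp
  have gen1: "n \<le> Y" if "2 * n \<le> c" "(x + p) / 2 \<le> Y" "\<bar>c - x\<bar> \<le> p" for n c x p Y :: real
    using that by (auto simp: field_simps abs_le_iff)
  have gen2: "Y \<le> n" if "c \<le> 2 * n + k" "Y \<le> (x - p - k) / 2" "\<bar>c - x\<bar> \<le> p" for n c x p Y k :: real
    using that by (auto simp: field_simps abs_le_iff)
  show ?thesis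
    using e1 e2 f zero_count_asymptotics eventually_ge_at_top[of 1]
  proof eventually_elim
    case (elim T)
    have "of_int (N T) \<le> T / (2 * pi) * (ln (T / (2 * pi)) - 1) + 7 / 8 + T powr (4/5)"
      by (rule gen1[OF zero_count_N(1)[OF elim(5)] elim(1,3)])
    moreover have "T / (2 * pi) * (ln (T / (2 * pi)) - 1) + 7 / 8 - T powr (4/5) \<le> of_int (N T)"
      by (rule gen2[OF zero_count_N(2)[OF elim(5)] elim(2)[unfolded K_def] elim(4)])
    moreover have "\<bar>n - l\<bar> \<le> e" if "n \<le> l + e" "l - e \<le> n" for n l e :: real using that by linarith
    ultimately show ?case unfolding Q_def L_def by blast
  qed
qed

section \<open>The lowest zero\<close>

lemma DERIV_prod_linear_powers:
  fixes m :: "complex \<Rightarrow> nat"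
  assumes "finite S" "z \<notin> S"
  shows "((\<lambda>z. \<Prod>w\<in>S. (z - w) ^ m w) has_field_derivative
     (\<Prod>w\<in>S. (z - w) ^ m w) * (\<Sum>w\<in>S. of_nat (m w) / (z - w))) (at z)"
  using assms
proof (induction S rule: finite_induct)
  case (insert w S)
  have zw: "z - w \<noteq> 0" using insert.prems by auto
  have "((\<lambda>z. (z - w) ^ m w) has_field_derivative (z - w) ^ m w * (of_nat (m w) / (z - w))) (at z)"
  proof (cases "m w")
    case (Suc k)
    have "((\<lambda>z. (z - w) ^ Suc k) has_field_derivative of_nat (Suc k) * (z - w) ^ k) (at z)"
      by (auto intro!: derivative_eq_intros simp del: power_Suc)
    moreover have "(z - w) ^ Suc k * (of_nat (Suc k) / (z - w)) = of_nat (Suc k) * (z - w) ^ k"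
      using zw by (simp del: of_nat_Suc)
    ultimately show ?thesis using Suc by simp
  qed simp
  from DERIV_mult[OF this insert.IH] insert.prems
  have "((\<lambda>z. (z - w) ^ m w * (\<Prod>w\<in>S. (z - w) ^ m w)) has_field_derivative
     (z - w) ^ m w * (of_nat (m w) / (z - w)) * (\<Prod>w\<in>S. (z - w) ^ m w)
     + (\<Prod>w\<in>S. (z - w) ^ m w) * (\<Sum>w\<in>S. of_nat (m w) / (z - w)) * (z - w) ^ m w) (at z)"
    by simp
  then show ?case using insert.hyps by (simp add: algebra_simps)
qed simp

text \<open>The logarithmic derivative of an even entire function is the sum of its principal parts plus
  a remainder that vanishes at \<open>0\<close>; its derivative is controlled by Borel--Caratheodory.\<close>

lemma log_deriv_approximation:
  fixes f :: "complex \<Rightarrow> complex"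
  assumes f: "f holomorphic_on UNIV" and f0: "f 0 \<noteq> 0" and even: "\<And>z. f (- z) = f z"
    and mult_even: "\<And>z. zmult f (- z) = zmult f z"
    and r: "8 \<le> r" and sph: "\<And>z. cmod z = r \<Longrightarrow> f z \<noteq> 0"
    and A: "\<And>z. cmod z \<le> r \<Longrightarrow> cmod (f z) \<le> exp A" and u: "cmod u \<le> 1/2" "f u \<noteq> 0"
  defines "S \<equiv> {z \<in> ball 0 r. f z = 0}"
  defines "B \<equiv> 2 * (A - ln (cmod (f 0)) + (\<Sum>w\<in>S. real (zmult f w)) * ln r)"
  shows "cmod (deriv f u / f u - (\<Sum>w\<in>S. of_nat (zmult f w) / (u - w))) \<le> 64 * (B + 1) / r\<^sup>2"
proof -
  have rpos: "r > 0" using r by simp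
  have fin: "finite S" unfolding S_def by (rule finite_zeros_ball[OF f f0 bounded_ball])
  define m where "m = zmult f"
  obtain r' F where F: "r' > r" "F holomorphic_on ball 0 r'" "\<And>z. z \<in> ball 0 r' \<Longrightarrow> F z \<noteq> 0"
    "\<And>z. z \<in> cball 0 r \<Longrightarrow> f z = F z * (\<Prod>w\<in>{z \<in> ball 0 r. f z = 0}.
       (of_real r * (z - w) / ((of_real r)\<^sup>2 - cnj w * z)) ^ zmult f w)"
    "\<And>z. cmod z = r \<Longrightarrow> cmod (F z) = cmod (f z)"
    "ln (cmod (F 0)) = ln (cmod (f 0)) + (\<Sum>w\<in>{z \<in> ball 0 r. f z = 0}. real (zmult f w) * ln (r / cmod w))"
    by (rule blaschke_factorization[OF f f0 rpos]) (erule sph, rule that)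
  define P where "P = (\<lambda>z. \<Prod>w\<in>S. (z - w) ^ m w)"
  define q where "q = (\<lambda>z. \<Prod>w\<in>S. (of_real r / ((of_real r)\<^sup>2 - cnj w * z)) ^ m w)"
  \<comment> \<open>Here f = P g with P the plain polynomial of the zeros: the Blaschke denominators
    go into g, so that the logarithmic derivative of P is the sum of principal parts of f.\<close>
  define g where "g = (\<lambda>z. F z * q z)"
  have den: "(of_real r)\<^sup>2 - cnj w * z \<noteq> 0" if "w \<in> S" "cmod z \<le> r" for w z
    using blaschke_denominator_nonzero[of z r w] that by (simp add: S_def)
  have fPg: "f z = P z * g z" if "cmod z \<le> r" for z
    using F(4)[of z] that unfolding S_def[symmetric] m_def[symmetric]
    by (simp add: P_def g_def q_def power_mult_distrib power_divide prod.distrib prod_dividef mult_ac)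
  have gholo: "g holomorphic_on ball 0 r"
    unfolding g_def q_def using den F(1)
    by (intro holomorphic_intros holomorphic_on_subset[OF F(2)]) auto
  have gne: "g z \<noteq> 0" if "z \<in> ball 0 r" for z
    using F(1) F(3)[of z] den that fin rpos by (auto simp: g_def q_def)
  obtain h where h: "h holomorphic_on ball 0 r" "\<And>z. z \<in> ball 0 r \<Longrightarrow> exp (h z) = g z"
    using holomorphic_logarithm_exists[OF convex_ball open_ball gholo gne, of 0] rpos by auto
  have Re_h: "Re (h z) = ln (cmod (g z))" if "z \<in> ball 0 r" for z
    using h(2)[OF that, symmetric] by simp
  have FA: "cmod (F z) \<le> exp A" if "z \<in> ball 0 r" for z
  proof (rule maximum_modulus_frontier[of F "ball 0 r"])
    show "F holomorphic_on interior (ball 0 r)" using F(1) by (auto intro: holomorphic_on_subset[OF F(2)])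
    show "continuous_on (closure (ball 0 r)) F" using F(1) rpos
      by (intro holomorphic_on_imp_continuous_on holomorphic_on_subset[OF F(2)]) auto
    show "cmod (F z) \<le> exp A" if "z \<in> frontier (ball 0 r)" for z
      using that rpos F(5)[of z] A[of z] by (simp add: frontier_ball)
  qed (use that in auto)
  \<comment> \<open>For |z| <= r/2 each denominator is at least r^2/2, which is at least r since r
    >= 8.\<close>
  have q1: "cmod (q z) \<le> 1" if "cmod z \<le> r / 2" for z
  proof -
    have "cmod (of_real r / ((of_real r)\<^sup>2 - cnj w * z)) \<le> 1" if w: "w \<in> S" for w
    proof -
      have "cmod (cnj w * z) \<le> r * (r / 2)"
        using w rpos \<open>cmod z \<le> r / 2\<close> unfolding norm_mult by (intro mult_mono) (auto simp: S_def)
      moreover have "cmod ((of_real r)\<^sup>2) = r * r" by (simp add: power2_eq_square norm_mult)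
      ultimately have "r * r - r * (r / 2) \<le> cmod ((of_real r)\<^sup>2 - cnj w * z)"
        using norm_triangle_ineq2[of "(of_real r)\<^sup>2" "cnj w * z"] by linarith
      moreover have "r * 8 \<le> r * r" using r by (intro mult_left_mono) auto
      moreover have "r * (r / 2) = r * r / 2" by simp
      ultimately have "r \<le> cmod ((of_real r)\<^sup>2 - cnj w * z)" using r by linarith
      then show ?thesis using rpos by (simp add: norm_divide divide_le_eq)
    qed
    then show ?thesis unfolding q_def prod_norm[symmetric] norm_power
      by (intro prod_le_1) (auto intro: power_le_one)
  qed
  have hA: "Re (h z) \<le> A" if "z \<in> ball 0 (r / 2)" for z
  proof -
    have z: "z \<in> ball 0 r" using that rpos by auto
    have "cmod (g z) \<le> exp A * 1"
      unfolding g_def norm_mult using FA[OF z] q1[of z] that by (intro mult_mono) auto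
    then show ?thesis using Re_h[OF z] gne[OF z] ln_le_cancel_iff[of "cmod (g z)" "exp A"] by simp
  qed
  have h0: "Re (h 0) \<ge> ln (cmod (f 0)) - (\<Sum>w\<in>S. real (m w)) * ln r"
  proof -
    have w0: "w \<noteq> 0" "cmod w < r" if "w \<in> S" for w using that f0 by (auto simp: S_def)
    have "cmod (P 0) = (\<Prod>w\<in>S. cmod w ^ m w)" by (simp add: P_def prod_norm[symmetric] norm_power)
    moreover have "ln (\<Prod>w\<in>S. cmod w ^ m w) = (\<Sum>w\<in>S. real (m w) * ln (cmod w))"
      using w0 by (subst ln_prod) (auto simp: ln_realpow fin)
    ultimately have "ln (cmod (P 0)) = (\<Sum>w\<in>S. real (m w) * ln (cmod w))" by simp
    also have "\<dots> \<le> (\<Sum>w\<in>S. real (m w)) * ln r"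
      unfolding sum_distrib_right
    proof (intro sum_mono mult_left_mono)
      fix w assume "w \<in> S"
      then show "ln (cmod w) \<le> ln r" using w0[of w] by (intro ln_mono) auto
    qed simp
    finally have lnP: "ln (cmod (P 0)) \<le> (\<Sum>w\<in>S. real (m w)) * ln r" .
    have "P 0 \<noteq> 0" using fPg[of 0] f0 rpos by auto
    then have "ln (cmod (f 0)) = ln (cmod (P 0)) + ln (cmod (g 0))"
      using fPg[of 0] gne[of 0] rpos by (simp add: norm_mult ln_mult_pos)
    then show ?thesis using Re_h[of 0] rpos lnP by simp
  qed
  have hB: "cmod (h z - h 0) \<le> B" if z: "cmod z \<le> r / 4" for z
  proof -
    have "h holomorphic_on ball 0 (r / 2)" by (rule holomorphic_on_subset[OF h(1)]) (use rpos in auto)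
    then have "cmod (h z - h 0) \<le> 2 * (A - Re (h 0)) * cmod z / (r / 2 - cmod z)"
      by (rule borel_caratheodory[OF _ hA]) (use z rpos in auto)
    also have "\<dots> = 2 * (A - Re (h 0)) * (cmod z / (r / 2 - cmod z))" by simp
    also have "\<dots> \<le> 2 * (A - Re (h 0)) * 1"
      using hA[of 0] rpos z by (intro mult_left_mono) (auto simp: divide_le_eq)
    also have "\<dots> \<le> B" using h0 unfolding B_def m_def by simp
    finally show ?thesis .
  qed
  have h'holo: "deriv h holomorphic_on ball 0 r" by (rule holomorphic_deriv[OF h(1) open_ball])
  have h2: "cmod (deriv (deriv h) z) \<le> 128 * (B + 1) / r\<^sup>2" if z: "cmod z \<le> 1/2" for z
  proof -
    have sub: "cball z (r / 8) \<subseteq> cball 0 (r / 4)"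
    proof
      fix x assume "x \<in> cball z (r / 8)"
      then have "cmod x \<le> r / 8 + 1/2" using z norm_triangle_ineq2[of x z] by (simp add: dist_norm norm_minus_commute)
      then show "x \<in> cball 0 (r / 4)" using r by simp
    qed
    have sub': "cball 0 (r / 4) \<subseteq> ball (0::complex) r" using rpos by auto
    \<comment> \<open>Cauchy's estimate on the disc of radius r/8 about z, contained in |x| <= r/4
      because 1/2 <= r/8. The value B + 1 provides an open ball around h 0 for a non-strict bound
      B.\<close>
    have "cmod ((deriv ^^ 2) h z) \<le> fact 2 * (B + 1) / (r / 8) ^ 2"
    proof (rule Cauchy_higher_deriv_bound)
      show "h holomorphic_on ball z (r / 8)"
        by (rule holomorphic_on_subset[OF h(1)]) (use sub sub' ball_subset_cball in blast)
      show "continuous_on (cball z (r / 8)) h"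
        by (rule holomorphic_on_imp_continuous_on[OF holomorphic_on_subset[OF h(1)]]) (use sub sub' in blast)
      show "h x \<in> ball (h 0) (B + 1)" if "x \<in> ball z (r / 8)" for x
      proof -
        have "x \<in> cball 0 (r / 4)" using that sub ball_subset_cball[of z "r / 8"] by blast
        then have "cmod x \<le> r / 4" by simp
        then show ?thesis using hB[of x] by (simp add: dist_norm norm_minus_commute)
      qed
    qed (use rpos in auto)
    then show ?thesis by (simp add: eval_nat_numeral field_simps)
  qed
  have dh: "cmod (deriv h u - deriv h 0) \<le> 64 * (B + 1) / r\<^sup>2"
  proof -
    have "cmod (deriv h u - deriv h 0) \<le> 128 * (B + 1) / r\<^sup>2 * cmod (u - 0)"
    proof (rule field_differentiable_bound[of "cball 0 (1/2)"])
      fix x :: complex assume x: "x \<in> cball 0 (1/2)"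
      then have "x \<in> ball 0 r" using r by auto
      then show "(deriv h has_field_derivative deriv (deriv h) x) (at x within cball 0 (1/2))"
        by (intro has_field_derivative_at_within[OF holomorphic_derivI[OF h'holo open_ball]])
      show "cmod (deriv (deriv h) x) \<le> 128 * (B + 1) / r\<^sup>2" using h2 x by simp
    qed (use u in auto)
    also have "\<dots> \<le> 128 * (B + 1) / r\<^sup>2 * (1/2)"
    proof (rule mult_left_mono)
      show "0 \<le> 128 * (B + 1) / r\<^sup>2" using order_trans[OF norm_ge_zero h2[of 0]] by simp
    qed (use u in simp)
    also have "\<dots> = 64 * (B + 1) / r\<^sup>2" using rpos by (simp add: field_simps)
    finally show ?thesis .
  qed
  have ld: "deriv f z / f z = (\<Sum>w\<in>S. of_nat (m w) / (z - w)) + deriv h z" if z: "cmod z \<le> 1/2" "f z \<noteq> 0" for z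
  proof -
    have zb: "z \<in> ball 0 r" using z r by simp
    have zS: "z \<notin> S" using z by (simp add: S_def)
    have "((\<lambda>z. P z * exp (h z)) has_field_derivative
        P z * (\<Sum>w\<in>S. of_nat (m w) / (z - w)) * exp (h z) + exp (h z) * deriv h z * P z) (at z)"
      unfolding P_def
      by (intro DERIV_mult DERIV_prod_linear_powers[OF fin zS] DERIV_chain2[OF DERIV_exp] holomorphic_derivI[OF h(1) open_ball zb])
    moreover have "(f has_field_derivative D) (at z)" if "((\<lambda>z. P z * exp (h z)) has_field_derivative D) (at z)" for D
      by (rule has_field_derivative_transform_within_open[OF that open_ball zb])
         (use fPg h(2) in auto)
    ultimately have "deriv f z = P z * (\<Sum>w\<in>S. of_nat (m w) / (z - w)) * exp (h z) + exp (h z) * deriv h z * P z"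
      by (intro DERIV_imp_deriv) blast
    moreover have "f z = P z * exp (h z)" using fPg[of z] h(2)[OF zb] zb by simp
    moreover have "P z * exp (h z) \<noteq> 0" using z(2) calculation(2) by simp
    ultimately show ?thesis by (simp add: field_simps)
  qed
  \<comment> \<open>Evenness: f' vanishes at 0, and the principal parts at w and - w cancel there.
    So h' at u is controlled by the second derivative of h, which is the source of the decay
    \<open>1 / r\<^sup>2\<close>.\<close>
  have "deriv h 0 = 0"
  proof -
    have "(f has_field_derivative deriv f 0) (at 0)" by (rule holomorphic_derivI[OF f open_UNIV UNIV_I])
    then have "((\<lambda>z. f (- z)) has_field_derivative deriv f 0 * - 1) (at 0)"
      by (intro DERIV_chain2[of f _ uminus]) (auto intro!: derivative_eq_intros)
    then have "(f has_field_derivative deriv f 0 * - 1) (at 0)" by (simp add: even)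
    then have "deriv f 0 = deriv f 0 * - 1" by (rule DERIV_imp_deriv)
    then have df0: "deriv f 0 = 0" by simp
    have "(\<Sum>w\<in>S. of_nat (m w) / (0 - w)) = (\<Sum>w\<in>uminus ` S. of_nat (m w) / (0 - w))"
    proof -
      have "uminus ` S = S"
      proof
        show "uminus ` S \<subseteq> S" by (auto simp: S_def even)
        show "S \<subseteq> uminus ` S"
        proof
          fix w assume "w \<in> S"
          then have "- w \<in> S" by (auto simp: S_def even)
          then have "- (- w) \<in> uminus ` S" by (rule imageI)
          then show "w \<in> uminus ` S" by simp
        qed
      qed
      then show ?thesis by simp
    qed
    also have "\<dots> = (\<Sum>w\<in>S. - (of_nat (m w) / (0 - w)))"
      by (subst sum.reindex) (auto simp: m_def mult_even intro!: sum.cong)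
    also have "\<dots> = - (\<Sum>w\<in>S. of_nat (m w) / (0 - w))" by (rule sum_negf)
    finally have "(\<Sum>w\<in>S. of_nat (m w) / (0 - w)) = 0" by simp
    then show ?thesis using ld[of 0] f0 df0 by simp
  qed
  then show ?thesis using dh ld[OF u] unfolding m_def by simp
qed

lemma first_zero_numerics:
  "1 + euler_mascheroni / 2 - ln 2 - ln pi / 2 < 1 / (1 + (2 * pi)\<^sup>2)"
proof -
  have l2: "ln (2::real) \<ge> 69313/100000"
    using ln_approx_bounds[of 2 4] by (simp add: eval_nat_numeral)
  have l157: "ln (157/100 :: real) \<ge> 45106/100000"
    using ln_approx_bounds[of "157/100" 3] by (simp add: eval_nat_numeral)
  \<comment> \<open>The index 15 is taken because ln 16 = 4 ln 2, so the bound for Euler's constant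
    involves only ln 2; likewise pi is compared with 2 * 1.57.\<close>
  have "(euler_mascheroni :: real) \<le> harm 15 - ln (real (Suc 15)) + inverse (real (2 * 15))"
    using euler_mascheroni_bounds[of 15] by simp
  also have "ln (real (Suc 15)) = 4 * ln 2"
    using ln_realpow[of 2 4] by simp
  also have "harm 15 = (1195757/360360 :: real)" by (simp add: harm_expand)
  finally have eg: "(euler_mascheroni :: real) \<le> 1195757/360360 - 4 * ln 2 + 1/30" by simp
  have "ln pi \<ge> ln (2 * (157/100))"
    using pi_approx(1) by (intro ln_mono) auto
  then have lp: "ln pi \<ge> ln 2 + ln (157/100)" by (simp only: ln_mult_pos)
  have "(2 * pi)\<^sup>2 \<le> (2 * 3.1416)\<^sup>2" using pi_approx(2) pi_gt_zero by (intro power_mono) auto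
  then have "1 / (1 + (2 * 3.1416)\<^sup>2) \<le> 1 / (1 + (2 * pi)\<^sup>2)"
    by (intro divide_left_mono mult_pos_pos add_pos_nonneg) auto
  moreover have "1 + (1195757/360360 + 1/30) / 2 - 7/2 * (69313/100000) - 1/2 * (45106/100000) < 1 / (1 + (2 * 3.1416)\<^sup>2 :: real)"
    by (simp add: power2_eq_square)
  moreover have "1 + euler_mascheroni / 2 - ln 2 - ln pi / 2 \<le> 1 + (1195757/360360 + 1/30) / 2 - 7/2 * (69313/100000) - 1/2 * (45106/100000)"
    using eg lp l2 l157 by (simp add: field_simps)
  ultimately show ?thesis by linarith
qed

text \<open>The point 1/2 is s = 1, where \<open>zeta_reg\<close> has value 1 and derivative gamma.
  The power of pi contributes - ln pi / 2, and the Gamma factor half of Digamma (3/2) = 2 - gamma -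
  2 ln 2.\<close>

lemma Xi_log_deriv_half: "Xi (1/2) \<noteq> 0" "deriv Xi (1/2) / Xi (1/2) = of_real (1 + euler_mascheroni / 2 - ln 2 - ln pi / 2)"
proof -
  define E where "E = (\<lambda>z. zeta_reg (1/2 + z) * exp (- (1/2 + z) / 2 * of_real (ln pi)) * Gamma ((1/2 + z) / 2 + 1))"
  have XE: "Xi z = E z" if "Re z > -1" for z
    using that by (simp add: Xi_def xi_eq_xi_half xi_half_def E_def powr_def Ln_of_real)
  have half: "(1/2 + 1/2 :: complex) = 1" "(1::complex) / 2 + 1 = of_real (3/2)" by simp_all
  have nI: "complex_of_real (3/2) \<notin> \<int>\<^sub>\<le>\<^sub>0" by (auto elim!: nonpos_Ints_cases simp: complex_eq_iff)
  have G: "Gamma (complex_of_real (3/2)) \<noteq> 0" using nI by (rule Gamma_nonzero)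
  have E1: "E (1/2) = exp (- 1 / 2 * of_real (ln pi)) * Gamma (of_real (3/2))"
    unfolding E_def half by simp
  then have E0: "E (1/2) \<noteq> 0" using G by simp
  show "Xi (1/2) \<noteq> 0" using XE[of "1/2"] E0 by simp
  have sh: "((\<lambda>z. 1/2 + z) has_field_derivative 1) (at (1/2 :: complex))"
    by (auto intro!: derivative_eq_intros)
  have "(zeta_reg has_field_derivative euler_mascheroni) (at (1/2 + 1/2))"
    using holomorphic_derivI[OF zeta_reg_holomorphic open_halfplane_Re, of 1] zeta_reg_deriv_1 by simp
  then have d1: "((\<lambda>z. zeta_reg (1/2 + z)) has_field_derivative euler_mascheroni) (at (1/2))"
    using DERIV_chain2[OF _ sh] by fastforce
  have d2: "((\<lambda>z. exp (- (1/2 + z) / 2 * of_real (ln pi))) has_field_derivative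
      exp (- 1 / 2 * of_real (ln pi)) * (- of_real (ln pi) / 2)) (at (1/2))"
    by (auto intro!: derivative_eq_intros)
  have sh3: "((\<lambda>z. (1/2 + z) / 2 + 1) has_field_derivative 1/2) (at (1/2 :: complex))"
    by (auto intro!: derivative_eq_intros)
  have "(Gamma has_field_derivative Gamma (of_real (3/2)) * Digamma (of_real (3/2))) (at ((1/2 + 1/2) / 2 + 1 :: complex))"
    using has_field_derivative_Gamma[OF nI] unfolding half by simp
  then have d3: "((\<lambda>z. Gamma ((1/2 + z) / 2 + 1)) has_field_derivative Gamma (of_real (3/2)) * Digamma (of_real (3/2)) * (1/2)) (at (1/2 :: complex))"
    by (rule DERIV_chain2[OF _ sh3])
  have "(E has_field_derivative (euler_mascheroni * exp (- (1/2 + 1/2) / 2 * of_real (ln pi)) + exp (- 1 / 2 * of_real (ln pi)) * (- of_real (ln pi) / 2) * zeta_reg (1/2 + 1/2)) * Gamma ((1/2 + 1/2) / 2 + 1)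
      + Gamma (of_real (3/2)) * Digamma (of_real (3/2)) * (1/2) * (zeta_reg (1/2 + 1/2) * exp (- (1/2 + 1/2) / 2 * of_real (ln pi)))) (at (1/2))"
    unfolding E_def by (intro DERIV_mult d1 d2 d3)
  then have dE: "(E has_field_derivative E (1/2) * (euler_mascheroni - of_real (ln pi) / 2 + Digamma (of_real (3/2)) / 2)) (at (1/2))"
    by (rule DERIV_cong) (unfold E1 half, simp add: algebra_simps)
  have "(Xi has_field_derivative E (1/2) * (euler_mascheroni - of_real (ln pi) / 2 + Digamma (of_real (3/2)) / 2)) (at (1/2))"
    by (rule has_field_derivative_transform_within_open[OF dE open_halfspace_Re_gt[of "-1"]]) (auto simp: XE)
  then have "deriv Xi (1/2) = E (1/2) * (euler_mascheroni - of_real (ln pi) / 2 + Digamma (of_real (3/2)) / 2)"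
    by (rule DERIV_imp_deriv)
  then have "deriv Xi (1/2) / Xi (1/2) = euler_mascheroni - of_real (ln pi) / 2 + Digamma (of_real (3/2)) / 2"
    using E0 XE[of "1/2"] by simp
  also have "Digamma (complex_of_real (3/2)) = 2 - euler_mascheroni - of_real (2 * ln 2)"
    using Digamma_plus1[of "1/2 :: complex"] Digamma_one_half[where 'a = complex] by simp
  finally show "deriv Xi (1/2) / Xi (1/2) = of_real (1 + euler_mascheroni / 2 - ln 2 - ln pi / 2)"
    by (simp add: field_simps)
qed

lemma Im_Xi_zero_gt:
  assumes z: "Xi z = 0" "Im z > 0"
  shows "Im z > 2 * pi"
proof (rule ccontr)
  assume "\<not> Im z > 2 * pi"
  then have le: "Im z \<le> 2 * pi" by simp
  define c0 where "c0 = ln (cmod (Xi 0))"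
  define D where "D = 1 + euler_mascheroni / 2 - ln 2 - ln pi / 2"
  \<comment> \<open>The numerical margin. The disc will be so large that the remainder of the
    truncated sum over zeros is below it.\<close>
  define e where "e = 1 / (1 + (2 * pi)\<^sup>2) - D"
  have e: "e > 0" using first_zero_numerics by (simp add: e_def D_def)
  \<comment> \<open>The error of \<open>log_deriv_approximation\<close> with the growth bound for A
    and the count of zeros inserted; it is O(ln^2 R / R).\<close>
  define E where "E = (\<lambda>R. 64 * (2 * (10 * (R + 1) * ln (R + 1) - c0 + ((10 * (3 * (R + 1)) * ln (3 * (R + 1)) - c0) / ln 2) * ln (R + 1)) + 1) / R\<^sup>2)"
  have "(E \<longlongrightarrow> 0) at_top" unfolding E_def by real_asymp
  then have "eventually (\<lambda>R. dist (E R) 0 < e) at_top" using e by (rule tendstoD)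
  then have "eventually (\<lambda>R. dist (E R) 0 < e \<and> R \<ge> 8 \<and> R > cmod z) at_top"
    by (intro eventually_conj eventually_ge_at_top eventually_gt_at_top)
  then obtain R where R: "dist (E R) 0 < e" "R \<ge> 8" "R > cmod z"
    by (auto simp: eventually_at_top_linorder)
  obtain r where r: "R < r" "r < R + 1" and sph: "\<And>z. cmod z = r \<Longrightarrow> Xi z \<noteq> 0"
    using exists_zero_free_radius[OF Xi_holomorphic Xi_0_nonzero, of R "R + 1"] by auto
  define S where "S = {z \<in> ball 0 r. Xi z = 0}"
  define A where "A = 10 * (R + 1) * ln (R + 1)"
  have fin: "finite S" unfolding S_def by (rule finite_zeros_ball_Xi)
  have ub: "cmod (Xi v) \<le> exp A" if "cmod v \<le> r" for v
    unfolding A_def by (rule Xi_upper_bound) (use R r that in auto)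
  define n where "n = (\<Sum>w\<in>S. real (zmult Xi w))"
  have n: "n \<le> (10 * (3 * (R + 1)) * ln (3 * (R + 1)) - c0) / ln 2"
  proof -
    have "n \<le> (\<Sum>w\<in>{z \<in> ball 0 (R + 1). Xi z = 0}. real (zmult Xi w))"
      unfolding n_def S_def using r by (intro sum_mono2 finite_zeros_ball_Xi) auto
    also have "\<dots> \<le> (10 * (3 * (R + 1)) * ln (3 * (R + 1)) - c0) / ln 2"
    proof -
      have "(\<Sum>w\<in>{z \<in> ball 0 (R + 1). Xi z = 0}. real (zmult Xi w)) * ln 2 \<le> 10 * (3 * (R + 1)) * ln (3 * (R + 1)) - ln (cmod (Xi 0))"
        by (rule log_bound_imp_zero_count[OF Xi_holomorphic Xi_0_nonzero _ Xi_upper_bound]) (use R in simp_all)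
      then show ?thesis by (simp add: c0_def pos_le_divide_eq)
    qed
    finally show ?thesis .
  qed
  have "cmod (deriv Xi (1/2) / Xi (1/2) - (\<Sum>w\<in>S. of_nat (zmult Xi w) / (1/2 - w))) \<le> 64 * (2 * (A - c0 + n * ln r) + 1) / r\<^sup>2"
    unfolding S_def n_def c0_def
    by (rule log_deriv_approximation[OF Xi_holomorphic Xi_0_nonzero Xi_even zmult_Xi_uminus _ sph ub _ Xi_log_deriv_half(1)])
       (use R r in auto)
  also have "\<dots> \<le> E R"
  proof -
    have n0: "n \<ge> 0" unfolding n_def by (intro sum_nonneg) simp
    have "n * ln r \<le> (10 * (3 * (R + 1)) * ln (3 * (R + 1)) - c0) / ln 2 * ln (R + 1)"
      using n n0 R r by (intro mult_mono) auto
    then have b: "64 * (2 * (A - c0 + n * ln r) + 1) \<le> 64 * (2 * (10 * (R + 1) * ln (R + 1) - c0 + ((10 * (3 * (R + 1)) * ln (3 * (R + 1)) - c0) / ln 2) * ln (R + 1)) + 1)"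
      unfolding A_def by simp
    have "Xi 0 \<noteq> 0" by (rule Xi_0_nonzero)
    then have "c0 \<le> A" using ub[of 0] r R ln_le_cancel_iff[of "cmod (Xi 0)" "exp A"] by (simp add: c0_def)
    then have "0 \<le> 64 * (2 * (A - c0 + n * ln r) + 1)" using n0 R r by simp
    then have "64 * (2 * (A - c0 + n * ln r) + 1) / r\<^sup>2 \<le> 64 * (2 * (A - c0 + n * ln r) + 1) / R\<^sup>2"
      using R r by (intro divide_left_mono power_mono mult_pos_pos) auto
    also have "\<dots> \<le> E R" unfolding E_def using b by (intro divide_right_mono) auto
    finally show ?thesis .
  qed
  also have "\<dots> < e" using R(1) by (simp add: dist_real_def)
  finally have close: "cmod (of_real D - (\<Sum>w\<in>S. of_nat (zmult Xi w) / (1/2 - w))) < e"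
    unfolding Xi_log_deriv_half(2) D_def .
  \<comment> \<open>The point 1/2 is on the right edge of the closed strip, so every term has
    nonnegative real part and zeros other than z and - z may be dropped.\<close>
  have term_nonneg: "Re (of_nat (zmult Xi w) / (1/2 - w)) \<ge> 0" if "w \<in> S" for w
  proof -
    have "Re w \<le> 1/2" using Xi_zero_strip[of w] that by (auto simp: S_def)
    then show ?thesis by (simp add: Re_divide)
  qed
  have zS: "z \<in> S" "- z \<in> S" "z \<noteq> - z"
    using z R(3) r by (auto simp: S_def Xi_even complex_eq_iff)
  have rez: "\<bar>Re z\<bar> \<le> 1/2" by (rule Xi_zero_strip[OF z(1)])
  have term_ge: "Re (of_nat (zmult Xi w) / (1/2 - w)) \<ge> (1/2 - Re w) / (1 + (2 * pi)\<^sup>2)"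
    if w: "Xi w = 0" "\<bar>Im w\<bar> \<le> 2 * pi" "Im w \<noteq> 0" for w
  proof -
    have rw: "\<bar>Re w\<bar> \<le> 1/2" by (rule Xi_zero_strip[OF w(1)])
    have m1: "1 \<le> real (zmult Xi w)" by (rule zmult_ge_1[OF Xi_holomorphic Xi_0_nonzero w(1)])
    have "(1/2 - Re w)\<^sup>2 \<le> 1\<^sup>2" using rw by (intro power_mono) auto
    moreover have "(Im w)\<^sup>2 \<le> (2 * pi)\<^sup>2" using w(2) by (metis abs_ge_zero power2_abs power_mono)
    ultimately have d: "(1/2 - Re w)\<^sup>2 + (Im w)\<^sup>2 \<le> 1 + (2 * pi)\<^sup>2" by simp
    have dpos: "(1/2 - Re w)\<^sup>2 + (Im w)\<^sup>2 > 0" using w(3) by (simp add: add_nonneg_pos)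
    have "(1/2 - Re w) / (1 + (2 * pi)\<^sup>2) \<le> (1/2 - Re w) / ((1/2 - Re w)\<^sup>2 + (Im w)\<^sup>2)"
      using d dpos rw by (intro divide_left_mono mult_pos_pos) auto
    also have "\<dots> \<le> real (zmult Xi w) * ((1/2 - Re w) / ((1/2 - Re w)\<^sup>2 + (Im w)\<^sup>2))"
      using mult_right_mono[OF m1, of "(1/2 - Re w) / ((1/2 - Re w)\<^sup>2 + (Im w)\<^sup>2)"] rw dpos by simp
    also have "\<dots> = Re (of_nat (zmult Xi w) / (1/2 - w))" by (simp add: Re_divide)
    finally show ?thesis .
  qed
  \<comment> \<open>The numerators 1/2 - Re z and 1/2 + Re z of the pair add up to 1, wherever z
    lies in the strip.\<close>
  have "1 / (1 + (2 * pi)\<^sup>2) = (1/2 - Re z) / (1 + (2 * pi)\<^sup>2) + (1/2 - Re (- z)) / (1 + (2 * pi)\<^sup>2)"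
    by (simp add: add_divide_distrib[symmetric])
  also have "\<dots> \<le> Re (of_nat (zmult Xi z) / (1/2 - z)) + Re (of_nat (zmult Xi (- z)) / (1/2 - (- z)))"
    using z le by (intro add_mono term_ge) (auto simp: Xi_even)
  also have "\<dots> = (\<Sum>w\<in>{z, - z}. Re (of_nat (zmult Xi w) / (1/2 - w)))"
    using zS(3) by (subst sum.insert) auto
  also have "\<dots> \<le> (\<Sum>w\<in>S. Re (of_nat (zmult Xi w) / (1/2 - w)))"
    using zS fin term_nonneg by (intro sum_mono2) auto
  also have "\<dots> = Re (\<Sum>w\<in>S. of_nat (zmult Xi w) / (1/2 - w))" by simp
  also have "\<dots> < D + e"
    using close abs_Re_le_cmod[of "of_real D - (\<Sum>w\<in>S. of_nat (zmult Xi w) / (1/2 - w))"] by (simp add: abs_less_iff)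
  finally show False by (simp add: e_def)
qed

section \<open>Partial summation\<close>

lemma N_mono: "S \<le> T \<Longrightarrow> N S \<le> N T"
proof -
  assume "S \<le> T"
  then have "(\<Sum>z\<in>upper_zeros S. real (zmult Xi z)) \<le> (\<Sum>z\<in>upper_zeros T. real (zmult Xi z))"
    by (intro sum_mono2 finite_upper_zeros) (auto simp: upper_zeros_def)
  then show ?thesis unfolding N_eq[symmetric] by simp
qed

lemma N_nonneg: "0 \<le> N T"
proof -
  have "0 \<le> (\<Sum>z\<in>upper_zeros T. real (zmult Xi z))" by (intro sum_nonneg) simp
  then show ?thesis unfolding N_eq[symmetric] by simp
qed

lemma N_measurable [measurable]: "(\<lambda>t. real_of_int (N t)) \<in> borel_measurable borel"
  by (rule borel_measurable_mono) (auto simp: mono_def N_mono)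

lemma Q_measurable [measurable]: "Q \<in> borel_measurable borel"
  unfolding Q_def[abs_def] L_def by measurable

lemma Q_integrable: "set_integrable lborel {2 * pi..} (\<lambda>t. Q t / t\<^sup>2)"
proof -
  obtain T0 where T0: "\<And>T. T \<ge> T0 \<Longrightarrow> \<bar>Q T\<bar> \<le> T powr (4/5)"
    using Q_bound unfolding eventually_at_top_linorder by blast
  define T1 where "T1 = max T0 (2 * pi)"
  have T1: "T1 \<ge> 2 * pi" by (simp add: T1_def)
  then have T1_pos: "T1 > 0" using pi_gt_zero by linarith
  have "set_integrable lborel {T1..} (\<lambda>t. Q t / t\<^sup>2)"
  proof (rule set_integrable_bound)
    have "((\<lambda>t. t powr (- 6/5)) has_integral - (T1 powr (- 6/5 + 1)) / (- 6/5 + 1)) {T1..}"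
      by (rule has_integral_powr_to_inf) (use T1_pos in auto)
    then have "(\<lambda>t. t powr (- 6/5)) absolutely_integrable_on {T1..}"
      by (intro nonnegative_absolutely_integrable_1) (auto simp: has_integral_integrable)
    then show "set_integrable lborel {T1..} (\<lambda>t. t powr (- 6/5))"
      unfolding set_integrable_def by (subst (asm) integrable_completion) auto
    show "set_borel_measurable lborel {T1..} (\<lambda>t. Q t / t\<^sup>2)"
      unfolding set_borel_measurable_def by measurable
    show "AE t in lborel. t \<in> {T1..} \<longrightarrow> norm (Q t / t\<^sup>2) \<le> norm (t powr (- 6/5))"
    proof (intro AE_I2 impI)
      fix t assume t: "t \<in> {T1..}"
      then have tp: "t > 0" using T1_pos by auto
      have "\<bar>Q t\<bar> \<le> t powr (4/5)" using t by (intro T0) (auto simp: T1_def)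
      then have "\<bar>Q t\<bar> / t\<^sup>2 \<le> t powr (4/5) / t powr 2" using tp by (simp add: divide_right_mono)
      also have "\<dots> = t powr (- 6/5)" by (simp flip: powr_diff)
      finally show "norm (Q t / t\<^sup>2) \<le> norm (t powr (- 6/5))" by simp
    qed
  qed
  moreover have "set_integrable lborel {2 * pi..T1} (\<lambda>t. Q t / t\<^sup>2)"
  proof (rule set_integrable_bound)
    define M where "M = real_of_int (N T1) + (T1 * (\<bar>ln T1\<bar> + \<bar>ln (2 * pi)\<bar> + 1) + 1)"
    show "set_integrable lborel {2 * pi..T1} (\<lambda>t. M)"
      unfolding set_integrable_def
      by (intro integrable_scaleR_left) (simp add: integrable_indicator_iff emeasure_lborel_Icc_eq)
    show "set_borel_measurable lborel {2 * pi..T1} (\<lambda>t. Q t / t\<^sup>2)"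
      unfolding set_borel_measurable_def by measurable
    show "AE t in lborel. t \<in> {2 * pi..T1} \<longrightarrow> norm (Q t / t\<^sup>2) \<le> norm M"
    proof (intro AE_I2 impI)
      fix t assume t: "t \<in> {2 * pi..T1}"
      then have t1: "t \<ge> 1" "2 * pi \<le> t" "t \<le> T1" using pi_ge_two by auto
      have l: "0 \<le> ln (t / (2 * pi))" using t1 by (intro ln_ge_zero) (simp add: le_divide_eq)
      have "ln (t / (2 * pi)) \<le> ln T1 - ln (2 * pi)"
        using t1 by (simp add: ln_div)
      then have l2: "\<bar>ln (t / (2 * pi)) - 1\<bar> \<le> \<bar>ln T1\<bar> + \<bar>ln (2 * pi)\<bar> + 1" using l by linarith
      have "t / (2 * pi) \<le> T1" using t1 mult_mono[of 1 "2 * pi" t T1] pi_ge_two by (simp add: divide_le_eq mult.commute)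
      then have "\<bar>t / (2 * pi) * (ln (t / (2 * pi)) - 1)\<bar> \<le> T1 * (\<bar>ln T1\<bar> + \<bar>ln (2 * pi)\<bar> + 1)"
        unfolding abs_mult using l2 t1 T1_pos by (intro mult_mono) auto
      then have L: "\<bar>L t\<bar> \<le> T1 * (\<bar>ln T1\<bar> + \<bar>ln (2 * pi)\<bar> + 1) + 1" unfolding L_def by linarith
      have "0 \<le> real_of_int (N t)" "real_of_int (N t) \<le> real_of_int (N T1)"
        using N_nonneg[of t] N_mono[OF t1(3)] by auto
      then have "\<bar>Q t\<bar> \<le> M" using L unfolding Q_def M_def by linarith
      moreover have "\<bar>Q t\<bar> / t\<^sup>2 \<le> \<bar>Q t\<bar>"
        using t1 by (simp add: divide_le_eq mult_le_cancel_left1 one_le_power)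
      ultimately show "norm (Q t / t\<^sup>2) \<le> norm M" by simp
    qed
  qed
  ultimately have "set_integrable lborel ({2 * pi..T1} \<union> {T1..}) (\<lambda>t. Q t / t\<^sup>2)"
    by (intro set_integrable_Un) auto
  moreover have "{2 * pi..T1} \<union> {T1..} = {2 * pi..}" using T1 by auto
  ultimately show ?thesis by simp
qed

lemma Q_integral_tendsto:
  "((\<lambda>T. LBINT t:{2 * pi..T}. Q t / t\<^sup>2) \<longlongrightarrow> (LBINT t:{2 * pi..}. Q t / t\<^sup>2)) at_top"
  by (rule tendsto_set_lebesgue_integral_at_top[OF _ Q_integrable]) auto

lemma inverse_square_integral:
  fixes a b :: real
  assumes "0 < a" "a \<le> b"
  shows "set_integrable lborel {a..b} (\<lambda>t. 1 / t\<^sup>2)" "(LBINT t:{a..b}. 1 / t\<^sup>2) = 1 / a - 1 / b"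
proof -
  have "has_bochner_integral lborel (\<lambda>t. (1 / t\<^sup>2) * indicator {a..b} t) (- 1 / b - - 1 / a)"
    by (rule has_bochner_integral_FTC_Icc_real)
       (use assms in \<open>auto intro!: derivative_eq_intros continuous_intros simp: power2_eq_square\<close>)
  then show "set_integrable lborel {a..b} (\<lambda>t. 1 / t\<^sup>2)" "(LBINT t:{a..b}. 1 / t\<^sup>2) = 1 / a - 1 / b"
    by (auto simp: has_bochner_integral_iff set_integrable_def set_lebesgue_integral_def mult.commute)
qed

lemma L_integral:
  assumes "2 * pi \<le> T"
  shows "set_integrable lborel {2 * pi..T} (\<lambda>t. L t / t\<^sup>2)"
    "(LBINT t:{2 * pi..T}. L t / t\<^sup>2) + L T / T = (ln (T / (2 * pi)))\<^sup>2 / (4 * pi) - 1 / (16 * pi)"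
proof -
  \<comment> \<open>At t = 2 pi both logarithms vanish and W is -7/(16 pi). Together with the -1/(2
    pi) in L(T)/T this leaves -1/(16 pi); the other lower terms of W T cancel against
    L(T)/T.\<close>
  define W where "W = (\<lambda>t. (ln (t / (2 * pi)))\<^sup>2 / (4 * pi) - ln (t / (2 * pi)) / (2 * pi) - 7 / (8 * t))"
  have "has_bochner_integral lborel (\<lambda>t. (L t / t\<^sup>2) * indicator {2 * pi..T} t) (W T - W (2 * pi))"
  proof (rule has_bochner_integral_FTC_Icc_real[OF assms])
    fix t :: real assume "2 * pi \<le> t" "t \<le> T"
    then have t: "t > 0" using pi_gt_zero by linarith
    show "(W has_real_derivative L t / t\<^sup>2) (at t)"
      unfolding W_def L_def using t
      by (auto intro!: derivative_eq_intros simp: field_simps power2_eq_square)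
    show "isCont (\<lambda>t. L t / t\<^sup>2) t"
      unfolding L_def using t by (intro continuous_intros) auto
  qed
  then have *: "set_integrable lborel {2 * pi..T} (\<lambda>t. L t / t\<^sup>2)" "(LBINT t:{2 * pi..T}. L t / t\<^sup>2) = W T - W (2 * pi)"
    by (auto simp: has_bochner_integral_iff set_integrable_def set_lebesgue_integral_def mult.commute)
  show "set_integrable lborel {2 * pi..T} (\<lambda>t. L t / t\<^sup>2)" by (rule *)
  have "T > 0" using assms pi_gt_zero by linarith
  then have "W T - W (2 * pi) + L T / T = (ln (T / (2 * pi)))\<^sup>2 / (4 * pi) - 1 / (16 * pi)"
    unfolding W_def L_def by (simp add: field_simps)
  then show "(LBINT t:{2 * pi..T}. L t / t\<^sup>2) + L T / T = (ln (T / (2 * pi)))\<^sup>2 / (4 * pi) - 1 / (16 * pi)"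
    unfolding *(2) .
qed

text \<open>Each zero contributes \<open>1/\<gamma> = 1/T + \<integral>\<^sub>\<gamma>\<^sup>T t\<^sup>-\<^sup>2 dt\<close>; the lower limit may be taken to be \<open>2\<pi>\<close>
  because every zero satisfies \<open>\<gamma> > 2\<pi>\<close>.\<close>

lemma G_partial_summation:
  assumes T: "2 * pi \<le> T"
  shows "set_integrable lborel {2 * pi..T} (\<lambda>t. real_of_int (N t) / t\<^sup>2)"
    "G T = real_of_int (N T) / T + (LBINT t:{2 * pi..T}. real_of_int (N t) / t\<^sup>2)"
proof -
  have Tpos: "T > 0" using T pi_gt_zero by linarith
  define m where "m = (\<lambda>z. real (zmult Xi z))"
  have Im: "2 * pi < Im z" "Im z \<le> T" if "z \<in> upper_zeros T" for z
    using Im_Xi_zero_gt[of z] that by (auto simp: upper_zeros_def)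
  have Neq: "indicator {2 * pi..T} t *\<^sub>R (real_of_int (N t) / t\<^sup>2) = (\<Sum>z\<in>upper_zeros T. m z * (indicator {Im z..T} t *\<^sub>R (1 / t\<^sup>2)))" for t
  proof (cases "t \<in> {2 * pi..T}")
    case True
    have "upper_zeros t = {z \<in> upper_zeros T. Im z \<le> t}" using True by (auto simp: upper_zeros_def)
    then have "real_of_int (N t) = (\<Sum>z\<in>{z \<in> upper_zeros T. Im z \<le> t}. m z)" by (simp add: N_eq m_def)
    also have "\<dots> = (\<Sum>z\<in>upper_zeros T. if Im z \<le> t then m z else 0)"
      by (rule sum.inter_filter[OF finite_upper_zeros])
    finally have "real_of_int (N t) / t\<^sup>2 = (\<Sum>z\<in>upper_zeros T. (if Im z \<le> t then m z else 0) / t\<^sup>2)"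
      by (simp only: sum_divide_distrib)
    also have "\<dots> = (\<Sum>z\<in>upper_zeros T. m z * (indicator {Im z..T} t *\<^sub>R (1 / t\<^sup>2)))"
      using True by (intro sum.cong) (auto simp: indicator_def)
    finally show ?thesis using True by simp
  next
    case False
    \<comment> \<open>For t < 2 pi the left side is cut off, and the right side vanishes because no
      zero lies that low.\<close>
    have "m z * (indicator {Im z..T} t *\<^sub>R (1 / t\<^sup>2)) = 0" if "z \<in> upper_zeros T" for z
      using False Im(1)[OF that] by (auto simp: indicator_def)
    then have "(\<Sum>z\<in>upper_zeros T. m z * (indicator {Im z..T} t *\<^sub>R (1 / t\<^sup>2))) = 0"
      by (intro sum.neutral) blast
    then show ?thesis using False by simp
  qed
  have I: "integrable lborel (\<lambda>t. indicator {Im z..T} t *\<^sub>R (1 / t\<^sup>2))"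
    "(\<integral>t. indicator {Im z..T} t *\<^sub>R (1 / t\<^sup>2) \<partial>lborel) = 1 / Im z - 1 / T" if "z \<in> upper_zeros T" for z
    using inverse_square_integral[of "Im z" T] Im[OF that] pi_gt_zero
    unfolding set_integrable_def set_lebesgue_integral_def by auto
  show "set_integrable lborel {2 * pi..T} (\<lambda>t. real_of_int (N t) / t\<^sup>2)"
    unfolding set_integrable_def Neq using I by (intro Bochner_Integration.integrable_sum integrable_mult_right) auto
  have "(LBINT t:{2 * pi..T}. real_of_int (N t) / t\<^sup>2) = (\<Sum>z\<in>upper_zeros T. m z * (1 / Im z - 1 / T))"
    unfolding set_lebesgue_integral_def Neq
  proof (subst Bochner_Integration.integral_sum)
    show "(\<Sum>z\<in>upper_zeros T. \<integral>t. m z * (indicator {Im z..T} t *\<^sub>R (1 / t\<^sup>2)) \<partial>lborel) =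
        (\<Sum>z\<in>upper_zeros T. m z * (1 / Im z - 1 / T))"
      by (intro sum.cong refl) (simp only: Bochner_Integration.integral_mult_right[OF I(1)] I(2))
  qed (intro integrable_mult_right I)
  also have "\<dots> = G T - real_of_int (N T) / T"
    by (simp add: G_eq N_eq m_def right_diff_distrib sum_subtractf sum_divide_distrib)
  finally show "G T = real_of_int (N T) / T + (LBINT t:{2 * pi..T}. real_of_int (N t) / t\<^sup>2)" by simp
qed

lemma G_eq_Q:
  assumes T: "2 * pi \<le> T"
  shows "G T - (ln (T / (2 * pi)))\<^sup>2 / (4 * pi) = (LBINT t:{2 * pi..T}. Q t / t\<^sup>2) - 1 / (16 * pi) + Q T / T"
proof -
  have "(LBINT t:{2 * pi..T}. real_of_int (N t) / t\<^sup>2) - (LBINT t:{2 * pi..T}. L t / t\<^sup>2) = (LBINT t:{2 * pi..T}. real_of_int (N t) / t\<^sup>2 - L t / t\<^sup>2)"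
    by (rule set_integral_diff(2)[symmetric, OF G_partial_summation(1)[OF T] L_integral(1)[OF T]])
  also have "\<dots> = (LBINT t:{2 * pi..T}. Q t / t\<^sup>2)" by (simp add: Q_def diff_divide_distrib)
  finally show ?thesis
    using G_partial_summation(2)[OF T] L_integral(2)[OF T] by (simp add: Q_def diff_divide_distrib)
qed

theorem theorem1:
  "\<exists>H :: real.
     ((\<lambda>T. G T - (ln (T / (2 * pi)))\<^sup>2 / (4 * pi)) \<longlongrightarrow> H) at_top \<and>
     set_integrable lborel {2 * pi..} (\<lambda>t. Q t / t\<^sup>2) \<and>
     H = (LBINT t:{2 * pi..}. Q t / t\<^sup>2) - 1 / (16 * pi)"
proof (intro exI conjI)
  show "set_integrable lborel {2 * pi..} (\<lambda>t. Q t / t\<^sup>2)" by (rule Q_integrable)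
  have "((\<lambda>T. Q T / T) \<longlongrightarrow> 0) at_top"
  proof (rule Lim_null_comparison)
    show "eventually (\<lambda>T. norm (Q T / T) \<le> T powr (4/5) / T) at_top"
      using Q_bound eventually_gt_at_top[of 0]
      by eventually_elim (simp add: divide_right_mono)
    show "((\<lambda>T::real. T powr (4/5) / T) \<longlongrightarrow> 0) at_top" by real_asymp
  qed
  then have "((\<lambda>T. (LBINT t:{2 * pi..T}. Q t / t\<^sup>2) - 1 / (16 * pi) + Q T / T) \<longlongrightarrow>
      (LBINT t:{2 * pi..}. Q t / t\<^sup>2) - 1 / (16 * pi) + 0) at_top"
    by (intro tendsto_intros Q_integral_tendsto)
  moreover have "eventually (\<lambda>T. G T - (ln (T / (2 * pi)))\<^sup>2 / (4 * pi) =
      (LBINT t:{2 * pi..T}. Q t / t\<^sup>2) - 1 / (16 * pi) + Q T / T) at_top"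
    using eventually_ge_at_top[of "2 * pi"] by eventually_elim (rule G_eq_Q)
  ultimately show "((\<lambda>T. G T - (ln (T / (2 * pi)))\<^sup>2 / (4 * pi)) \<longlongrightarrow>
      (LBINT t:{2 * pi..}. Q t / t\<^sup>2) - 1 / (16 * pi)) at_top"
    by (simp add: tendsto_cong)
qed simp

end
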